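(* Let $m\ge1$ and let $f$ be a continuous probability density on $\mathbb{R}^m$ with finite second moments. Let $X\sim f$, with mean $\mu=\mathbf{E}[X]$ and covariance matrix $\Sigma=\mathbf{Var}(X)$. Assume that $H(f)$ is finite, that $f$ is bounded above, and that $\mathbf{E}\|X\|^{m+\delta}<\infty$ for some $\delta>0$. Let $X_1,X_2,\dots$ be i.i.d. random vectors with density $f$, and for a fixed integer $k\ge1$ let $T_{N,k}^{\mathrm{KL}}$ be the statistic $$T_{N,k}^{\mathrm{KL}}=\tfrac12\log\bigl[(2\pi e)^m\det(S_N)\bigr]-\widehat H_{N,k}(f)$$ computed from $X_1,\dots,X_N$. Then, for any fixed $k\ge1$, $$T_{N,k}^{\mathrm{KL}}\ \xrightarrow{\ p\ }\ H(\phi_{\mu,\Sigma})-H(f)=D_{KL}(f\|\phi_{\mu,\Sigma})\qquad\text{as }N\to\infty .$$ In particular, $T_{N,k}^{\mathrm{KL}}\xrightarrow{p}0$ if $X\sim N_m(\mu,\Sigma)$, and, for any such $f$ with mean $\mu$ and covariance $\Sigma$ that is not Gaussian, $T_{N,k}^{\mathrm{KL}}\xrightarrow{p}\xi(f)$ for some constant $\xi(f)>0$.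
   Context: Differential Shannon entropy: $H(f)=-\int_{\mathbb{R}^m} f\log f\,dx$. Kullback-Leibler divergence: $D_{KL}(f\|g)=\int_{\mathbb{R}^m} f\log(f/g)\,dx$. $\phi_{\mu,\Sigma}$ is the density of the Gaussian distribution $N_m(\mu,\Sigma)$ on $\mathbb{R}^m$, for which $H(\phi_{\mu,\Sigma})=\frac12\log[(2\pi e)^m\det(\Sigma)]$. $\|\cdot\|$ is the Euclidean norm and $\xrightarrow{p}$ denotes convergence in probability. Sample mean and covariance: $\bar X_N=\frac1N\sum_{i=1}^N X_i$ and $S_N=\frac1{N-1}\sum_{i=1}^N (X_i-\bar X_N)(X_i-\bar X_N)^{\top}$. $k$-nearest-neighbor (Kozachenko-Leonenko) entropy estimator, for $N>k$: let $\rho_{i,k,N}$ be the Euclidean distance from $X_i$ to its $k$th nearest neighbor among $\{X_j: 1\le j\le N,\ j\ne i\}$, let $V_m=\pi^{m/2}/\Gamma(\frac m2+1)$ be the volume of the unit ball in $\mathbb{R}^m$, and let $\psi$ be the digamma function. Then $$\widehat H_{N,k}(f)=\psi(N)-\psi(k)+\log V_m+\frac mN\sum_{i=1}^N\log\rho_{i,k,N}.$$ *)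

theory Defs
  imports "HOL-Probability.Probability"
begin

text \<open>
  The dimension is \<open>m = CARD('m)\<close>, all logarithms are natural, and Lebesgue measure on
  \<open>real ^ 'm\<close> is \<^const>\<open>lborel\<close>. Densities are real-valued functions.
\<close>

section \<open>Entropy and divergence of densities\<close>

text \<open>
  As \<open>ln 0 = 0\<close>, the convention \<open>0 log 0 = 0\<close> is built in. The Bochner integral is \<open>0\<close> when the
  integrand is not integrable, so finiteness of the entropy is the separate predicate
  \<open>finite_diff_entropy\<close>.
\<close>

definition diff_entropy :: "(real ^ 'm::finite \<Rightarrow> real) \<Rightarrow> real" where
  "diff_entropy f = - (\<integral>x. f x * ln (f x) \<partial>lborel)"

definition finite_diff_entropy :: "(real ^ 'm::finite \<Rightarrow> real) \<Rightarrow> bool" where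
  "finite_diff_entropy f \<longleftrightarrow> integrable lborel (\<lambda>x. f x * ln (f x))"

text \<open>
  As \<open>a / 0 = 0\<close>, this is the divergence only if \<open>f\<close> vanishes almost everywhere that \<open>g\<close> does.
\<close>

definition KL_div :: "(real ^ 'm::finite \<Rightarrow> real) \<Rightarrow> (real ^ 'm \<Rightarrow> real) \<Rightarrow> real" where
  "KL_div f g = (\<integral>x. f x * ln (f x / g x) \<partial>lborel)"

lemma KL_div_eq_KL_divergence:
  fixes f g :: "real ^ 'm::finite \<Rightarrow> real"
  assumes "f \<in> borel_measurable borel" "g \<in> borel_measurable borel"
    and "\<And>x. 0 \<le> f x" "\<And>x. 0 \<le> g x" "\<And>x. g x = 0 \<Longrightarrow> f x = 0"
  shows "KL_div f g = KL_divergence (exp 1) (density lborel g) (density lborel f)"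
  using assms
  by (subst sigma_finite_measure.KL_density_density)
     (auto simp: KL_div_def log_def sigma_finite_lborel)

lemma (in prob_space) diff_entropy_eq_entropy:
  fixes X :: "'a \<Rightarrow> real ^ 'm::finite"
  assumes "distributed M lborel X f" "\<And>x. 0 \<le> f x"
  shows "diff_entropy f = entropy (exp 1) lborel X"
proof -
  interpret information_space M "exp 1"
    by unfold_locales simp
  show ?thesis
    using assms by (subst entropy_distr) (auto simp: diff_entropy_def log_def)
qed

section \<open>Moments and the normal distribution\<close>

definition covariance_matrix :: "'a measure \<Rightarrow> ('a \<Rightarrow> real ^ 'm::finite) \<Rightarrow> real ^ 'm ^ 'm" where
  "covariance_matrix M X =
     (\<chi> a b. \<integral>\<omega>. (X \<omega> - integral\<^sup>L M X) $ a * (X \<omega> - integral\<^sup>L M X) $ b \<partial>M)"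

definition mvn_density :: "real ^ 'm::finite \<Rightarrow> real ^ 'm ^ 'm \<Rightarrow> real ^ 'm \<Rightarrow> real" where
  "mvn_density \<mu> S x =
     exp (- ((x - \<mu>) \<bullet> (matrix_inv S *v (x - \<mu>))) / 2) / sqrt ((2 * pi) ^ CARD('m) * det S)"

definition symmetric_pos_def :: "real ^ 'm::finite ^ 'm \<Rightarrow> bool" where
  "symmetric_pos_def S \<longleftrightarrow> transpose S = S \<and> (\<forall>v. v \<noteq> 0 \<longrightarrow> 0 < v \<bullet> (S *v v))"

definition mvn_distributed ::
    "'a measure \<Rightarrow> ('a \<Rightarrow> real ^ 'm::finite) \<Rightarrow> real ^ 'm \<Rightarrow> real ^ 'm ^ 'm \<Rightarrow> bool" where
  "mvn_distributed M X \<mu> S \<longleftrightarrow> symmetric_pos_def S \<and> distributed M lborel X (mvn_density \<mu> S)"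

section \<open>Statistics of a sample \<open>x 1, \<dots>, x N\<close> (the value \<open>x 0\<close> is never used)\<close>

definition sample_mean :: "nat \<Rightarrow> (nat \<Rightarrow> real ^ 'm::finite) \<Rightarrow> real ^ 'm" where
  "sample_mean N x = (1 / real N) *\<^sub>R (\<Sum>i=1..N. x i)"

definition sample_cov :: "nat \<Rightarrow> (nat \<Rightarrow> real ^ 'm::finite) \<Rightarrow> real ^ 'm ^ 'm" where
  "sample_cov N x =
     (\<chi> a b. (\<Sum>i=1..N. (x i - sample_mean N x) $ a * (x i - sample_mean N x) $ b) / (real N - 1))"

text \<open>
  The \<open>k\<close>th entry of the sorted list (with repetitions) of the distances from \<open>x i\<close> to the other
  points. Meaningful only for \<open>1 \<le> k < N\<close> and \<open>1 \<le> i \<le> N\<close>.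
\<close>

definition knn_dist :: "nat \<Rightarrow> nat \<Rightarrow> (nat \<Rightarrow> real ^ 'm::finite) \<Rightarrow> nat \<Rightarrow> real" where
  "knn_dist k N x i = sort (map (\<lambda>j. norm (x i - x j)) [j \<leftarrow> [1..<Suc N]. j \<noteq> i]) ! (k - 1)"

definition KL_entropy_est :: "nat \<Rightarrow> nat \<Rightarrow> (nat \<Rightarrow> real ^ 'm::finite) \<Rightarrow> real" where
  "KL_entropy_est k N x =
     Digamma (real N) - Digamma (real k) + ln (unit_ball_vol (real CARD('m)))
       + real CARD('m) / real N * (\<Sum>i=1..N. ln (knn_dist k N x i))"

definition T_KL :: "nat \<Rightarrow> nat \<Rightarrow> (nat \<Rightarrow> real ^ 'm::finite) \<Rightarrow> real" where
  "T_KL k N x =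
     ln ((2 * pi * exp 1) ^ CARD('m) * det (sample_cov N x)) / 2 - KL_entropy_est k N x"

section \<open>Convergence in probability to a constant\<close>

text \<open>
  \<^const>\<open>measure\<close> is \<open>0\<close> on non-measurable sets, so measurability is part of the definition. It is
  required only eventually, because the statistics above are meaningful only for large \<open>N\<close>.
\<close>

definition tendsto_in_prob :: "'a measure \<Rightarrow> (nat \<Rightarrow> 'a \<Rightarrow> real) \<Rightarrow> real \<Rightarrow> bool" where
  "tendsto_in_prob M Y c \<longleftrightarrow>
     (\<forall>\<^sub>F N in sequentially. Y N \<in> borel_measurable M) \<and>
     (\<forall>\<epsilon>>0. (\<lambda>N. measure M {\<omega> \<in> space M. \<bar>Y N \<omega> - c\<bar> > \<epsilon>}) \<longlonglongrightarrow> 0)"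

end

theory Submission
  imports Defs
begin

text \<open>
  Write \<open>m\<close> for the dimension, \<open>V\<close> for the volume of the unit ball and \<open>Z\<^sub>i = ln (N V \<rho>\<^sub>i\<^sup>m)\<close>, so that the
  entropy estimator is \<open>\<psi>(N) - ln N - \<psi>(k)\<close> plus the mean of the \<open>Z\<^sub>i\<close>. With the deterministic radius
  \<open>r\<close> given by \<open>V r\<^sup>m = e\<^sup>t / N\<close>, the event \<open>t < Z\<^sub>i\<close> says that fewer than \<open>k\<close> of the other points lie
  within \<open>r\<close> of \<open>X\<^sub>i\<close>. The numbers of points in two disjoint small balls are asymptotically independent
  Poisson variables, and the intensities are \<open>f(x) e\<^sup>t\<close> because \<open>f\<close> is continuous. Hence the empirical survival
  function \<open>F\<^sub>N(t)\<close> of the \<open>Z\<^sub>i\<close> has a convergent mean and a vanishing variance, and it tends in \<open>L\<^sup>1\<close> to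
  \<open>g(t) = \<integral> f(x) P(Poisson(f(x) e\<^sup>t) < k) dx\<close>. The mean of the \<open>Z\<^sub>i\<close> differs from
  \<open>\<integral> (g(t) - 1{t < 0}) dt = \<psi>(k) + H(f)\<close> by \<open>\<integral> (F\<^sub>N(t) - g(t)) dt\<close>, to which dominated convergence applies:
  boundedness of \<open>f\<close> gives the tail \<open>O(e\<^sup>t)\<close> for \<open>t < 0\<close>, and for \<open>t \<ge> 0\<close> counting points in the cells of a
  grid inside a ball of radius \<open>e\<^bsup>t/2m\<^esup>\<close>, together with the moment assumption outside it, gives
  \<open>O(e\<^bsup>-t/2\<^esup>)\<close>.

  The term \<open>ln det S\<^sub>N\<close> converges by the weak law of large numbers, and the divergence from the Gaussian
  is computed by whitening and is positive by Gibbs' inequality with its equality case.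
\<close>

section \<open>Weak law of large numbers in \<open>L\<^sup>1\<close>\<close>

text \<open>The logarithms are unbounded at both ends and mutually dependent. Passing to survival
  functions confines every variance computation to averages of indicators; the logarithm enters only
  through an integral over t. Since a variance is nonnegative, an upper bound on the two-point
  probabilities is enough, so overlapping balls may receive the trivial bound 1. The compensator 1{t
  < 0} is the survival function of the constant 0. A Poisson count of mean exp t falls below k with
  the probability that a Gamma(k) variable exceeds exp t, so the compensated integral is the mean
  logarithm of that variable, Digamma k. The intensity f(x) shifts t by ln f(x), and this shift is
  the source of the entropy. The radius R = exp (t / 2m) balances two errors. Its m-th power exp (t
  / 2) is the square root of N V r^m = exp t, which leaves exp (- t / 2) for the grid count, and
  Markov's inequality gives the same rate outside the ball. The sample size cancels in both, so the
  bound is uniform in N. If r exceeds 2 R, which happens for t large compared with N, the grid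
  degenerates and a union bound over k + 1 points takes over.\<close>

lemmas integrable_mean_intros = integrable_abs Bochner_Integration.integrable_diff
  Bochner_Integration.integrable_divide_zero Bochner_Integration.integrable_sum

text \<open>Nonnegativity of the variance of |Z|. It turns second-moment bounds into L1 bounds, the
  form in which averages are controlled here.\<close>

lemma (in prob_space) expectation_abs_le:
  fixes Z :: "'a \<Rightarrow> real"
  assumes Z: "random_variable borel Z" and Z2: "integrable M (\<lambda>\<omega>. (Z \<omega>)\<^sup>2)"
  shows "expectation (\<lambda>\<omega>. \<bar>Z \<omega>\<bar>) \<le> sqrt (expectation (\<lambda>\<omega>. (Z \<omega>)\<^sup>2))"
proof -
  have "integrable M Z"
    by (rule square_integrable_imp_integrable[OF Z Z2])
  then have i: "integrable M (\<lambda>\<omega>. \<bar>Z \<omega>\<bar>)" by auto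
  have "0 \<le> variance (\<lambda>\<omega>. \<bar>Z \<omega>\<bar>)" by (rule variance_positive)
  also have "\<dots> = expectation (\<lambda>\<omega>. (Z \<omega>)\<^sup>2) - (expectation (\<lambda>\<omega>. \<bar>Z \<omega>\<bar>))\<^sup>2"
    using i Z2 by (subst variance_eq) auto
  finally show ?thesis by (intro real_le_rsqrt) simp
qed

text \<open>After centring, products of distinct variables have mean zero by independence, and only
  the N diagonal terms are left against the division by N^2. The constant 4 K^2 is the square of 2
  K, which bounds the centred variable because |c| \<le> K.\<close>

lemma (in prob_space) weak_law_L1_bounded:
  fixes Y :: "nat \<Rightarrow> 'a \<Rightarrow> real"
  assumes indep: "indep_vars (\<lambda>_. borel) Y {1..}"
    and bound: "\<And>i \<omega>. 1 \<le> i \<Longrightarrow> \<bar>Y i \<omega>\<bar> \<le> K"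
    and mean: "\<And>i. 1 \<le> i \<Longrightarrow> expectation (Y i) = c"
    and N: "1 \<le> N"
  shows "expectation (\<lambda>\<omega>. \<bar>(\<Sum>i=1..N. Y i \<omega>) / real N - c\<bar>) \<le> sqrt (4 * K\<^sup>2 / real N)"
proof -
  have rv: "random_variable borel (Y i)" if "1 \<le> i" for i using indep that by (auto simp: indep_vars_def)
  have intY: "integrable M (Y i)" if "1 \<le> i" for i
    using rv[OF that] bound[OF that] by (intro integrable_const_bound[where B=K]) auto
  have cK: "\<bar>c\<bar> \<le> K"
  proof -
    have "\<bar>c\<bar> = \<bar>expectation (Y 1)\<bar>" using mean[of 1] by simp
    also have "\<dots> \<le> expectation (\<lambda>\<omega>. \<bar>Y 1 \<omega>\<bar>)" by (rule integral_abs_bound)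
    also have "\<dots> \<le> expectation (\<lambda>\<omega>. K)" using bound[of 1] intY[of 1] by (intro integral_mono) auto
    finally show ?thesis by (simp add: prob_space)
  qed
  define Z where "Z i \<omega> = Y i \<omega> - c" for i \<omega>
  have Zrv: "random_variable borel (Z i)" if "1 \<le> i" for i using rv[OF that] unfolding Z_def by simp
  have Zb: "\<bar>Z i \<omega>\<bar> \<le> 2 * K" if "1 \<le> i" for i \<omega>
    using bound[OF that, of \<omega>] cK by (simp add: Z_def)
  have Zindep: "indep_vars (\<lambda>_. borel) Z {1..}"
    unfolding Z_def using indep_vars_compose2[OF indep, of "\<lambda>_ y. y - c" "\<lambda>_. borel"] by simp
  have ZZ: "\<bar>Z i \<omega> * Z j \<omega>\<bar> \<le> (2 * K)\<^sup>2" if "1 \<le> i" "1 \<le> j" for i j \<omega>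
    unfolding power2_eq_square abs_mult using Zb[OF that(1), of \<omega>] Zb[OF that(2), of \<omega>] by (intro mult_mono) auto
  have ZZint: "integrable M (\<lambda>\<omega>. Z i \<omega> * Z j \<omega>)" if "1 \<le> i" "1 \<le> j" for i j
    using Zrv[OF that(1)] Zrv[OF that(2)] ZZ[OF that] by (intro integrable_const_bound[where B="(2*K)\<^sup>2"]) auto
  have cov: "expectation (\<lambda>\<omega>. Z i \<omega> * Z j \<omega>) \<le> (if i = j then (2 * K)\<^sup>2 else 0)" if "1 \<le> i" "1 \<le> j" for i j
  proof (cases "i = j")
    case True
    have "expectation (\<lambda>\<omega>. Z i \<omega> * Z j \<omega>) \<le> expectation (\<lambda>\<omega>. (2 * K)\<^sup>2)"
      using ZZint[OF that] ZZ[OF that] by (intro integral_mono) (auto dest: abs_le_D1)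
    then show ?thesis using True by (simp add: prob_space)
  next
    case False
    have "expectation (\<lambda>\<omega>. \<Prod>l\<in>{i, j}. Z l \<omega>) = (\<Prod>l\<in>{i, j}. expectation (Z l))"
      using that intY by (intro indep_vars_lebesgue_integral indep_vars_subset[OF Zindep]) (auto simp: Z_def[abs_def])
    moreover have "expectation (Z i) = 0"
      unfolding Z_def using intY[OF that(1)] mean[OF that(1)] by (simp add: prob_space)
    ultimately show ?thesis using False by simp
  qed
  define A where "A \<omega> = (\<Sum>i=1..N. Y i \<omega>) / real N - c" for \<omega>
  have A: "A \<omega> = (\<Sum>i=1..N. Z i \<omega>) / real N" for \<omega>
    using N by (simp add: A_def Z_def sum_subtractf diff_divide_distrib)
  have A2: "(A \<omega>)\<^sup>2 = (\<Sum>i=1..N. \<Sum>j=1..N. Z i \<omega> * Z j \<omega>) / (real N)\<^sup>2" for \<omega>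
    by (simp add: A power_divide power2_eq_square sum_product)
  have "expectation (\<lambda>\<omega>. (A \<omega>)\<^sup>2) = (\<Sum>i=1..N. \<Sum>j=1..N. expectation (\<lambda>\<omega>. Z i \<omega> * Z j \<omega>)) / (real N)\<^sup>2"
  proof -
    have "expectation (\<lambda>\<omega>. \<Sum>i=1..N. \<Sum>j=1..N. Z i \<omega> * Z j \<omega>) = (\<Sum>i=1..N. expectation (\<lambda>\<omega>. \<Sum>j=1..N. Z i \<omega> * Z j \<omega>))"
      using ZZint by (intro Bochner_Integration.integral_sum Bochner_Integration.integrable_sum) auto
    also have "\<dots> = (\<Sum>i=1..N. \<Sum>j=1..N. expectation (\<lambda>\<omega>. Z i \<omega> * Z j \<omega>))"
      using ZZint by (intro sum.cong refl Bochner_Integration.integral_sum) auto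
    finally show ?thesis unfolding A2 by simp
  qed
  also have "\<dots> \<le> (\<Sum>i=1..N. \<Sum>j=1..N. if i = j then (2 * K)\<^sup>2 else 0) / (real N)\<^sup>2"
    using cov by (intro divide_right_mono sum_mono) auto
  also have "\<dots> = 4 * K\<^sup>2 / real N" using N by (simp add: power2_eq_square)
  finally have "expectation (\<lambda>\<omega>. (A \<omega>)\<^sup>2) \<le> 4 * K\<^sup>2 / real N" .
  moreover have "integrable M (\<lambda>\<omega>. (A \<omega>)\<^sup>2)" unfolding A2 using ZZint
    by (intro integrable_mean_intros) auto
  moreover have "random_variable borel A" unfolding A[abs_def] using Zrv by auto
  ultimately have "expectation (\<lambda>\<omega>. \<bar>A \<omega>\<bar>) \<le> sqrt (4 * K\<^sup>2 / real N)"
    using expectation_abs_le[of A] by (meson order_trans real_sqrt_le_mono)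
  then show ?thesis by (simp add: A_def)
qed

text \<open>With only a first moment at hand, the variables are truncated at level K. The truncated
  part obeys the bounded law; the mean size of the removed part tends to 0 as K grows, uniformly in
  the index because the variables are identically distributed.\<close>

lemma (in prob_space) weak_law_L1_real:
  fixes Y :: "nat \<Rightarrow> 'a \<Rightarrow> real"
  assumes indep: "indep_vars (\<lambda>_. borel) Y {1..}"
    and distr: "\<And>i. 1 \<le> i \<Longrightarrow> distr M borel (Y i) = distr M borel (Y 1)"
    and int: "integrable M (Y 1)"
  shows "(\<lambda>N. expectation (\<lambda>\<omega>. \<bar>(\<Sum>i=1..N. Y i \<omega>) / real N - expectation (Y 1)\<bar>)) \<longlonglongrightarrow> 0"
proof -
  let ?D = "\<lambda>N. expectation (\<lambda>\<omega>. \<bar>(\<Sum>i=1..N. Y i \<omega>) / real N - expectation (Y 1)\<bar>)"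
  have rv: "random_variable borel (Y i)" if "1 \<le> i" for i using indep that by (auto simp: indep_vars_def)
  have transfer: "expectation (\<lambda>\<omega>. g (Y i \<omega>)) = expectation (\<lambda>\<omega>. g (Y 1 \<omega>))"
    "integrable M (\<lambda>\<omega>. g (Y i \<omega>)) \<longleftrightarrow> integrable M (\<lambda>\<omega>. g (Y 1 \<omega>))"
    if "1 \<le> i" and [measurable]: "g \<in> borel_measurable borel" for i and g :: "real \<Rightarrow> real"
    using integral_distr[of "Y i" M borel g] integral_distr[of "Y 1" M borel g]
      integrable_distr_eq[of "Y i" M borel g] integrable_distr_eq[of "Y 1" M borel g] rv[of i] rv[of 1] that distr[of i] by auto
  define T :: "nat \<Rightarrow> real \<Rightarrow> real" where "T K y = indicator {- real K..real K} y * y" for K y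
  have [measurable]: "T K \<in> borel_measurable borel" for K unfolding T_def[abs_def] by measurable
  let ?R = "\<lambda>K. expectation (\<lambda>\<omega>. \<bar>Y 1 \<omega> - T K (Y 1 \<omega>)\<bar>)"
  have TK: "\<bar>T K y\<bar> \<le> real K" "\<bar>T K y\<bar> \<le> \<bar>y\<bar>" "\<bar>y - T K y\<bar> \<le> \<bar>y\<bar>" for K y
    by (auto simp: T_def indicator_def)
  have lim: "(\<lambda>K. ?R K) \<longlonglongrightarrow> (\<integral>\<omega>. 0 \<partial>M)"
  proof (rule integral_dominated_convergence[where w = "\<lambda>\<omega>. \<bar>Y 1 \<omega>\<bar>"])
    show "AE \<omega> in M. (\<lambda>K. \<bar>Y 1 \<omega> - T K (Y 1 \<omega>)\<bar>) \<longlonglongrightarrow> 0"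
    proof (intro AE_I2)
      fix \<omega>
      obtain K0 where "\<bar>Y 1 \<omega>\<bar> \<le> real K0" using real_arch_simple by blast
      then have "0 = \<bar>Y 1 \<omega> - T K (Y 1 \<omega>)\<bar>" if "K0 \<le> K" for K
        using that by (auto simp: T_def indicator_def)
      then have "\<forall>\<^sub>F K in sequentially. 0 = \<bar>Y 1 \<omega> - T K (Y 1 \<omega>)\<bar>"
        by (auto simp: eventually_sequentially)
      then show "(\<lambda>K. \<bar>Y 1 \<omega> - T K (Y 1 \<omega>)\<bar>) \<longlonglongrightarrow> 0" by (rule Lim_transform_eventually[OF tendsto_const])
    qed
  qed (use int rv[of 1] TK(3) in \<open>auto simp: abs_minus_commute\<close>)
  show ?thesis
  proof (rule LIMSEQ_I)
    fix \<epsilon> :: real assume "\<epsilon> > 0"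
    then have "\<forall>\<^sub>F K in sequentially. ?R K < \<epsilon> / 4"
      using order_tendstoD(2)[OF lim, of "\<epsilon>/4"] by simp
    \<comment> \<open>K is fixed before N tends to infinity. The truncation error enters twice, as
      an average over the sample and as a shift of the mean, hence the share \<epsilon>/4 for each;
      the bounded law receives \<epsilon>/2.\<close>
    then obtain K where K: "?R K < \<epsilon> / 4"
      by (meson eventually_happens trivial_limit_sequentially)
    define c where "c = expectation (\<lambda>\<omega>. T K (Y 1 \<omega>))"
    have intT: "integrable M (\<lambda>\<omega>. T K (Y i \<omega>))" if "1 \<le> i" for i
      using rv[OF that] TK(1) by (intro integrable_const_bound[where B="real K"]) auto
    have intYi: "integrable M (Y i)" if "1 \<le> i" for i using transfer(2)[OF that, of "\<lambda>y. y"] int by simp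
    have Tindep: "indep_vars (\<lambda>_. borel) (\<lambda>i \<omega>. T K (Y i \<omega>)) {1..}"
      by (rule indep_vars_compose2[OF indep]) auto
    have bd: "?D N \<le> \<epsilon> / 2 + sqrt (4 * (real K)\<^sup>2 / real N)"
      if N: "1 \<le> N" for N
    proof -
      define R where "R \<omega> = (\<Sum>i=1..N. \<bar>Y i \<omega> - T K (Y i \<omega>)\<bar>) / real N" for \<omega>
      define B where "B \<omega> = \<bar>(\<Sum>i=1..N. T K (Y i \<omega>)) / real N - c\<bar>" for \<omega>
      have intR: "integrable M R" unfolding R_def using intYi intT
        by (intro integrable_mean_intros) auto
      have intB: "integrable M B" unfolding B_def using intT
        by (intro integrable_mean_intros) auto
      have "\<bar>(\<Sum>i=1..N. Y i \<omega>) / real N - expectation (Y 1)\<bar> \<le> R \<omega> + B \<omega> + \<epsilon> / 4" for \<omega>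
      proof -
        have "\<bar>(\<Sum>i=1..N. Y i \<omega>) / real N - (\<Sum>i=1..N. T K (Y i \<omega>)) / real N\<bar> \<le> R \<omega>"
          unfolding R_def using N by (simp add: diff_divide_distrib[symmetric] sum_subtractf[symmetric] abs_divide divide_right_mono sum_abs)
        moreover have "\<bar>expectation (Y 1) - c\<bar> \<le> \<epsilon> / 4"
        proof -
          have "\<bar>expectation (Y 1) - c\<bar> = \<bar>expectation (\<lambda>\<omega>. Y 1 \<omega> - T K (Y 1 \<omega>))\<bar>"
            unfolding c_def using int intT[of 1] by simp
          also have "\<dots> \<le> ?R K" by (rule integral_abs_bound)
          finally show ?thesis using K by simp
        qed
        ultimately show ?thesis unfolding B_def by linarith
      qed
      then have "?D N \<le> expectation (\<lambda>\<omega>. R \<omega> + B \<omega> + \<epsilon> / 4)"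
        using intR intB intYi
        by (intro integral_mono integrable_mean_intros) auto
      also have "\<dots> = expectation R + expectation B + \<epsilon> / 4" using intR intB by (simp add: prob_space)
      also have "expectation R = (\<Sum>i=1..N. expectation (\<lambda>\<omega>. \<bar>Y i \<omega> - T K (Y i \<omega>)\<bar>)) / real N"
        unfolding R_def using intYi intT by (simp add: Bochner_Integration.integral_sum)
      also have "(\<Sum>i=1..N. expectation (\<lambda>\<omega>. \<bar>Y i \<omega> - T K (Y i \<omega>)\<bar>)) = (\<Sum>i=1..N. ?R K)"
        by (intro sum.cong refl transfer(1)[of _ "\<lambda>y. \<bar>y - T K y\<bar>"]) auto
      also have "\<dots> / real N \<le> \<epsilon> / 4" using K N by simp
      also have "expectation B \<le> sqrt (4 * (real K)\<^sup>2 / real N)"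
        unfolding B_def
      proof (rule weak_law_L1_bounded[OF Tindep])
        show "expectation (\<lambda>\<omega>. T K (Y i \<omega>)) = c" if "1 \<le> i" for i
          unfolding c_def by (rule transfer(1)[OF that]) auto
      qed (use TK(1) N in auto)
      finally show ?thesis by simp
    qed
    have "(\<lambda>N. sqrt (4 * (real K)\<^sup>2 * (1 / real N))) \<longlonglongrightarrow> sqrt (4 * (real K)\<^sup>2 * 0)"
      by (intro tendsto_intros lim_1_over_n)
    then have "(\<lambda>N. sqrt (4 * (real K)\<^sup>2 / real N)) \<longlonglongrightarrow> 0" by simp
    then have "\<forall>\<^sub>F N in sequentially. sqrt (4 * (real K)\<^sup>2 / real N) < \<epsilon> / 2"
      using \<open>\<epsilon> > 0\<close> by (intro order_tendstoD(2)) auto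
    then have "\<forall>\<^sub>F N in sequentially. norm (?D N - 0) < \<epsilon>"
      using eventually_ge_at_top[of 1]
    proof eventually_elim
      case (elim N)
      have "0 \<le> ?D N" by (rule integral_nonneg_AE) auto
      then show ?case using bd[OF elim(2)] elim(1) by simp
    qed
    then show "\<exists>no. \<forall>N\<ge>no. norm (?D N - 0) < \<epsilon>"
      by (simp add: eventually_sequentially)
  qed
qed

text \<open>Coordinatewise from the real case, since the Euclidean norm is at most the sum of the
  absolute coordinates. In the application the space consists of pairs of a vector and a
  matrix.\<close>

lemma (in prob_space) weak_law_L1:
  fixes Y :: "nat \<Rightarrow> 'a \<Rightarrow> 'v::euclidean_space"
  assumes indep: "indep_vars (\<lambda>_. borel) Y {1..}"
    and distr: "\<And>i. 1 \<le> i \<Longrightarrow> distr M borel (Y i) = distr M borel (Y 1)"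
    and int: "integrable M (Y 1)"
  shows "(\<lambda>N. expectation (\<lambda>\<omega>. norm ((\<Sum>i=1..N. Y i \<omega>) /\<^sub>R real N - expectation (Y 1)))) \<longlonglongrightarrow> 0"
proof (rule tendsto_sandwich[OF _ _ tendsto_const])
  let ?A = "\<lambda>N \<omega>. (\<Sum>i=1..N. Y i \<omega>) /\<^sub>R real N - expectation (Y 1)"
  have rv: "random_variable borel (Y i)" if "1 \<le> i" for i using indep that by (auto simp: indep_vars_def)
  have intYi: "integrable M (Y i)" if "1 \<le> i" for i
  proof -
    have id: "(\<lambda>y. y) \<in> borel_measurable (borel :: 'v measure)" by simp
    from integrable_distr_eq[OF rv[OF that] id] integrable_distr_eq[OF rv[OF order_refl] id] distr[OF that] int
    show ?thesis by metis
  qed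
  let ?E = "\<lambda>N b. expectation (\<lambda>\<omega>. \<bar>(\<Sum>i=1..N. Y i \<omega> \<bullet> b) / real N - expectation (\<lambda>\<omega>. Y 1 \<omega> \<bullet> b)\<bar>)"
  have "(\<lambda>N. ?E N b) \<longlonglongrightarrow> 0" for b
  proof (rule weak_law_L1_real)
    show "indep_vars (\<lambda>_. borel) (\<lambda>i \<omega>. Y i \<omega> \<bullet> b) {1..}" by (rule indep_vars_compose2[OF indep]) auto
    show "distr M borel (\<lambda>\<omega>. Y i \<omega> \<bullet> b) = distr M borel (\<lambda>\<omega>. Y 1 \<omega> \<bullet> b)" if "1 \<le> i" for i
    proof -
      have g: "(\<lambda>y. y \<bullet> b) \<in> borel_measurable (borel :: 'v measure)" by simp
      from distr_distr[OF g rv[OF that]] distr_distr[OF g rv[OF order_refl]] distr[OF that]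
      show ?thesis by (metis (mono_tags, lifting) comp_def distr_cong)
    qed
  qed (use int in auto)
  then have "(\<lambda>N. \<Sum>b\<in>Basis. ?E N b) \<longlonglongrightarrow> (\<Sum>b\<in>(Basis :: 'v set). 0)" by (intro tendsto_sum)
  then show "(\<lambda>N. \<Sum>b\<in>Basis. ?E N b) \<longlonglongrightarrow> 0" by simp
  show "\<forall>\<^sub>F N in sequentially. expectation (\<lambda>\<omega>. norm (?A N \<omega>)) \<le> (\<Sum>b\<in>Basis. ?E N b)"
  proof (intro always_eventually allI)
    fix N
    have I1: "integrable M (\<lambda>\<omega>. norm (?A N \<omega>))"
      by (intro integrable_norm Bochner_Integration.integrable_diff integrable_scaleR_right Bochner_Integration.integrable_sum intYi integrable_const) auto
    have I2: "integrable M (\<lambda>\<omega>. \<bar>(\<Sum>i=1..N. Y i \<omega> \<bullet> b) / real N - expectation (\<lambda>\<omega>. Y 1 \<omega> \<bullet> b)\<bar>)" for b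
      by (intro integrable_mean_intros integrable_inner_left intYi integrable_const) auto
    have "expectation (\<lambda>\<omega>. norm (?A N \<omega>))
      \<le> expectation (\<lambda>\<omega>. \<Sum>b\<in>Basis. \<bar>(\<Sum>i=1..N. Y i \<omega> \<bullet> b) / real N - expectation (\<lambda>\<omega>. Y 1 \<omega> \<bullet> b)\<bar>)"
    proof (rule integral_mono)
      fix \<omega>
      have "norm (?A N \<omega>) \<le> (\<Sum>b\<in>Basis. \<bar>?A N \<omega> \<bullet> b\<bar>)"
        by (rule norm_le_l1)
      also have "\<dots> = (\<Sum>b\<in>Basis. \<bar>(\<Sum>i=1..N. Y i \<omega> \<bullet> b) / real N - expectation (\<lambda>\<omega>. Y 1 \<omega> \<bullet> b)\<bar>)"
      proof (intro sum.cong refl)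
        fix b :: 'v
        have "expectation (\<lambda>\<omega>. Y 1 \<omega> \<bullet> b) = expectation (Y 1) \<bullet> b" using int by (rule integral_inner_left)
        then show "\<bar>?A N \<omega> \<bullet> b\<bar> = \<bar>(\<Sum>i=1..N. Y i \<omega> \<bullet> b) / real N - expectation (\<lambda>\<omega>. Y 1 \<omega> \<bullet> b)\<bar>"
          by (simp only: inner_diff_left inner_scaleR_left inner_sum_left divide_inverse mult.commute)
      qed
      finally show "norm (?A N \<omega>) \<le> (\<Sum>b\<in>Basis. \<bar>(\<Sum>i=1..N. Y i \<omega> \<bullet> b) / real N - expectation (\<lambda>\<omega>. Y 1 \<omega> \<bullet> b)\<bar>)" .
    qed (intro I1, intro Bochner_Integration.integrable_sum I2)
    also have "\<dots> = (\<Sum>b\<in>Basis. ?E N b)" by (intro Bochner_Integration.integral_sum I2)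
    finally show "expectation (\<lambda>\<omega>. norm (?A N \<omega>)) \<le> (\<Sum>b\<in>Basis. ?E N b)" .
  qed
  show "\<forall>\<^sub>F N in sequentially. 0 \<le> expectation (\<lambda>\<omega>. norm (?A N \<omega>))"
    by (intro always_eventually allI integral_nonneg_AE AE_I2) simp
qed

section \<open>Convergence in probability: Markov's inequality, continuous mapping,
  differences\<close>

lemma (in prob_space) tendsto_in_prob_L1:
  assumes int: "\<forall>\<^sub>F N in sequentially. integrable M (Y N)"
    and lim: "(\<lambda>N. expectation (\<lambda>\<omega>. \<bar>Y N \<omega> - c\<bar>)) \<longlonglongrightarrow> 0"
  shows "tendsto_in_prob M Y c"
  unfolding tendsto_in_prob_def
proof (intro conjI allI impI)
  show "\<forall>\<^sub>F N in sequentially. random_variable borel (Y N)" using int by eventually_elim auto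
  fix \<epsilon> :: real assume \<epsilon>: "0 < \<epsilon>"
  show "(\<lambda>N. prob {\<omega> \<in> space M. \<epsilon> < \<bar>Y N \<omega> - c\<bar>}) \<longlonglongrightarrow> 0"
  proof (rule tendsto_sandwich[OF _ _ tendsto_const])
    show "\<forall>\<^sub>F N in sequentially. prob {\<omega> \<in> space M. \<epsilon> < \<bar>Y N \<omega> - c\<bar>} \<le> expectation (\<lambda>\<omega>. \<bar>Y N \<omega> - c\<bar>) / \<epsilon>"
      using int
    proof eventually_elim
      case (elim N)
      then have [measurable]: "random_variable borel (Y N)" by auto
      have "prob {\<omega> \<in> space M. \<epsilon> < \<bar>Y N \<omega> - c\<bar>} \<le> prob {\<omega> \<in> space M. \<epsilon> \<le> \<bar>Y N \<omega> - c\<bar>}"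
        by (intro finite_measure_mono) auto
      also have "\<dots> \<le> expectation (\<lambda>\<omega>. \<bar>Y N \<omega> - c\<bar>) / \<epsilon>"
        using elim \<epsilon> by (intro integral_Markov_inequality_measure[where A = "{}"]) auto
      finally show ?case .
    qed
    show "(\<lambda>N. expectation (\<lambda>\<omega>. \<bar>Y N \<omega> - c\<bar>) / \<epsilon>) \<longlonglongrightarrow> 0"
      using tendsto_divide[OF lim tendsto_const[of \<epsilon>]] \<epsilon> by simp
  qed auto
qed

text \<open>Continuity of h is asked only at the limit point, because the application takes the
  logarithm of a determinant that can vanish for some samples. The deterministic sequence s will
  carry the factor N / (N - 1) of the sample covariance.\<close>

lemma (in prob_space) tendsto_in_prob_compose:
  fixes Y :: "nat \<Rightarrow> 'a \<Rightarrow> 'v::euclidean_space"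
  assumes Y: "(\<lambda>N. expectation (\<lambda>\<omega>. norm (Y N \<omega> - y))) \<longlonglongrightarrow> 0" "\<And>N. integrable M (Y N)"
    and s: "s \<longlonglongrightarrow> (s0 :: real)"
    and h: "isCont h (s0, y)" "h \<in> borel_measurable borel"
  shows "tendsto_in_prob M (\<lambda>N \<omega>. h (s N, Y N \<omega>) :: real) (h (s0, y))"
  unfolding tendsto_in_prob_def
proof (intro conjI allI impI)
  have [measurable]: "random_variable borel (Y N)" for N using Y(2) by auto
  note h(2)[measurable]
  show "\<forall>\<^sub>F N in sequentially. random_variable borel (\<lambda>\<omega>. h (s N, Y N \<omega>))" by simp
  fix \<epsilon> :: real assume "0 < \<epsilon>"
  then obtain d where d: "d > 0" "\<And>z. dist z (s0, y) < d \<Longrightarrow> \<bar>h z - h (s0, y)\<bar> < \<epsilon>"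
    using h(1) unfolding continuous_at_eps_delta by (metis dist_real_def)
  let ?B = "\<lambda>N. {\<omega> \<in> space M. \<epsilon> < \<bar>h (s N, Y N \<omega>) - h (s0, y)\<bar>}"
  show "(\<lambda>N. prob (?B N)) \<longlonglongrightarrow> 0"
  proof (rule tendsto_sandwich[OF _ _ tendsto_const])
    have "\<forall>\<^sub>F N in sequentially. dist (s N) s0 < d / 2" using s d(1) by (intro tendstoD) auto
    then show "\<forall>\<^sub>F N in sequentially. prob (?B N) \<le> expectation (\<lambda>\<omega>. norm (Y N \<omega> - y)) / (d / 2)"
    proof eventually_elim
      case (elim N)
      have "prob (?B N) \<le> prob {\<omega> \<in> space M. d / 2 \<le> norm (Y N \<omega> - y)}"
      proof (intro finite_measure_mono subsetI)
        fix \<omega> assume "\<omega> \<in> ?B N"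
        then have \<omega>: "\<omega> \<in> space M" and "\<not> dist (s N, Y N \<omega>) (s0, y) < d" using d(2)[of "(s N, Y N \<omega>)"] by auto
        moreover have "dist (s N, Y N \<omega>) (s0, y) \<le> dist (s N) s0 + dist (Y N \<omega>) y"
          unfolding dist_Pair_Pair by (rule sqrt_sum_squares_le_sum) auto
        ultimately show "\<omega> \<in> {\<omega> \<in> space M. d / 2 \<le> norm (Y N \<omega> - y)}" using elim by (simp add: dist_norm)
      qed auto
      also have "\<dots> \<le> expectation (\<lambda>\<omega>. norm (Y N \<omega> - y)) / (d / 2)"
        using Y(2) d(1) by (intro integral_Markov_inequality_measure[where A = "{}"]) auto
      finally show ?case .
    qed
    show "(\<lambda>N. expectation (\<lambda>\<omega>. norm (Y N \<omega> - y)) / (d / 2)) \<longlonglongrightarrow> 0"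
      using tendsto_divide[OF Y(1) tendsto_const[of "d/2"]] d by simp
  qed auto
qed

lemma (in prob_space) tendsto_in_prob_diff:
  assumes X: "tendsto_in_prob M X a" and Y: "tendsto_in_prob M Y b"
  shows "tendsto_in_prob M (\<lambda>N \<omega>. X N \<omega> - Y N \<omega>) (a - b)"
  unfolding tendsto_in_prob_def
proof (intro conjI allI impI)
  have meas: "\<forall>\<^sub>F N in sequentially. random_variable borel (X N) \<and> random_variable borel (Y N)"
    using X Y by (auto simp: tendsto_in_prob_def intro: eventually_conj)
  then show "\<forall>\<^sub>F N in sequentially. random_variable borel (\<lambda>\<omega>. X N \<omega> - Y N \<omega>)" by eventually_elim auto
  fix \<epsilon> :: real assume \<epsilon>: "0 < \<epsilon>"
  let ?P = "\<lambda>Z c N. prob {\<omega> \<in> space M. \<epsilon> / 2 < \<bar>Z N \<omega> - c\<bar>}"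
  show "(\<lambda>N. prob {\<omega> \<in> space M. \<epsilon> < \<bar>X N \<omega> - Y N \<omega> - (a - b)\<bar>}) \<longlonglongrightarrow> 0"
  proof (rule tendsto_sandwich[OF _ _ tendsto_const])
    show "\<forall>\<^sub>F N in sequentially. prob {\<omega> \<in> space M. \<epsilon> < \<bar>X N \<omega> - Y N \<omega> - (a - b)\<bar>} \<le> ?P X a N + ?P Y b N"
      using meas
    proof eventually_elim
      case (elim N)
      then have [measurable]: "random_variable borel (X N)" "random_variable borel (Y N)" by auto
      have "prob {\<omega> \<in> space M. \<epsilon> < \<bar>X N \<omega> - Y N \<omega> - (a - b)\<bar>}
        \<le> prob ({\<omega> \<in> space M. \<epsilon> / 2 < \<bar>X N \<omega> - a\<bar>} \<union> {\<omega> \<in> space M. \<epsilon> / 2 < \<bar>Y N \<omega> - b\<bar>})"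
      proof (intro finite_measure_mono subsetI)
        fix \<omega> assume w: "\<omega> \<in> {\<omega> \<in> space M. \<epsilon> < \<bar>X N \<omega> - Y N \<omega> - (a - b)\<bar>}"
        then have "\<epsilon> < \<bar>X N \<omega> - Y N \<omega> - (a - b)\<bar>" by simp
        then have "\<epsilon> / 2 < \<bar>X N \<omega> - a\<bar> \<or> \<epsilon> / 2 < \<bar>Y N \<omega> - b\<bar>" by linarith
        with w show "\<omega> \<in> {\<omega> \<in> space M. \<epsilon> / 2 < \<bar>X N \<omega> - a\<bar>} \<union> {\<omega> \<in> space M. \<epsilon> / 2 < \<bar>Y N \<omega> - b\<bar>}" by auto
      qed auto
      also have "\<dots> \<le> ?P X a N + ?P Y b N" by (rule measure_Un_le) auto
      finally show ?case .
    qed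
    have "?P X a \<longlonglongrightarrow> 0" "?P Y b \<longlonglongrightarrow> 0" using X Y half_gt_zero[OF \<epsilon>] unfolding tendsto_in_prob_def by blast+
    then show "(\<lambda>N. ?P X a N + ?P Y b N) \<longlonglongrightarrow> 0" by (rule tendsto_add_zero)
  qed auto
qed

section \<open>Linear change of variables\<close>

text \<open>
  The library proves the change of variables for \<open>real ^ 'n\<close> only if the index type \<open>'n\<close> is
  well-ordered. An arbitrary finite index type is replaced by a copy that carries an order.
\<close>

typedef ('a::finite) ordered_copy = "UNIV :: 'a set" by auto

text \<open>The injection is arbitrary: an order only has to exist, and \<open>det_reindex\<close>
  and \<open>lborel_distr_reindex\<close> show that determinants and volumes do not depend on
  it.\<close>

definition copy_index :: "'a::finite ordered_copy \<Rightarrow> nat" where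
  "copy_index x = (SOME h :: 'a \<Rightarrow> nat. inj h) (Rep_ordered_copy x)"

lemma inj_copy_index: "inj (copy_index :: 'a::finite ordered_copy \<Rightarrow> nat)"
proof -
  have "\<exists>h :: 'a \<Rightarrow> nat. inj h" using finite_imp_inj_to_nat_seg[of "UNIV :: 'a set"] by auto
  then have inj: "inj (SOME h :: 'a \<Rightarrow> nat. inj h)" by (rule someI_ex)
  show ?thesis
  proof (rule injI)
    fix x y :: "'a ordered_copy" assume "copy_index x = copy_index y"
    then have "Rep_ordered_copy x = Rep_ordered_copy y" unfolding copy_index_def by (rule injD[OF inj])
    then show "x = y" by (simp only: Rep_ordered_copy_inject)
  qed
qed

instantiation ordered_copy :: (finite) "{finite, wellorder}"
begin

definition less_eq_ordered_copy :: "'a ordered_copy \<Rightarrow> 'a ordered_copy \<Rightarrow> bool" where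
  "less_eq_ordered_copy x y \<longleftrightarrow> copy_index x \<le> copy_index y"

definition less_ordered_copy :: "'a ordered_copy \<Rightarrow> 'a ordered_copy \<Rightarrow> bool" where
  "less_ordered_copy x y \<longleftrightarrow> copy_index x < copy_index y"

instance
proof
  show "finite (UNIV :: 'a ordered_copy set)"
    by (rule finite_imageD[of Rep_ordered_copy]) (auto simp: inj_on_def Rep_ordered_copy_inject)
next
  fix P :: "'a ordered_copy \<Rightarrow> bool" and a
  assume step: "\<And>x. (\<And>y. y < x \<Longrightarrow> P y) \<Longrightarrow> P x"
  show "P a" by (induction a rule: measure_induct_rule[of copy_index]) (auto intro: step simp: less_ordered_copy_def)
qed (auto simp: less_eq_ordered_copy_def less_ordered_copy_def intro: injD[OF inj_copy_index])

end

lemma bij_Rep_ordered_copy: "bij (Rep_ordered_copy :: 'a::finite ordered_copy \<Rightarrow> 'a)"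
  by (rule o_bij[of Abs_ordered_copy]) (auto simp: fun_eq_iff Rep_ordered_copy_inverse Abs_ordered_copy_inverse)

text \<open>Conjugation by e is a sign-preserving bijection between the permutations of the two
  index types, so the Leibniz expansions agree term by term.\<close>

lemma det_reindex:
  fixes A :: "real ^ 'm::finite ^ 'm" and e :: "'n::finite \<Rightarrow> 'm"
  assumes e: "bij e"
  shows "det (\<chi> i j. A $ e i $ e j) = det A"
proof -
  let ?c = "map_permutation UNIV e"
  have c: "?c p (e i) = e (p i)" for p i using e by (simp add: map_permutation_apply bij_is_inj)
  have inv_e: "bij (inv e)" using e by (rule bij_imp_bij_inv)
  have bij: "bij_betw ?c {p. p permutes (UNIV :: 'n set)} {p. p permutes (UNIV :: 'm set)}"
  proof (rule bij_betw_byWitness[where f' = "map_permutation UNIV (inv e)"])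
    show "\<forall>p\<in>{p. p permutes UNIV}. map_permutation UNIV (inv e) (?c p) = p"
      using map_permutation_compose_inv[of e UNIV UNIV] e by (auto simp: bij_is_inj)
    show "\<forall>p\<in>{p. p permutes UNIV}. ?c (map_permutation UNIV (inv e) p) = p"
      using map_permutation_compose_inv[of "inv e" UNIV UNIV] e inv_e by (auto simp: surj_f_inv_f bij_is_surj)
    show "?c ` {p. p permutes UNIV} \<subseteq> {p. p permutes UNIV}"
      using map_permutation_permutes[OF e] by auto
    show "map_permutation UNIV (inv e) ` {p. p permutes UNIV} \<subseteq> {p. p permutes UNIV}"
      using map_permutation_permutes[OF inv_e] by auto
  qed
  have "det A = (\<Sum>p | p permutes (UNIV :: 'n set). of_int (sign (?c p)) * (\<Prod>i\<in>UNIV. A $ i $ ?c p i))"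
    unfolding det_def by (rule sum.reindex_bij_betw[OF bij, symmetric])
  also have "\<dots> = (\<Sum>p | p permutes (UNIV :: 'n set). of_int (sign p) * (\<Prod>i\<in>UNIV. A $ e i $ e (p i)))"
  proof (intro sum.cong refl arg_cong2[where f = "(*)"])
    fix p assume "p \<in> {p. p permutes (UNIV :: 'n set)}"
    then have p: "p permutes UNIV" by simp
    show "of_int (sign (?c p)) = (of_int (sign p) :: real)"
      using sign_map_permutation[OF bij_is_inj[OF e] p] by simp
    show "(\<Prod>i\<in>UNIV. A $ i $ ?c p i) = (\<Prod>i\<in>UNIV. A $ e i $ e (p i))"
      using prod.reindex_bij_betw[OF e, of "\<lambda>i. A $ i $ ?c p i"] by (simp add: c)
  qed
  finally show ?thesis by (simp add: det_def)
qed

text \<open>The preimage under A is the image under the inverse B, to which the volume formula for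
  linear images applies; |det A| |det B| = 1 moves the factor to the other side. Boxes suffice
  because they determine Lebesgue measure.\<close>

lemma emeasure_lborel_linear_vimage_ordered:
  fixes A :: "real ^ 'n::{finite,wellorder} ^ 'n::_"
  assumes A: "det A \<noteq> 0" and lu: "\<And>b. b \<in> Basis \<Longrightarrow> l \<bullet> b \<le> u \<bullet> b"
  shows "ennreal \<bar>det A\<bar> * emeasure lborel ((*v) A -` box l u) = (\<Prod>b\<in>Basis. (u - l) \<bullet> b)"
proof -
  obtain B where B: "A ** B = mat 1" "B ** A = mat 1"
    using A invertible_det_nz[of A] by (auto simp: invertible_def)
  have AB: "A *v (B *v x) = x" "B *v (A *v x) = x" for x by (simp_all add: matrix_vector_mul_assoc B)
  have im: "(*v) A -` box l u = (*v) B ` box l u"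
    by (auto simp: image_iff AB) (metis AB(2))
  have box: "box l u \<in> lmeasurable" by simp
  have lin: "linear ((*v) B)" by simp
  have "det A * det B = 1" using det_mul[of A B] B by (simp add: det_I)
  then have dAB: "\<bar>det A\<bar> * \<bar>det B\<bar> = 1" by (simp add: abs_mult[symmetric])
  have meas: "(*v) A -` box l u \<in> sets borel"
    by (intro borel_open open_vimage open_box linear_continuous_on) (simp add: linear_linear)
  have "emeasure lborel ((*v) A -` box l u) = emeasure lebesgue ((*v) B ` box l u)"
    using meas by (simp add: im[symmetric] emeasure_completion)
  also have "\<dots> = ennreal (measure lebesgue ((*v) B ` box l u))"
    using measurable_linear_image[OF lin box] by (intro emeasure_eq_ennreal_measure) (auto simp: fmeasurable_def)
  also have "measure lebesgue ((*v) B ` box l u) = \<bar>det B\<bar> * (\<Prod>b\<in>Basis. (u - l) \<bullet> b)"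
    using measure_linear_image[OF lin box] lu by (simp add: measure_completion measure_lborel_box)
  finally show ?thesis
    by (simp add: ennreal_mult'[symmetric] mult.assoc[symmetric] dAB)
qed

lemma prod_Basis_cart:
  fixes g :: "real ^ 'm::finite \<Rightarrow> 'b::comm_monoid_mult"
  shows "(\<Prod>b\<in>Basis. g b) = (\<Prod>i\<in>UNIV. g (axis i 1))"
proof -
  have B: "(Basis :: (real ^ 'm) set) = range (\<lambda>i. axis i 1)" by (auto simp: Basis_vec_def)
  have inj: "inj (\<lambda>i :: 'm. axis i (1 :: real))" by (auto simp: inj_def axis_eq_axis)
  show ?thesis unfolding B by (subst prod.reindex[OF inj]) (simp add: o_def)
qed

text \<open>Relabelling coordinates permutes the side lengths of a box, and Lebesgue measure is
  determined by its values on boxes.\<close>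

lemma lborel_distr_reindex:
  fixes e :: "'n::finite \<Rightarrow> 'm::finite"
  assumes e: "bij e"
  shows "distr (lborel :: (real ^ 'm) measure) borel (\<lambda>x. \<chi> i. x $ e i) = (lborel :: (real ^ 'n) measure)"
proof (rule lborel_eqI[symmetric])
  let ?T = "\<lambda>x :: real ^ 'm. \<chi> i. x $ e i"
  let ?U = "\<lambda>x :: real ^ 'n. \<chi> j. x $ inv e j"
  have ee: "e (inv e j) = j" "inv e (e i) = i" for i j
    by (rule surj_f_inv_f[OF bij_is_surj[OF e]], rule inv_f_f[OF bij_is_inj[OF e]])
  have [measurable]: "?T \<in> borel_measurable borel"
    by (intro borel_measurable_continuous_onI continuous_intros)
  fix l u :: "real ^ 'n" assume lu: "\<And>b. b \<in> Basis \<Longrightarrow> l \<bullet> b \<le> u \<bullet> b"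
  have lu': "l $ i \<le> u $ i" for i using lu[of "axis i 1"] by (simp add: inner_axis)
  have "?T -` box l u = box (?U l) (?U u)"
  proof (intro set_eqI)
    fix x
    have "x \<in> ?T -` box l u \<longleftrightarrow> (\<forall>i. l $ i < x $ e i \<and> x $ e i < u $ i)" by (simp add: mem_box_cart)
    also have "\<dots> \<longleftrightarrow> (\<forall>j. l $ inv e j < x $ j \<and> x $ j < u $ inv e j)" by (metis ee)
    finally show "x \<in> ?T -` box l u \<longleftrightarrow> x \<in> box (?U l) (?U u)" by (simp add: mem_box_cart)
  qed
  then have "emeasure (distr lborel borel ?T) (box l u) = emeasure lborel (box (?U l) (?U u))"
    by (subst emeasure_distr) auto
  also have "\<dots> = (\<Prod>b\<in>Basis. (?U u - ?U l) \<bullet> b)"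
    by (rule emeasure_lborel_box) (auto simp: Basis_vec_def inner_axis lu')
  also have "(\<Prod>b\<in>Basis. (?U u - ?U l) \<bullet> b) = (\<Prod>j\<in>UNIV. u $ inv e j - l $ inv e j)"
    by (simp add: prod_Basis_cart inner_axis)
  also have "\<dots> = (\<Prod>i\<in>UNIV. u $ i - l $ i)"
    by (rule prod.reindex_bij_betw[OF bij_imp_bij_inv[OF e]])
  also have "\<dots> = (\<Prod>b\<in>Basis. (u - l) \<bullet> b)" by (simp add: prod_Basis_cart inner_axis)
  finally show "emeasure (distr lborel borel ?T) (box l u) = (\<Prod>b\<in>Basis. (u - l) \<bullet> b)" .
qed simp

text \<open>Relabelling the coordinates conjugates A into a matrix over the ordered index type with
  the same determinant, where the volume of the preimage of a box is known. The values on boxes then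
  identify the measure.\<close>

lemma lborel_linear:
  fixes A :: "real ^ 'm::finite ^ 'm"
  assumes A: "det A \<noteq> 0"
  shows "lborel = density (distr lborel borel ((*v) A)) (\<lambda>_. ennreal \<bar>det A\<bar>)"
proof (rule lborel_eqI)
  let ?e = "Rep_ordered_copy :: 'm ordered_copy \<Rightarrow> 'm"
  note e = bij_Rep_ordered_copy
  have ee: "?e (inv ?e j) = j" "inv ?e (?e i) = i" for i j
    by (rule surj_f_inv_f[OF bij_is_surj[OF e]], rule inv_f_f[OF bij_is_inj[OF e]])
  let ?T = "\<lambda>x :: real ^ 'm. \<chi> i. x $ ?e i"
  let ?A = "\<chi> i j. A $ ?e i $ ?e j"
  have TA: "?T (A *v x) = ?A *v ?T x" for x
    unfolding vec_eq_iff matrix_vector_mult_def by (simp add: sum.reindex_bij_betw[OF e, of "\<lambda>j. A $ _ $ j * x $ j"])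
  have [measurable]: "?T \<in> borel_measurable borel"
    by (intro borel_measurable_continuous_onI continuous_intros)
  have [measurable]: "(*v) A \<in> borel_measurable borel" "(*v) ?A \<in> borel_measurable borel"
    by (intro borel_measurable_continuous_onI linear_continuous_on; simp add: linear_linear)+
  fix l u :: "real ^ 'm" assume lu: "\<And>b. b \<in> Basis \<Longrightarrow> l \<bullet> b \<le> u \<bullet> b"
  have lu': "l $ i \<le> u $ i" for i using lu[of "axis i 1"] by (simp add: inner_axis)
  have Tbox: "?T -` box (?T l) (?T u) = box l u"
  proof (intro set_eqI)
    fix x
    have "x \<in> ?T -` box (?T l) (?T u) \<longleftrightarrow> (\<forall>i. l $ ?e i < x $ ?e i \<and> x $ ?e i < u $ ?e i)" by (simp add: mem_box_cart)
    also have "\<dots> \<longleftrightarrow> (\<forall>j. l $ j < x $ j \<and> x $ j < u $ j)" by (metis ee(1))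
    finally show "x \<in> ?T -` box (?T l) (?T u) \<longleftrightarrow> x \<in> box l u" by (simp add: mem_box_cart)
  qed
  have "(*v) A -` box l u = ?T -` ((*v) ?A -` box (?T l) (?T u))"
    unfolding Tbox[symmetric] by (auto simp: TA )
  moreover have "(*v) ?A -` box (?T l) (?T u) \<in> sets borel"
    using measurable_sets[of "(*v) ?A" borel borel "box (?T l) (?T u)"] by simp
  ultimately have "emeasure lborel ((*v) A -` box l u) = emeasure (distr lborel borel ?T) ((*v) ?A -` box (?T l) (?T u))"
    by (subst emeasure_distr) auto
  then have em: "emeasure lborel ((*v) A -` box l u) = emeasure lborel ((*v) ?A -` box (?T l) (?T u))"
    unfolding lborel_distr_reindex[OF e] .
  have "ennreal \<bar>det ?A\<bar> * emeasure lborel ((*v) ?A -` box (?T l) (?T u)) = (\<Prod>b\<in>Basis. (?T u - ?T l) \<bullet> b)"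
  proof (rule emeasure_lborel_linear_vimage_ordered)
    show "det ?A \<noteq> 0" unfolding det_reindex[OF e] by fact
  qed (auto simp: Basis_vec_def inner_axis lu')
  then have "ennreal \<bar>det A\<bar> * emeasure lborel ((*v) A -` box l u) = (\<Prod>b\<in>Basis. (?T u - ?T l) \<bullet> b)"
    unfolding em det_reindex[OF e] .
  also have "(\<Prod>b\<in>Basis. (?T u - ?T l) \<bullet> b) = (\<Prod>i\<in>UNIV. u $ ?e i - l $ ?e i)"
    by (simp add: prod_Basis_cart inner_axis)
  also have "\<dots> = (\<Prod>i\<in>UNIV. u $ i - l $ i)"
    by (rule prod.reindex_bij_betw[OF e])
  also have "\<dots> = (\<Prod>b\<in>Basis. (u - l) \<bullet> b)" by (simp add: prod_Basis_cart inner_axis)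
  finally show "emeasure (density (distr lborel borel ((*v) A)) (\<lambda>_. ennreal \<bar>det A\<bar>)) (box l u) = (\<Prod>b\<in>Basis. (u - l) \<bullet> b)"
    by (subst emeasure_density_const, simp, subst emeasure_distr) auto
qed (simp only: sets_density sets_distr)

text \<open>Combines the linear substitution with translation invariance. The nonnegative integral
  lets it be used before integrability is known.\<close>

lemma nn_integral_lborel_affine:
  fixes A :: "real ^ 'm::finite ^ 'm"
  assumes A: "det A \<noteq> 0" and [measurable]: "h \<in> borel_measurable borel"
  shows "(\<integral>\<^sup>+x. ennreal \<bar>det A\<bar> * h (A *v (x - c)) \<partial>lborel) = (\<integral>\<^sup>+y. h y \<partial>lborel)"
proof -
  have [measurable]: "(*v) A \<in> borel_measurable borel"
    by (intro borel_measurable_continuous_onI linear_continuous_on) (simp add: linear_linear)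
  have "(\<integral>\<^sup>+y. h y \<partial>lborel) = (\<integral>\<^sup>+x. ennreal \<bar>det A\<bar> * h (A *v x) \<partial>lborel)"
    by (subst lborel_linear[OF A]) (simp add: nn_integral_density nn_integral_distr)
  also have "\<dots> = (\<integral>\<^sup>+x. ennreal \<bar>det A\<bar> * h (A *v (- c + x)) \<partial>lborel)"
    by (subst lborel_distr_plus[of "- c", symmetric]) (simp add: nn_integral_distr)
  finally show ?thesis by simp
qed

section \<open>Entropy of the normal distribution\<close>

lemma matrix_inv_eqI:
  fixes A B :: "real ^ 'm::finite ^ 'm"
  assumes "A ** B = mat 1"
  shows "matrix_inv A = B"
proof -
  have BA: "B ** A = mat 1" using assms by (simp add: matrix_left_right_inverse)
  have "\<exists>A'. A ** A' = mat 1 \<and> A' ** A = mat 1" using assms BA by blast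
  then have "A ** matrix_inv A = mat 1" unfolding matrix_inv_def by (rule someI2_ex) blast
  then have "B ** (A ** matrix_inv A) = B" by simp
  then show ?thesis by (simp add: matrix_mul_assoc BA)
qed

text \<open>Gram-Schmidt for the inner product x \<bullet> (S *v y), by induction over the set of
  indices already served. A family orthonormal for S takes the place of the inverse square root of
  S.\<close>

lemma symmetric_pos_def_orthonormal_basis:
  fixes S :: "real ^ 'm::finite ^ 'm"
  assumes S: "symmetric_pos_def S"
  shows "\<exists>b :: 'm \<Rightarrow> real ^ 'm. \<forall>i j. b i \<bullet> (S *v b j) = (if i = j then 1 else 0)"
proof -
  have sym: "x \<bullet> (S *v y) = y \<bullet> (S *v x)" for x y
    using S by (metis dot_lmul_matrix inner_commute symmetric_pos_def_def transpose_matrix_vector)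
  have pos: "v \<noteq> 0 \<Longrightarrow> 0 < v \<bullet> (S *v v)" for v using S by (simp add: symmetric_pos_def_def)
  have "\<exists>b :: 'm \<Rightarrow> real ^ 'm. \<forall>i\<in>A. \<forall>j\<in>A. b i \<bullet> (S *v b j) = (if i = j then 1 else 0)" if "finite A" for A
    using that
  proof (induction A)
    case (insert i A)
    then obtain b where b: "\<forall>i\<in>A. \<forall>j\<in>A. b i \<bullet> (S *v b j) = (if i = j then 1 else 0)" by blast
    \<comment> \<open>Since i lies outside A, the earlier vectors are fewer than the dimension and
      cannot span the space. This supplies the next vector for the orthogonalisation.\<close>
    have "card A < CARD('m)" using insert.hyps by (metis UNIV_I finite psubset_card_mono psubsetI subset_UNIV)
    then have "card (b ` A) < CARD('m)" using card_image_le[OF insert.hyps(1), of b] by simp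
    then have "dim (b ` A) < DIM(real ^ 'm)" using dim_le_card'[of "b ` A"] insert.hyps(1) by simp
    then have "span (b ` A) \<noteq> UNIV" by (metis dim_UNIV dim_span less_irrefl)
    then obtain v where v: "v \<notin> span (b ` A)" by blast
    define w where "w = v - (\<Sum>j\<in>A. (b j \<bullet> (S *v v)) *\<^sub>R b j)"
    have "(\<Sum>j\<in>A. (b j \<bullet> (S *v v)) *\<^sub>R b j) \<in> span (b ` A)"
      by (intro span_sum span_scale span_base) auto
    then have w0: "w \<noteq> 0" using v unfolding w_def by auto
    have bw: "b j \<bullet> (S *v w) = 0" if "j \<in> A" for j
    proof -
      have "b j \<bullet> (S *v w) = b j \<bullet> (S *v v) - (\<Sum>l\<in>A. (b l \<bullet> (S *v v)) * (b j \<bullet> (S *v b l)))"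
        by (simp add: w_def matrix_vector_mult_diff_distrib inner_diff_right linear_sum[OF matrix_vector_mul_linear] inner_sum_right
              matrix_vector_mult_scaleR)
      also have "(\<Sum>l\<in>A. (b l \<bullet> (S *v v)) * (b j \<bullet> (S *v b l))) = (\<Sum>l\<in>A. if j = l then b l \<bullet> (S *v v) else 0)"
        using b that by (intro sum.cong) auto
      also have "\<dots> = b j \<bullet> (S *v v)" using that insert.hyps by simp
      finally show ?thesis by simp
    qed
    define c where "c = sqrt (w \<bullet> (S *v w))"
    have c: "c > 0" "c * c = w \<bullet> (S *v w)" using pos[OF w0] by (auto simp: c_def)
    define b' where "b' = b(i := (1 / c) *\<^sub>R w)"
    have "b' l \<bullet> (S *v b' j) = (if l = j then 1 else 0)" if "l \<in> insert i A" "j \<in> insert i A" for l j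
    proof -
      have "((1 / c) *\<^sub>R w) \<bullet> (S *v ((1 / c) *\<^sub>R w)) = 1" using c by (simp add: matrix_vector_mult_scaleR c(2)[symmetric])
      moreover have "b j \<bullet> (S *v ((1 / c) *\<^sub>R w)) = 0" "((1 / c) *\<^sub>R w) \<bullet> (S *v b j) = 0" if "j \<in> A" for j
        using bw[OF that] sym[of w "b j"] by (simp_all add: matrix_vector_mult_scaleR)
      ultimately show ?thesis using that insert.hyps b by (auto simp: b'_def)
    qed
    then show ?case by blast
  qed simp
  from this[of UNIV] show ?thesis by simp
qed

text \<open>The rows of W are the vectors orthonormal for S, so the matrix of their S-products is
  the identity. The substitution W (x - \<mu>) then reduces Gaussian and covariance computations to
  the standard case, and the determinant identity provides the Jacobian.\<close>

lemma symmetric_pos_def_whitening: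
  fixes S :: "real ^ 'm::finite ^ 'm"
  assumes S: "symmetric_pos_def S"
  obtains W where "W ** S ** transpose W = mat 1" "matrix_inv S = transpose W ** W"
    "det S * (det W)\<^sup>2 = 1"
proof -
  obtain b :: "'m \<Rightarrow> real ^ 'm" where b: "\<And>i j. b i \<bullet> (S *v b j) = (if i = j then 1 else 0)"
    using symmetric_pos_def_orthonormal_basis[OF S] by blast
  define W :: "real ^ 'm ^ 'm" where "W = (\<chi> i. b i)"
  have W1: "W ** S ** transpose W = mat 1"
  proof -
    have "(W ** S ** transpose W) $ i $ j = b i \<bullet> (S *v b j)" for i j
      unfolding matrix_mul_assoc[symmetric]
      by (simp add: W_def inner_vec_def matrix_matrix_mult_def matrix_vector_mult_def transpose_def)
    then show ?thesis by (simp add: vec_eq_iff b mat_def)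
  qed
  have "S ** transpose W ** W = mat 1"
    using W1 by (subst matrix_left_right_inverse) (simp add: matrix_mul_assoc)
  then have inv: "matrix_inv S = transpose W ** W" by (intro matrix_inv_eqI) (simp add: matrix_mul_assoc)
  have "det S * (det W)\<^sup>2 = 1"
    using arg_cong[OF W1, of det] by (simp add: det_mul det_I power2_eq_square mult_ac)
  with W1 inv show ?thesis by (rule that)
qed

lemma symmetric_pos_def_det_pos:
  fixes S :: "real ^ 'm::finite ^ 'm"
  assumes "symmetric_pos_def S" shows "0 < det S"
proof -
  obtain W :: "real ^ 'm ^ 'm" where "det S * (det W)\<^sup>2 = 1" by (rule symmetric_pos_def_whitening[OF assms]) blast
  then have "0 < det S * (det W)\<^sup>2" by simp
  then show ?thesis by (auto simp: zero_less_mult_iff)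
qed

lemma quadratic_matrix_inv:
  fixes S W :: "real ^ 'm::finite ^ 'm"
  assumes "matrix_inv S = transpose W ** W"
  shows "v \<bullet> (matrix_inv S *v v) = (norm (W *v v))\<^sup>2"
proof -
  have "v \<bullet> (matrix_inv S *v v) = v \<bullet> (transpose W *v (W *v v))" by (simp add: assms matrix_vector_mul_assoc)
  also have "\<dots> = (W *v v) \<bullet> (W *v v)" using dot_lmul_matrix[of "W *v v" W v] by (simp add: inner_commute)
  finally show ?thesis by (simp only: power2_norm_eq_inner)
qed

section \<open>Gaussian integrals\<close>

definition std_mvn_density :: "real ^ 'm::finite \<Rightarrow> real" where
  "std_mvn_density y = (\<Prod>b\<in>Basis. std_normal_density (y \<bullet> b))"

lemma std_mvn_density_eq:
  fixes y :: "real ^ 'm::finite"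
  shows "std_mvn_density y = exp (- (norm y)\<^sup>2 / 2) / sqrt ((2 * pi) ^ CARD('m))"
proof -
  have "(\<Prod>b\<in>Basis. exp (- (y \<bullet> b)\<^sup>2 / 2)) = exp (\<Sum>b\<in>Basis. - (y \<bullet> b)\<^sup>2 / 2)"
    by (simp add: exp_sum)
  also have "(\<Sum>b\<in>Basis. - (y \<bullet> b)\<^sup>2 / 2) = - (norm y)\<^sup>2 / 2"
  proof -
    have "(\<Sum>b\<in>Basis. - (y \<bullet> b)\<^sup>2 / 2) = - (\<Sum>b\<in>Basis. (y \<bullet> b) * (y \<bullet> b)) / 2"
      unfolding sum_divide_distrib sum_negf[symmetric] power2_eq_square by simp
    then show ?thesis unfolding power2_norm_eq_inner euclidean_inner[of y y, symmetric] .
  qed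
  finally have "(\<Prod>b\<in>Basis. exp (- (y \<bullet> b)\<^sup>2 / 2)) = exp (- (norm y)\<^sup>2 / 2)" .
  moreover have "(\<Prod>b\<in>(Basis :: (real ^ 'm) set). 1 / sqrt (2 * pi)) = 1 / sqrt ((2 * pi) ^ CARD('m))"
    by (simp only: prod_constant DIM_cart DIM_real mult_1_right power_one_over real_sqrt_power)
  ultimately show ?thesis
    unfolding std_mvn_density_def std_normal_density_def prod.distrib by simp
qed

lemma borel_measurable_std_mvn_density[measurable]: "std_mvn_density \<in> borel_measurable borel"
  unfolding std_mvn_density_def[abs_def] by measurable

lemma std_mvn_density_nonneg: "0 \<le> std_mvn_density y"
  unfolding std_mvn_density_def by (intro prod_nonneg) auto

lemma nn_integral_std_mvn_density: "(\<integral>\<^sup>+y. std_mvn_density (y :: real ^ 'm::finite) \<partial>lborel) = 1"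
proof -
  have 1: "(\<integral>\<^sup>+t. std_normal_density t \<partial>lborel) = 1"
    using nn_integral_eq_integral[of lborel std_normal_density] by (simp add: integral_normal_density)
  have "(\<integral>\<^sup>+y. std_mvn_density (y :: real ^ 'm) \<partial>lborel) = (\<integral>\<^sup>+y. (\<Prod>b\<in>Basis. ennreal (std_normal_density (y \<bullet> b))) \<partial>(lborel :: (real ^ 'm) measure))"
    by (simp add: std_mvn_density_def prod_ennreal)
  also have "\<dots> = (\<Prod>b\<in>(Basis :: (real ^ 'm) set). (\<integral>\<^sup>+t. std_normal_density t \<partial>lborel))"
    by (rule nn_integral_lborel_prod) auto
  finally show ?thesis by (simp add: 1)
qed

lemma nn_integral_std_mvn_density_norm:
  "(\<integral>\<^sup>+y. std_mvn_density y * (norm (y :: real ^ 'm::finite))\<^sup>2 \<partial>lborel) = CARD('m)"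
proof -
  have 1: "(\<integral>\<^sup>+t. std_normal_density t \<partial>lborel) = 1"
    using nn_integral_eq_integral[of lborel std_normal_density] by (simp add: integral_normal_density)
  have 2: "(\<integral>\<^sup>+t. std_normal_density t * t\<^sup>2 \<partial>lborel) = 1"
    using nn_integral_eq_integral[of lborel "\<lambda>t. std_normal_density t * t\<^sup>2"] std_normal_moment_even[of 1]
    by (simp add: has_bochner_integral_iff)
  have c: "(\<integral>\<^sup>+y. std_mvn_density y * (y \<bullet> a)\<^sup>2 \<partial>(lborel :: (real ^ 'm) measure)) = 1" if a: "a \<in> Basis" for a
  proof -
    \<comment> \<open>The square is placed in the single coordinate \<open>a\<close>, so that the
      integral factors into one-dimensional integrals, each equal to 1.\<close>
    let ?g = "\<lambda>b t. ennreal (std_normal_density t * (if b = a then t\<^sup>2 else 1))"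
    have "ennreal (std_mvn_density y * (y \<bullet> a)\<^sup>2) = (\<Prod>b\<in>Basis. ?g b (y \<bullet> b))" for y :: "real ^ 'm"
      using a by (simp add: std_mvn_density_def prod_ennreal prod.distrib prod.delta')
    then have "(\<integral>\<^sup>+y. std_mvn_density y * (y \<bullet> a)\<^sup>2 \<partial>(lborel :: (real ^ 'm) measure)) = (\<integral>\<^sup>+y. (\<Prod>b\<in>Basis. ?g b (y \<bullet> b)) \<partial>(lborel :: (real ^ 'm) measure))"
      by simp
    also have "\<dots> = (\<Prod>b\<in>(Basis :: (real ^ 'm) set). (\<integral>\<^sup>+t. ?g b t \<partial>lborel))"
      by (rule nn_integral_lborel_prod) auto
    also have "\<dots> = (\<Prod>b\<in>(Basis :: (real ^ 'm) set). 1)" 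
    proof (intro prod.cong refl)
      show "(\<integral>\<^sup>+t. ?g b t \<partial>lborel) = 1" for b using 1 2 by (cases "b = a") auto
    qed
    finally show ?thesis by simp
  qed
  have "ennreal (std_mvn_density y * (norm y)\<^sup>2) = (\<Sum>a\<in>Basis. ennreal (std_mvn_density y * (y \<bullet> a)\<^sup>2))" for y :: "real ^ 'm"
  proof -
    have "(norm y)\<^sup>2 = (\<Sum>a\<in>Basis. (y \<bullet> a)\<^sup>2)"
      unfolding power2_norm_eq_inner by (subst euclidean_inner) (simp add: power2_eq_square)
    then show ?thesis by (simp add: sum_distrib_left std_mvn_density_nonneg)
  qed
  then have "(\<integral>\<^sup>+y. std_mvn_density y * (norm (y :: real ^ 'm))\<^sup>2 \<partial>lborel) = (\<Sum>a\<in>(Basis :: (real ^ 'm) set). \<integral>\<^sup>+y. std_mvn_density y * (y \<bullet> a)\<^sup>2 \<partial>lborel)"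
    by (simp add: nn_integral_sum)
  also have "\<dots> = CARD('m)" by (simp add: c ennreal_of_nat_eq_real_of_nat)
  finally show ?thesis .
qed

lemma mvn_density_eq_std:
  fixes S :: "real ^ 'm::finite ^ 'm"
  assumes W: "matrix_inv S = transpose W ** W" "det S * (det W)\<^sup>2 = 1"
  shows "mvn_density \<mu> S x = \<bar>det W\<bar> * std_mvn_density (W *v (x - \<mu>))"
proof -
  have W0: "det W \<noteq> 0" using W(2) by auto
  have "det S = 1 / (det W)\<^sup>2" using W(2) W0 by (simp add: field_simps)
  then have "sqrt ((2 * pi) ^ CARD('m) * det S) = sqrt ((2 * pi) ^ CARD('m)) / \<bar>det W\<bar>"
    by (simp add: real_sqrt_divide real_sqrt_mult)
  then show ?thesis
    by (simp add: mvn_density_def std_mvn_density_eq quadratic_matrix_inv[OF W(1)])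
qed

text \<open>The substitution y = W (x - \<mu>) turns the quadratic form into |y|^2, a sum of m
  squared coordinates of unit variance.\<close>

lemma has_bochner_integral_mvn_density:
  fixes S :: "real ^ 'm::finite ^ 'm"
  assumes S: "symmetric_pos_def S"
  shows "has_bochner_integral lborel (mvn_density \<mu> S) 1"
    and "has_bochner_integral lborel (\<lambda>x. mvn_density \<mu> S x * ((x - \<mu>) \<bullet> (matrix_inv S *v (x - \<mu>)))) CARD('m)"
proof -
  obtain W where W: "matrix_inv S = transpose W ** W" "det S * (det W)\<^sup>2 = 1"
    using symmetric_pos_def_whitening[OF S] by metis
  have W0: "det W \<noteq> 0" using W(2) by auto
  have [measurable]: "(*v) W \<in> borel_measurable borel"
    by (intro borel_measurable_continuous_onI linear_continuous_on) (simp add: linear_linear)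
  have q: "mvn_density \<mu> S x * ((x - \<mu>) \<bullet> (matrix_inv S *v (x - \<mu>))) =
      \<bar>det W\<bar> * (std_mvn_density (W *v (x - \<mu>)) * (norm (W *v (x - \<mu>)))\<^sup>2)" for x
    by (simp add: mvn_density_eq_std[OF W] quadratic_matrix_inv[OF W(1)])
  have meas: "mvn_density \<mu> S \<in> borel_measurable borel"
    unfolding mvn_density_eq_std[OF W, abs_def] by measurable
  show "has_bochner_integral lborel (mvn_density \<mu> S) 1"
  proof (rule has_bochner_integral_nn_integral)
    show "(\<integral>\<^sup>+x. mvn_density \<mu> S x \<partial>lborel) = ennreal 1"
      using nn_integral_lborel_affine[OF W0, of "\<lambda>y. ennreal (std_mvn_density y)" \<mu>]
      by (simp add: mvn_density_eq_std[OF W] ennreal_mult' nn_integral_std_mvn_density)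
  qed (use meas in \<open>auto simp: mvn_density_eq_std[OF W] std_mvn_density_nonneg\<close>)
  show "has_bochner_integral lborel (\<lambda>x. mvn_density \<mu> S x * ((x - \<mu>) \<bullet> (matrix_inv S *v (x - \<mu>)))) CARD('m)"
    unfolding q
  proof (rule has_bochner_integral_nn_integral)
    show "(\<integral>\<^sup>+x. \<bar>det W\<bar> * (std_mvn_density (W *v (x - \<mu>)) * (norm (W *v (x - \<mu>)))\<^sup>2) \<partial>lborel) = ennreal CARD('m)"
      using nn_integral_lborel_affine[OF W0, of "\<lambda>y. ennreal (std_mvn_density y * (norm y)\<^sup>2)" \<mu>]
      by (simp add: ennreal_mult' nn_integral_std_mvn_density_norm ennreal_of_nat_eq_real_of_nat)
  qed (auto simp: std_mvn_density_nonneg)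
qed

lemma mvn_density_pos:
  assumes "symmetric_pos_def S" shows "0 < mvn_density \<mu> S x"
  using symmetric_pos_def_det_pos[OF assms] by (simp add: mvn_density_def)

lemma ln_mvn_density:
  fixes S :: "real ^ 'm::finite ^ 'm"
  assumes "symmetric_pos_def S"
  shows "ln (mvn_density \<mu> S x) = - ((x - \<mu>) \<bullet> (matrix_inv S *v (x - \<mu>))) / 2 - ln ((2 * pi) ^ CARD('m) * det S) / 2"
proof -
  have "0 < (2 * pi) ^ CARD('m) * det S" using symmetric_pos_def_det_pos[OF assms] by simp
  then have "ln (sqrt ((2 * pi) ^ CARD('m) * det S)) = ln ((2 * pi) ^ CARD('m) * det S) / 2"
    "0 < sqrt ((2 * pi) ^ CARD('m) * det S)"
    by (simp_all only: ln_sqrt real_sqrt_gt_0_iff)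
  then show ?thesis unfolding mvn_density_def
    by (subst ln_div) (simp_all only: ln_exp exp_gt_zero less_imp_neq[symmetric] if_True not_False_eq_True simp_thms)
qed

text \<open>Minus the log density is half the quadratic form plus a constant. The mean m of the
  quadratic form is absorbed into the logarithm as the factor e^m.\<close>

lemma diff_entropy_mvn_density:
  fixes S :: "real ^ 'm::finite ^ 'm"
  assumes S: "symmetric_pos_def S"
  shows "diff_entropy (mvn_density \<mu> S) = ln ((2 * pi * exp 1) ^ CARD('m) * det S) / 2"
proof -
  let ?c = "ln ((2 * pi) ^ CARD('m) * det S)"
  have "has_bochner_integral lborel
     (\<lambda>x. - (mvn_density \<mu> S x * ((x - \<mu>) \<bullet> (matrix_inv S *v (x - \<mu>)))) / 2 - mvn_density \<mu> S x * (?c / 2))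
     (- real CARD('m) / 2 - 1 * (?c / 2))"
    by (intro has_bochner_integral_diff has_bochner_integral_divide_zero has_bochner_integral_minus
          has_bochner_integral_mult_left has_bochner_integral_mvn_density S)
  moreover have "(\<lambda>x. - (mvn_density \<mu> S x * ((x - \<mu>) \<bullet> (matrix_inv S *v (x - \<mu>)))) / 2 - mvn_density \<mu> S x * (?c / 2)) = (\<lambda>x. mvn_density \<mu> S x * ln (mvn_density \<mu> S x))"
    by (simp add: ln_mvn_density[OF S] algebra_simps)
  ultimately have "diff_entropy (mvn_density \<mu> S) = (real CARD('m) + ?c) / 2"
    by (simp add: diff_entropy_def has_bochner_integral_iff add_divide_distrib)
  also have "real CARD('m) + ?c = ln ((2 * pi * exp 1) ^ CARD('m) * det S)"
    using symmetric_pos_def_det_pos[OF S] by (simp add: ln_mult ln_realpow power_mult_distrib algebra_simps)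
  finally show ?thesis by simp
qed

section \<open>Divergence from the normal distribution\<close>

lemma borel_measurable_vec_nth[measurable (raw)]:
  fixes f :: "'a \<Rightarrow> real ^ 'm::finite"
  assumes "f \<in> borel_measurable M"
  shows "(\<lambda>x. f x $ a) \<in> borel_measurable M"
  using assms by (rule measurable_compose) (intro borel_measurable_continuous_onI continuous_on_component continuous_on_id)

context prob_space
begin

lemma integrable_norm_diff_square:
  fixes X :: "'a \<Rightarrow> 'v::euclidean_space"
  assumes [measurable]: "random_variable borel X" and X2: "integrable M (\<lambda>\<omega>. norm (X \<omega>) ^ 2)"
  shows "integrable M X" "integrable M (\<lambda>\<omega>. norm (X \<omega> - c) ^ 2)"
proof -
  have t: "t \<le> t ^ 2 + 1" for t :: real
    using zero_le_power2[of "t - 1 / 2"] by (simp add: power2_eq_square algebra_simps)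
  show X: "integrable M X"
  proof (rule Bochner_Integration.integrable_bound)
    show "integrable M (\<lambda>\<omega>. norm (X \<omega>) ^ 2 + 1)" using X2 by simp
    show "AE \<omega> in M. norm (X \<omega>) \<le> norm (norm (X \<omega>) ^ 2 + 1)"
    proof (rule AE_I2)
      show "norm (X \<omega>) \<le> norm (norm (X \<omega>) ^ 2 + 1)" for \<omega> using t[of "norm (X \<omega>)"] by simp
    qed
  qed fact
  have "norm (X \<omega> - c) ^ 2 = norm (X \<omega>) ^ 2 - 2 * (X \<omega> \<bullet> c) + norm c ^ 2" for \<omega>
    unfolding power2_norm_eq_inner by (simp add: inner_diff_left inner_diff_right inner_commute)
  then show "integrable M (\<lambda>\<omega>. norm (X \<omega> - c) ^ 2)"
    using X X2 by simp
qed

lemma integrable_component_product: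
  fixes Y :: "'a \<Rightarrow> real ^ 'm::finite"
  assumes [measurable]: "random_variable borel Y" and Y2: "integrable M (\<lambda>\<omega>. norm (Y \<omega>) ^ 2)"
  shows "integrable M (\<lambda>\<omega>. Y \<omega> $ a * Y \<omega> $ b)"
proof (rule Bochner_Integration.integrable_bound[OF Y2])
  show "AE \<omega> in M. norm (Y \<omega> $ a * Y \<omega> $ b) \<le> norm (norm (Y \<omega>) ^ 2)"
    by (intro AE_I2) (simp add: abs_mult power2_eq_square mult_mono component_le_norm_cart)
qed measurable

text \<open>The quadratic form of the covariance matrix is the variance of a projection. This serves
  twice: for positive definiteness, and with the rows of a whitening matrix as v.\<close>

lemma expectation_inner_square:
  fixes X :: "'a \<Rightarrow> real ^ 'm::finite"
  assumes X: "random_variable borel X" "integrable M (\<lambda>\<omega>. norm (X \<omega>) ^ 2)"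
  shows "has_bochner_integral M (\<lambda>\<omega>. (v \<bullet> (X \<omega> - expectation X))\<^sup>2) (v \<bullet> (covariance_matrix M X *v v))"
proof -
  define Y where "Y \<omega> = X \<omega> - expectation X" for \<omega>
  have Y: "random_variable borel Y" "integrable M (\<lambda>\<omega>. norm (Y \<omega>) ^ 2)"
    using X integrable_norm_diff_square[OF X] by (simp_all add: Y_def[abs_def])
  have "(v \<bullet> Y \<omega>)\<^sup>2 = (\<Sum>a\<in>UNIV. \<Sum>b\<in>UNIV. v $ a * (v $ b * (Y \<omega> $ a * Y \<omega> $ b)))" for \<omega>
    by (simp add: inner_vec_def power2_eq_square sum_product mult_ac)
  moreover have "v \<bullet> (covariance_matrix M X *v v) = (\<Sum>a\<in>UNIV. \<Sum>b\<in>UNIV. v $ a * (v $ b * expectation (\<lambda>\<omega>. Y \<omega> $ a * Y \<omega> $ b)))"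
    by (simp add: inner_vec_def matrix_vector_mult_def covariance_matrix_def Y_def sum_distrib_left mult_ac)
  moreover have "has_bochner_integral M (\<lambda>\<omega>. \<Sum>a\<in>UNIV. \<Sum>b\<in>UNIV. v $ a * (v $ b * (Y \<omega> $ a * Y \<omega> $ b)))
      (\<Sum>a\<in>UNIV. \<Sum>b\<in>UNIV. v $ a * (v $ b * expectation (\<lambda>\<omega>. Y \<omega> $ a * Y \<omega> $ b)))"
    by (intro has_bochner_integral_sum has_bochner_integral_mult_right has_bochner_integral_integrable integrable_component_product Y)
  ultimately show ?thesis by (simp add: Y_def)
qed

text \<open>A direction v of variance zero would confine X almost surely to a hyperplane, which is
  Lebesgue null and hence has probability zero for a variable with a density.\<close>

lemma covariance_matrix_pos_def:
  fixes X :: "'a \<Rightarrow> real ^ 'm::finite"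
  assumes X: "distributed M lborel X f" and X2: "integrable M (\<lambda>\<omega>. norm (X \<omega>) ^ 2)"
  shows "symmetric_pos_def (covariance_matrix M X)"
  unfolding symmetric_pos_def_def
proof (intro conjI allI impI)
  show "transpose (covariance_matrix M X) = covariance_matrix M X"
    by (simp add: vec_eq_iff transpose_def covariance_matrix_def mult.commute)
  have rv: "random_variable borel X" using distributed_measurable[OF X] by simp
  note hb = expectation_inner_square[OF rv X2]
  fix v :: "real ^ 'm" assume v: "v \<noteq> 0"
  let ?H = "{x. v \<bullet> x = v \<bullet> expectation X}"
  have "0 \<le> v \<bullet> (covariance_matrix M X *v v)"
    unfolding has_bochner_integral_integral_eq[OF hb[of v], symmetric] by (intro integral_nonneg_AE AE_I2) simp
  moreover have "v \<bullet> (covariance_matrix M X *v v) \<noteq> 0"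
  proof
    assume "v \<bullet> (covariance_matrix M X *v v) = 0"
    then have "AE \<omega> in M. (v \<bullet> (X \<omega> - expectation X))\<^sup>2 = 0"
      using hb[of v] integral_nonneg_eq_0_iff_AE[of M "\<lambda>\<omega>. (v \<bullet> (X \<omega> - expectation X))\<^sup>2"]
      by (simp add: has_bochner_integral_iff)
    then have ae: "AE \<omega> in M. X \<omega> \<in> ?H"
      by eventually_elim (simp add: inner_diff_right)
    have "?H \<in> null_sets lebesgue"
      using v negligible_hyperplane[of v] by (simp add: negligible_iff_null_sets)
    moreover have H: "?H \<in> sets borel"
      by (intro borel_closed closed_hyperplane)
    ultimately have null: "?H \<in> null_sets lborel"
      by (auto simp: null_sets_def emeasure_completion)
    have "emeasure M (X -` ?H \<inter> space M) = (\<integral>\<^sup>+x. f x * indicator ?H x \<partial>lborel)"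
      using distributed_emeasure[OF X, of "?H"] H by simp
    also have "\<dots> = 0" using distributed_borel_measurable[OF X]
      by (subst nn_integral_0_iff_AE) (auto intro!: AE_I'[OF null] simp: indicator_def)
    finally have 0: "emeasure M (X -` ?H \<inter> space M) = 0" .
    have "AE \<omega> in M. \<omega> \<notin> X -` ?H \<inter> space M"
      using 0 measurable_sets[OF rv H] by (intro AE_not_in) (auto simp: null_sets_def)
    with ae AE_space have "AE \<omega> in M. False" by eventually_elim auto
    then show False by simp
  qed
  ultimately show "0 < v \<bullet> (covariance_matrix M X *v v)" by simp
qed

text \<open>Each whitened coordinate of X has variance 1, and there are m of them. The value agrees
  with the one under the normal density, which is what makes the two entropies comparable.\<close>

lemma expectation_mahalanobis:
  fixes X :: "'a \<Rightarrow> real ^ 'm::finite"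
  assumes X: "distributed M lborel X f" and X2: "integrable M (\<lambda>\<omega>. norm (X \<omega>) ^ 2)"
  shows "has_bochner_integral M (\<lambda>\<omega>. (X \<omega> - expectation X) \<bullet> (matrix_inv (covariance_matrix M X) *v (X \<omega> - expectation X))) CARD('m)"
proof -
  let ?S = "covariance_matrix M X"
  have rv: "random_variable borel X" using distributed_measurable[OF X] by simp
  obtain W :: "real ^ 'm ^ 'm" where W: "W ** ?S ** transpose W = mat 1" "matrix_inv ?S = transpose W ** W"
    by (rule symmetric_pos_def_whitening[OF covariance_matrix_pos_def[OF X X2]]) blast
  have q: "v \<bullet> (matrix_inv ?S *v v) = (\<Sum>i\<in>UNIV. (W $ i \<bullet> v)\<^sup>2)" for v
    unfolding quadratic_matrix_inv[OF W(2)] power2_norm_eq_inner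
    by (simp add: inner_vec_def matrix_vector_mult_def power2_eq_square)
  have one: "W $ i \<bullet> (?S *v W $ i) = 1" for i
  proof -
    have "W $ i \<bullet> (?S *v W $ i) = (W ** ?S ** transpose W) $ i $ i"
      unfolding matrix_mul_assoc[symmetric]
      by (simp add: inner_vec_def matrix_matrix_mult_def matrix_vector_mult_def transpose_def)
    then show ?thesis by (simp add: W mat_def)
  qed
  have "has_bochner_integral M (\<lambda>\<omega>. \<Sum>i\<in>UNIV. (W $ i \<bullet> (X \<omega> - expectation X))\<^sup>2) (\<Sum>i\<in>(UNIV::'m set). W $ i \<bullet> (?S *v W $ i))"
    by (intro has_bochner_integral_sum expectation_inner_square[OF rv X2])
  then show ?thesis by (simp add: q one)
qed

text \<open>The logarithm of \<phi> is a quadratic polynomial, so its mean under f depends only on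
  the first two moments and agrees with its mean under \<phi>. The cross term, the integral of f ln
  \<phi>, is therefore minus the entropy of \<phi>.\<close>

lemma KL_div_mvn_density:
  fixes X :: "'a \<Rightarrow> real ^ 'm::finite" and f :: "real ^ 'm \<Rightarrow> real"
  assumes X: "distributed M lborel X f" and f: "\<And>x. 0 \<le> f x" and X2: "integrable M (\<lambda>\<omega>. norm (X \<omega>) ^ 2)"
    and H: "finite_diff_entropy f"
  defines "\<phi> \<equiv> mvn_density (expectation X) (covariance_matrix M X)"
  shows "has_bochner_integral lborel (\<lambda>x. f x * ln (f x / \<phi> x)) (diff_entropy \<phi> - diff_entropy f)"
proof -
  let ?S = "covariance_matrix M X"
  let ?c = "ln ((2 * pi) ^ CARD('m) * det ?S)"
  note S = covariance_matrix_pos_def[OF X X2]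
  have \<phi>: "0 < \<phi> x" for x unfolding \<phi>_def by (rule mvn_density_pos[OF S])
  let ?q = "\<lambda>x. (x - expectation X) \<bullet> (matrix_inv ?S *v (x - expectation X))"
  have [measurable]: "(*v) (matrix_inv ?S) \<in> borel_measurable borel"
    by (intro borel_measurable_continuous_onI linear_continuous_on) (simp add: linear_linear)
  have "has_bochner_integral lborel (\<lambda>x. f x * ?q x) CARD('m)"
    using expectation_mahalanobis[OF X X2] distributed_integral[OF X, of ?q] distributed_integrable[OF X, of ?q] f
    by (simp add: has_bochner_integral_iff)
  moreover have "has_bochner_integral lborel f 1"
    using distributed_integral[OF X, of "\<lambda>_. 1"] distributed_integrable[OF X, of "\<lambda>_. 1"] f
    by (simp add: has_bochner_integral_iff prob_space)
  moreover have "has_bochner_integral lborel (\<lambda>x. f x * ln (f x)) (- diff_entropy f)"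
    using H by (simp add: has_bochner_integral_iff finite_diff_entropy_def diff_entropy_def)
  ultimately have A: "has_bochner_integral lborel (\<lambda>x. f x * ln (f x) + (f x * ?q x) / 2 + f x * (?c / 2)) (- diff_entropy f + real CARD('m) / 2 + 1 * (?c / 2))"
    by (intro has_bochner_integral_add has_bochner_integral_divide_zero has_bochner_integral_mult_left)
  have B: "f x * ln (f x) + (f x * ?q x) / 2 + f x * (?c / 2) = f x * ln (f x / \<phi> x)" for x
  proof (cases "f x = 0")
    case False
    then have "ln (f x / \<phi> x) = ln (f x) - ln (\<phi> x)" using f[of x] \<phi>[of x] by (subst ln_div) auto
    define Q where "Q = ?q x"
    have "ln (\<phi> x) = - Q / 2 - ?c / 2" unfolding Q_def \<phi>_def by (rule ln_mvn_density[OF S])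
    with \<open>ln (f x / \<phi> x) = ln (f x) - ln (\<phi> x)\<close> have "ln (f x / \<phi> x) = ln (f x) + Q / 2 + ?c / 2" by simp
    then show ?thesis unfolding Q_def[symmetric] by (simp only: distrib_left times_divide_eq_right)
  qed simp
  have C: "- diff_entropy f + real CARD('m) / 2 + 1 * (?c / 2) = diff_entropy \<phi> - diff_entropy f"
  proof -
    have "real CARD('m) + ?c = ln ((2 * pi * exp 1) ^ CARD('m) * det ?S)"
      using symmetric_pos_def_det_pos[OF S] by (simp add: ln_mult ln_realpow power_mult_distrib distrib_left)
    then show ?thesis by (simp add: \<phi>_def diff_entropy_mvn_density[OF S] add_divide_distrib[symmetric])
  qed
  show ?thesis using A unfolding B C .
qed

text \<open>Adding \<phi> - f, whose integral is 0, makes the integrand of the divergence pointwise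
  nonnegative: with t = \<phi> / f it is f (t - 1 - ln t), which vanishes only at t = 1, and it
  equals \<phi> > 0 where f = 0. A zero integral would force f = \<phi> almost everywhere, and then
  X would be normal.\<close>

lemma KL_div_mvn_density_pos:
  fixes X :: "'a \<Rightarrow> real ^ 'm::finite" and f :: "real ^ 'm \<Rightarrow> real"
  assumes X: "distributed M lborel X f" and f: "\<And>x. 0 \<le> f x" and X2: "integrable M (\<lambda>\<omega>. norm (X \<omega>) ^ 2)"
    and H: "finite_diff_entropy f"
    and not_normal: "\<not> mvn_distributed M X (expectation X) (covariance_matrix M X)"
  shows "0 < diff_entropy (mvn_density (expectation X) (covariance_matrix M X)) - diff_entropy f"
proof -
  define \<phi> where "\<phi> = mvn_density (expectation X) (covariance_matrix M X)"
  note S = covariance_matrix_pos_def[OF X X2]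
  have \<phi>: "0 < \<phi> x" for x unfolding \<phi>_def by (rule mvn_density_pos[OF S])
  have I\<phi>: "has_bochner_integral lborel \<phi> 1" unfolding \<phi>_def by (rule has_bochner_integral_mvn_density[OF S])
  then have [measurable]: "\<phi> \<in> borel_measurable borel" by (auto simp: has_bochner_integral_iff)
  have "has_bochner_integral lborel f 1"
    using distributed_integral[OF X, of "\<lambda>_. 1"] distributed_integrable[OF X, of "\<lambda>_. 1"] f
    by (simp add: has_bochner_integral_iff prob_space)
  from has_bochner_integral_add[OF has_bochner_integral_diff[OF KL_div_mvn_density[OF X f X2 H] this] I\<phi>]
  have I: "has_bochner_integral lborel (\<lambda>x. f x * ln (f x / \<phi> x) - f x + \<phi> x) (diff_entropy \<phi> - diff_entropy f)"
    by (simp add: \<phi>_def)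
  have gibbs: "0 \<le> f x * ln (f x / \<phi> x) - f x + \<phi> x" "f x * ln (f x / \<phi> x) - f x + \<phi> x = 0 \<Longrightarrow> f x = \<phi> x" for x
  proof -
    have "0 \<le> f x * ln (f x / \<phi> x) - f x + \<phi> x \<and> (f x * ln (f x / \<phi> x) - f x + \<phi> x = 0 \<longrightarrow> f x = \<phi> x)"
    proof (cases "f x = 0")
      case True
      then show ?thesis using \<phi>[of x] by simp
    next
      case False
      then have fx: "0 < f x" using f[of x] by simp
      define t where "t = \<phi> x / f x"
      have t: "0 < t" "\<phi> x = f x * t" using fx \<phi>[of x] by (auto simp: t_def)
      have "ln (f x / \<phi> x) = - ln t" unfolding t_def using fx \<phi>[of x] by (simp add: ln_div)
      then have e: "f x * ln (f x / \<phi> x) - f x + \<phi> x = f x * (t - 1 - ln t)" by (simp add: t(2) algebra_simps)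
      have "ln t \<le> t - 1" using t(1) by (rule ln_le_minus_one)
      moreover have "t = 1" if "ln t = t - 1" using ln_eq_minus_one[OF t(1) that] .
      ultimately show ?thesis using fx unfolding e by (auto simp: t(2))
    qed
    then show "0 \<le> f x * ln (f x / \<phi> x) - f x + \<phi> x" "f x * ln (f x / \<phi> x) - f x + \<phi> x = 0 \<Longrightarrow> f x = \<phi> x" by auto
  qed
  have "diff_entropy \<phi> - diff_entropy f \<noteq> 0"
  proof
    assume "diff_entropy \<phi> - diff_entropy f = 0"
    with I have "AE x in lborel. f x * ln (f x / \<phi> x) - f x + \<phi> x = 0"
      using integral_nonneg_eq_0_iff_AE[of lborel "\<lambda>x. f x * ln (f x / \<phi> x) - f x + \<phi> x"] gibbs(1)
      by (simp add: has_bochner_integral_iff)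
    then have "AE x in lborel. f x = \<phi> x" by eventually_elim (rule gibbs(2))
    moreover have [measurable]: "f \<in> borel_measurable borel" using distributed_real_measurable[OF _ X] f by simp
    ultimately have "density lborel f = density lborel \<phi>" by (intro density_cong) auto
    then have "distributed M lborel X \<phi>"
      using X by (auto simp: distributed_def)
    then show False using not_normal S by (simp add: mvn_distributed_def \<phi>_def)
  qed
  moreover have "0 \<le> diff_entropy \<phi> - diff_entropy f"
    unfolding has_bochner_integral_integral_eq[OF I, symmetric] by (intro integral_nonneg_AE AE_I2 gibbs(1))
  ultimately show ?thesis by (simp add: \<phi>_def)
qed

text \<open>Two densities of one variable agree almost everywhere, and the entropy does not see null
  sets. For normal X this equates the entropy of f with that of the normal density.\<close>

lemma diff_entropy_cong_distributed:
  assumes f: "distributed M lborel X f" "\<And>x. 0 \<le> f x" and g: "distributed M lborel X g" "\<And>x. 0 \<le> g x"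
  shows "diff_entropy f = diff_entropy g"
proof -
  have [measurable]: "f \<in> borel_measurable borel" "g \<in> borel_measurable borel"
    using distributed_real_measurable[OF _ f(1)] distributed_real_measurable[OF _ g(1)] f(2) g(2) by simp_all
  have "density lborel (\<lambda>x. ennreal (f x)) = density lborel (\<lambda>x. ennreal (g x))"
    using f(1) g(1) by (simp add: distributed_def)
  then have "AE x in lborel. ennreal (f x) = ennreal (g x)"
    by (subst (asm) sigma_finite_measure.density_unique_iff[OF sigma_finite_lborel]) auto
  then have "AE x in lborel. f x * ln (f x) = g x * ln (g x)"
    by eventually_elim (use f(2) g(2) in simp)
  then show ?thesis unfolding diff_entropy_def by (intro arg_cong[where f=uminus] integral_cong_AE) auto
qed

end

section \<open>The sample covariance matrix\<close>

lemma (in prob_space) tendsto_in_prob_cong: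
  assumes "\<forall>\<^sub>F N in sequentially. \<forall>\<omega>. X N \<omega> = Y N \<omega>" and X: "tendsto_in_prob M X c"
  shows "tendsto_in_prob M Y c"
  unfolding tendsto_in_prob_def
proof (intro conjI allI impI)
  have eq: "\<forall>\<^sub>F N in sequentially. X N = Y N" using assms(1) by eventually_elim auto
  have "\<forall>\<^sub>F N in sequentially. random_variable borel (X N)" using X by (simp add: tendsto_in_prob_def)
  then show "\<forall>\<^sub>F N in sequentially. random_variable borel (Y N)" using eq by eventually_elim simp
  fix \<epsilon> :: real assume "0 < \<epsilon>"
  then have "(\<lambda>N. prob {\<omega> \<in> space M. \<epsilon> < \<bar>X N \<omega> - c\<bar>}) \<longlonglongrightarrow> 0" using X by (simp add: tendsto_in_prob_def)
  moreover have "\<forall>\<^sub>F N in sequentially. prob {\<omega> \<in> space M. \<epsilon> < \<bar>X N \<omega> - c\<bar>} = prob {\<omega> \<in> space M. \<epsilon> < \<bar>Y N \<omega> - c\<bar>}"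
    using eq by eventually_elim simp
  ultimately show "(\<lambda>N. prob {\<omega> \<in> space M. \<epsilon> < \<bar>Y N \<omega> - c\<bar>}) \<longlonglongrightarrow> 0" by (rule Lim_transform_eventually)
qed

definition outer :: "real ^ 'm::finite \<Rightarrow> real ^ 'm ^ 'm" where
  "outer v = (\<chi> a b. v $ a * v $ b)"

text \<open>Row a of the matrix is v scaled by \<open>v $ a\<close>. The identity makes v v^T
  integrable as soon as the squared norm is, so that second moments enter the law of large numbers
  as a vector-valued mean.\<close>

lemma norm_outer: "norm (outer v) = (norm v)\<^sup>2"
proof -
  have "norm (outer v) = L2_set (\<lambda>a. norm (outer v $ a)) UNIV" by (rule norm_vec_def)
  also have "\<dots> = L2_set (\<lambda>a. norm v * norm (v $ a)) UNIV"
  proof (intro L2_set_cong refl)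
    fix a
    have "outer v $ a = (v $ a) *\<^sub>R v" by (simp add: outer_def vec_eq_iff)
    then show "norm (outer v $ a) = norm v * norm (v $ a)" by simp
  qed
  also have "\<dots> = norm v * L2_set (\<lambda>a. norm (v $ a)) UNIV" by (rule L2_set_right_distrib[symmetric]) simp
  also have "\<dots> = (norm v)\<^sup>2" by (simp only: norm_vec_def[symmetric] power2_eq_square)
  finally show ?thesis .
qed

lemma continuous_on_outer: "continuous_on UNIV outer"
  unfolding outer_def[abs_def]
  by (intro continuous_on_vec_lambda continuous_on_mult continuous_on_component continuous_on_id)

lemma continuous_on_det: "continuous_on UNIV (det :: real ^ 'm::finite ^ 'm \<Rightarrow> real)"
  unfolding det_def[abs_def]
  by (intro continuous_on_sum continuous_on_mult continuous_on_const continuous_on_prod continuous_on_component continuous_on_id)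

text \<open>Separates the deterministic factor N / (N - 1) from a fixed continuous function of the
  averages of x and of \<open>outer x\<close>, the form to which the law of large numbers and the
  continuous mapping lemma apply. The cross terms collapse because the x i sum to N times their
  mean.\<close>

lemma sample_cov_eq:
  assumes N: "2 \<le> N"
  shows "sample_cov N x = (real N / (real N - 1)) *\<^sub>R ((\<Sum>i=1..N. outer (x i)) /\<^sub>R real N - outer ((\<Sum>i=1..N. x i) /\<^sub>R real N))"
proof -
  define \<mu> where "\<mu> = (\<Sum>i=1..N. x i) /\<^sub>R real N"
  have \<mu>: "sample_mean N x = \<mu>" by (simp add: sample_mean_def \<mu>_def divide_inverse)
  have s: "(\<Sum>i=1..N. x i $ a) = real N * \<mu> $ a" for a
    using N by (simp add: \<mu>_def)
  have "(\<Sum>i=1..N. (x i - \<mu>) $ a * (x i - \<mu>) $ b) = (\<Sum>i=1..N. x i $ a * x i $ b) - real N * (\<mu> $ a * \<mu> $ b)" for a b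
  proof -
    have "(\<Sum>i=1..N. (x i - \<mu>) $ a * (x i - \<mu>) $ b) = (\<Sum>i=1..N. x i $ a * x i $ b - \<mu> $ b * x i $ a - \<mu> $ a * x i $ b + \<mu> $ a * \<mu> $ b)"
      by (intro sum.cong) (auto simp: algebra_simps)
    also have "\<dots> = (\<Sum>i=1..N. x i $ a * x i $ b) - \<mu> $ b * (\<Sum>i=1..N. x i $ a) - \<mu> $ a * (\<Sum>i=1..N. x i $ b) + real N * (\<mu> $ a * \<mu> $ b)"
      by (simp add: sum.distrib sum_subtractf sum_distrib_left)
    finally show ?thesis unfolding s by (simp add: algebra_simps)
  qed
  moreover have "(q - real N * p) / (real N - 1) = real N / (real N - 1) * (q / real N - p)" for q p
    using N by (simp add: right_diff_distrib diff_divide_distrib)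
  ultimately show ?thesis
    unfolding sample_cov_def \<mu> \<mu>_def[symmetric]
    by (simp add: vec_eq_iff outer_def divide_inverse mult.commute[of "inverse (real N)"])
qed

lemma (in prob_space) covariance_matrix_outer:
  fixes X :: "'a \<Rightarrow> real ^ 'm::finite"
  assumes X: "random_variable borel X" "integrable M (\<lambda>\<omega>. norm (X \<omega>) ^ 2)"
  shows "integrable M (\<lambda>\<omega>. outer (X \<omega>))"
    and "covariance_matrix M X = expectation (\<lambda>\<omega>. outer (X \<omega>)) - outer (expectation X)"
proof -
  have i: "integrable M (\<lambda>\<omega>. X \<omega> $ a * X \<omega> $ b)" for a b using X by (rule integrable_component_product)
  have X1: "integrable M X" using integrable_norm_diff_square[OF X] by simp
  have Xa: "integrable M (\<lambda>\<omega>. X \<omega> $ a)" for a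
    using integrable_inner_left[OF X1, of "axis a 1"] by (simp add: inner_axis)
  have EXa: "expectation (\<lambda>\<omega>. X \<omega> $ a) = expectation X $ a" for a
    using integral_inner_left[OF X1, of "axis a 1"] by (simp add: inner_axis)
  show io: "integrable M (\<lambda>\<omega>. outer (X \<omega>))"
  proof (rule Bochner_Integration.integrable_bound[OF X(2)])
    show "random_variable borel (\<lambda>\<omega>. outer (X \<omega>))"
      using X(1) by (rule measurable_compose) (rule borel_measurable_continuous_onI[OF continuous_on_outer])
  qed (simp add: norm_outer)
  have EO: "expectation (\<lambda>\<omega>. outer (X \<omega>)) $ a $ b = expectation (\<lambda>\<omega>. X \<omega> $ a * X \<omega> $ b)" for a b
    using integral_inner_left[OF io, of "axis a (axis b 1)"] by (simp add: inner_axis outer_def)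
  have "expectation (\<lambda>\<omega>. (X \<omega> - expectation X) $ a * (X \<omega> - expectation X) $ b) = expectation (\<lambda>\<omega>. X \<omega> $ a * X \<omega> $ b) - expectation X $ a * expectation X $ b" for a b
  proof -
    have "expectation (\<lambda>\<omega>. (X \<omega> - expectation X) $ a * (X \<omega> - expectation X) $ b)
       = expectation (\<lambda>\<omega>. X \<omega> $ a * X \<omega> $ b - expectation X $ b * X \<omega> $ a - expectation X $ a * X \<omega> $ b + expectation X $ a * expectation X $ b)"
      by (intro Bochner_Integration.integral_cong refl) (simp add: algebra_simps)
    also have "\<dots> = expectation (\<lambda>\<omega>. X \<omega> $ a * X \<omega> $ b) - expectation X $ b * expectation X $ a - expectation X $ a * expectation X $ b + expectation X $ a * expectation X $ b"
      using i Xa by (simp add: EXa prob_space)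
    finally show ?thesis by (simp add: mult.commute)
  qed
  then show "covariance_matrix M X = expectation (\<lambda>\<omega>. outer (X \<omega>)) - outer (expectation X)"
    by (simp add: vec_eq_iff covariance_matrix_def EO outer_def[of "expectation X"])
qed

text \<open>The averages of the pairs (X, outer X) converge in L1, and \<open>F\<close> is
  continuous in the average and in the factor N / (N - 1) jointly. Positivity of the limiting
  determinant keeps the limit point away from the singularity of \<open>ln\<close>. The constant c
  is (2 pi e)^m in the application.\<close>

lemma (in prob_space) ln_det_sample_cov_tendsto_in_prob:
  fixes X :: "nat \<Rightarrow> 'a \<Rightarrow> real ^ 'm::finite"
  assumes indep: "indep_vars (\<lambda>_. borel) X {1..}"
    and distr: "\<And>i. 1 \<le> i \<Longrightarrow> distr M borel (X i) = distr M borel (X 1)"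
    and X2: "integrable M (\<lambda>\<omega>. norm (X 1 \<omega>) ^ 2)"
    and det: "0 < det (covariance_matrix M (X 1))" and c: "0 < c"
  shows "tendsto_in_prob M (\<lambda>N \<omega>. ln (c * det (sample_cov N (\<lambda>i. X i \<omega>))) / 2) (ln (c * det (covariance_matrix M (X 1))) / 2)"
proof -
  have rv: "random_variable borel (X i)" if "1 \<le> i" for i using indep that by (auto simp: indep_vars_def)
  have om[measurable]: "outer \<in> borel_measurable (borel :: (real ^ 'm) measure)"
    using continuous_on_outer by (rule borel_measurable_continuous_onI)
  define p :: "real ^ 'm \<Rightarrow> (real ^ 'm) \<times> (real ^ 'm ^ 'm)" where "p x = (x, outer x)" for x
  have p[measurable]: "p \<in> borel_measurable borel"
    unfolding p_def[abs_def] by (intro borel_measurable_continuous_onI continuous_on_Pair continuous_on_id continuous_on_outer)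
  define Y where "Y i \<omega> = p (X i \<omega>)" for i \<omega>
  have Yindep: "indep_vars (\<lambda>_. borel) Y {1..}"
    unfolding Y_def using indep_vars_compose2[OF indep, of "\<lambda>_. p" "\<lambda>_. borel"] p by simp
  have Ydistr: "distr M borel (Y i) = distr M borel (Y 1)" if i: "1 \<le> i" for i
  proof -
    have "distr M borel (Y j) = distr (distr M borel (X j)) borel p" if "1 \<le> j" for j
      unfolding Y_def[abs_def] using rv[OF that] by (subst distr_distr) (auto simp: o_def)
    from this[OF i] this[OF order_refl] show ?thesis unfolding distr[OF i] by simp
  qed
  note X1 = integrable_norm_diff_square(1)[OF rv[OF order_refl] X2]
  note cov = covariance_matrix_outer[OF rv[OF order_refl] X2]
  have Yint: "integrable M (Y 1)"
  proof -
    have "integrable M (\<lambda>\<omega>. (X 1 \<omega>, 0 :: real ^ 'm ^ 'm) + (0 :: real ^ 'm, outer (X 1 \<omega>)))"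
      by (intro Bochner_Integration.integrable_add
          integrable_bounded_linear[OF bounded_linear_Pair[OF bounded_linear_ident bounded_linear_zero] X1]
          integrable_bounded_linear[OF bounded_linear_Pair[OF bounded_linear_zero bounded_linear_ident] cov(1)])
    then show ?thesis unfolding Y_def[abs_def] p_def by simp
  qed
  have EY: "expectation (Y 1) = (expectation (X 1), expectation (\<lambda>\<omega>. outer (X 1 \<omega>)))"
    using integral_fst[OF Yint] integral_snd[OF Yint] by (simp add: prod_eq_iff Y_def p_def)
  have Yint': "integrable M (Y i)" if "1 \<le> i" for i
  proof -
    have id: "(\<lambda>y. y) \<in> borel_measurable (borel :: ((real ^ 'm) \<times> (real ^ 'm ^ 'm)) measure)" by simp
    have Yrv: "random_variable borel (Y j)" if "1 \<le> j" for j using Yindep that by (auto simp: indep_vars_def)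
    from integrable_distr_eq[OF Yrv[OF that] id] integrable_distr_eq[OF Yrv[OF order_refl] id] Ydistr[OF that] Yint
    show ?thesis by metis
  qed
  define F where "F z = c * det (fst z *\<^sub>R (snd (snd z) - outer (fst (snd z))))" for z :: "real \<times> (real ^ 'm) \<times> (real ^ 'm ^ 'm)"
  have Fcont: "continuous_on UNIV F"
    unfolding F_def[abs_def]
    by (intro continuous_on_mult continuous_on_const continuous_on_compose2[OF continuous_on_det] continuous_on_scaleR
        continuous_on_diff continuous_on_compose2[OF continuous_on_outer] continuous_on_fst continuous_on_snd continuous_on_id) auto
  have Fpos: "F (1, expectation (Y 1)) = c * det (covariance_matrix M (X 1))"
    unfolding F_def EY cov(2) by simp
  have "tendsto_in_prob M (\<lambda>N \<omega>. ln (F (real N / (real N - 1), (\<Sum>i=1..N. Y i \<omega>) /\<^sub>R real N)) / 2) (ln (F (1, expectation (Y 1))) / 2)"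
  proof (rule tendsto_in_prob_compose[where h = "\<lambda>z. ln (F z) / 2" and Y = "\<lambda>N \<omega>. (\<Sum>i=1..N. Y i \<omega>) /\<^sub>R real N"])
    show "(\<lambda>N. expectation (\<lambda>\<omega>. norm ((\<Sum>i=1..N. Y i \<omega>) /\<^sub>R real N - expectation (Y 1)))) \<longlonglongrightarrow> 0"
      by (rule weak_law_L1[OF Yindep Ydistr Yint])
    show "integrable M (\<lambda>\<omega>. (\<Sum>i=1..N. Y i \<omega>) /\<^sub>R real N)" for N
      by (intro integrable_scaleR_right Bochner_Integration.integrable_sum Yint') auto
    show "(\<lambda>N. real N / (real N - 1)) \<longlonglongrightarrow> 1" by real_asymp
    have "isCont F (1, expectation (Y 1))" using Fcont unfolding continuous_on_eq_continuous_at[OF open_UNIV] by (rule bspec) simp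
    moreover have "F (1, expectation (Y 1)) \<noteq> 0" using det c unfolding Fpos by simp
    ultimately show "isCont (\<lambda>z. ln (F z) / 2) (1, expectation (Y 1))" by (intro continuous_intros) auto
    have [measurable]: "F \<in> borel_measurable borel" using Fcont by (rule borel_measurable_continuous_onI)
    show "(\<lambda>z. ln (F z) / 2) \<in> borel_measurable borel" by measurable
  qed
  then have "tendsto_in_prob M (\<lambda>N \<omega>. ln (F (real N / (real N - 1), (\<Sum>i=1..N. Y i \<omega>) /\<^sub>R real N)) / 2) (ln (c * det (covariance_matrix M (X 1))) / 2)"
    unfolding Fpos .
  \<comment> \<open>At N = 1 the factor N / (N - 1) is a division by zero with value 0; the
    identification with \<open>sample_cov\<close> starts at N = 2.\<close>
  moreover have "\<forall>\<^sub>F N in sequentially. \<forall>\<omega>. ln (F (real N / (real N - 1), (\<Sum>i=1..N. Y i \<omega>) /\<^sub>R real N)) / 2 = ln (c * det (sample_cov N (\<lambda>i. X i \<omega>))) / 2"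
    using eventually_ge_at_top[of 2]
  proof eventually_elim
    case (elim N)
    have "(\<Sum>i=1..N. Y i \<omega>) /\<^sub>R real N = ((\<Sum>i=1..N. X i \<omega>) /\<^sub>R real N, (\<Sum>i=1..N. outer (X i \<omega>)) /\<^sub>R real N)" for \<omega>
      by (simp add: prod_eq_iff fst_sum snd_sum Y_def p_def)
    then show ?case by (simp add: F_def sample_cov_eq[OF elim])
  qed
  ultimately show ?thesis by (rule tendsto_in_prob_cong[rotated])
qed

text \<open>The mean and covariance in the theorem belong to X on its own probability space, while
  the sample lives on another one. Only the distribution is shared.\<close>

lemma covariance_matrix_cong_distr:
  fixes X :: "'a \<Rightarrow> real ^ 'm::finite" and Y :: "'b \<Rightarrow> real ^ 'm"
  assumes X: "X \<in> borel_measurable P" and Y: "Y \<in> borel_measurable M" and eq: "distr P borel X = distr M borel Y"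
  shows "integral\<^sup>L P X = integral\<^sup>L M Y" "covariance_matrix P X = covariance_matrix M Y"
proof -
  have E: "(\<integral>\<omega>. g (X \<omega>) \<partial>P) = (\<integral>\<omega>. g (Y \<omega>) \<partial>M)" if "g \<in> borel_measurable borel" for g :: "real ^ 'm \<Rightarrow> 'c::{banach, second_countable_topology}"
    using integral_distr[OF X that] integral_distr[OF Y that] eq by simp
  show mean: "integral\<^sup>L P X = integral\<^sup>L M Y" using E[of "\<lambda>x. x"] by simp
  show "covariance_matrix P X = covariance_matrix M Y"
    unfolding covariance_matrix_def mean vec_eq_iff vec_lambda_beta
  proof (intro allI)
    fix a b
    show "(\<integral>\<omega>. (X \<omega> - integral\<^sup>L M Y) $ a * (X \<omega> - integral\<^sup>L M Y) $ b \<partial>P) = (\<integral>\<omega>. (Y \<omega> - integral\<^sup>L M Y) $ a * (Y \<omega> - integral\<^sup>L M Y) $ b \<partial>M)"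
      by (rule E) measurable
  qed
qed

section \<open>Poisson limit of the trinomial distribution\<close>

definition poisson_below :: "nat \<Rightarrow> real \<Rightarrow> real" where
  "poisson_below k c = (\<Sum>a<k. exp (- c) * c ^ a / fact a)"

text \<open>For n independent points and disjoint sets of probabilities p and q: the probability
  that fewer than k points fall into the first set and fewer than l into the second. With q = 0 and
  l = 1 this is the binomial probability of fewer than k successes, so one limit theorem covers
  single points and pairs.\<close>

definition trinomial_below :: "nat \<Rightarrow> nat \<Rightarrow> nat \<Rightarrow> real \<Rightarrow> real \<Rightarrow> real" where
  "trinomial_below n k l p q =
     (\<Sum>a<k. \<Sum>b<l. real (n choose a) * real ((n - a) choose b) * p ^ a * q ^ b * (1 - p - q) ^ (n - a - b))"

lemma sum_subsets_by_card:
  fixes \<phi> :: "nat \<Rightarrow> real"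
  assumes "finite I"
  shows "(\<Sum>A\<in>{A. A \<subseteq> I \<and> card A < k}. \<phi> (card A)) = (\<Sum>a<k. real (card I choose a) * \<phi> a)"
proof -
  have "(\<Sum>A\<in>{A. A \<subseteq> I \<and> card A < k}. \<phi> (card A))
      = (\<Sum>a<k. \<Sum>A\<in>{A \<in> {A. A \<subseteq> I \<and> card A < k}. card A = a}. \<phi> (card A))"
    using assms by (intro sum.group[symmetric]) auto
  also have "\<dots> = (\<Sum>a<k. \<Sum>A\<in>{A. A \<subseteq> I \<and> card A = a}. \<phi> a)"
    by (intro sum.cong) auto
  also have "\<dots> = (\<Sum>a<k. real (card I choose a) * \<phi> a)"
    using assms by (simp add: n_subsets)
  finally show ?thesis .
qed

text \<open>The event splits according to the exact sets A and B of indices whose coordinates lie in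
  U and in V. Each piece is a product set whose probability depends on A and B only through their
  sizes, so binomial coefficients count the pieces.\<close>

lemma (in prob_space) PiM_trinomial:
  fixes I :: "'i set"
  assumes I: "finite I" and U: "U \<in> sets M" and V: "V \<in> sets M" and disj: "U \<inter> V = {}"
  shows "measure (PiM I (\<lambda>_. M))
           {\<omega> \<in> space (PiM I (\<lambda>_. M)). card {j\<in>I. \<omega> j \<in> U} < k \<and> card {j\<in>I. \<omega> j \<in> V} < l}
         = trinomial_below (card I) k l (prob U) (prob V)"
proof -
  interpret PS: finite_product_prob_space "\<lambda>_. M" I
    by unfold_locales (use I in auto)
  let ?Pi = "PiM I (\<lambda>_. M)"
  let ?C = "\<lambda>\<omega>. card {j\<in>I. \<omega> j \<in> U} < k \<and> card {j\<in>I. \<omega> j \<in> V} < l"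
  let ?h = "\<lambda>a b. prob U ^ a * (prob V ^ b * (1 - prob U - prob V) ^ (card I - a - b))"
  define W where "W = space M - U - V"
  have W: "W \<in> sets M" unfolding W_def using U V by auto
  have probW: "prob W = 1 - prob U - prob V"
  proof -
    have "prob (U \<union> V) = prob U + prob V" using U V disj by (intro finite_measure_Union) auto
    moreover have "W = space M - (U \<union> V)" by (auto simp: W_def)
    ultimately show ?thesis using U V prob_compl[of "U \<union> V"] by auto
  qed
  \<comment> \<open>The cell prescribed for coordinate j once A and B are fixed; \<open>W\<close> is
    the complement of both sets.\<close>
  define E where "E = (\<lambda>(A :: 'i set, B) j. if j \<in> A then U else if j \<in> B then V else W)"
  let ?S = "\<lambda>\<omega> U. {j\<in>I. \<omega> j \<in> U}"
  define S where "S = (SIGMA A:{A. A \<subseteq> I \<and> card A < k}. {B. B \<subseteq> I - A \<and> card B < l})"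
  have finS: "finite S" unfolding S_def using I by (auto intro!: finite_SigmaI)
  have Esets: "E s j \<in> sets M" for s j unfolding E_def using U V W by (auto split: prod.split)
  have meas: "PiE I (E s) \<in> sets ?Pi" for s using I Esets by (auto intro!: sets_PiM_I_finite)
  have mem: "\<omega> \<in> PiE I (E (A, B)) \<longleftrightarrow> \<omega> \<in> space ?Pi \<and> A = ?S \<omega> U \<and> B = ?S \<omega> V"
    if "(A, B) \<in> S" for \<omega> A B
  proof
    assume w: "\<omega> \<in> PiE I (E (A, B))"
    have "\<omega> j \<in> E (A,B) j" if "j \<in> I" for j using w that by auto
    moreover have "A \<subseteq> I" "B \<subseteq> I - A" using that by (auto simp: S_def)
    moreover have "\<omega> \<in> space ?Pi" using sets.sets_into_space[OF meas] w by auto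
    ultimately show "\<omega> \<in> space ?Pi \<and> A = ?S \<omega> U \<and> B = ?S \<omega> V"
      using disj by (fastforce simp: E_def W_def split: if_splits)
  next
    assume "\<omega> \<in> space ?Pi \<and> A = ?S \<omega> U \<and> B = ?S \<omega> V"
    then show "\<omega> \<in> PiE I (E (A, B))"
      by (auto simp: space_PiM E_def W_def PiE_iff)
  qed
  have eq: "{\<omega> \<in> space ?Pi. ?C \<omega>} = (\<Union>s\<in>S. PiE I (E s))"
  proof (rule set_eqI)
    fix \<omega>
    have "\<omega> \<in> (\<Union>s\<in>S. PiE I (E s)) \<longleftrightarrow> (\<exists>A B. (A,B) \<in> S \<and> \<omega> \<in> PiE I (E (A,B)))" by auto
    also have "\<dots> \<longleftrightarrow> \<omega> \<in> space ?Pi \<and> (?S \<omega> U, ?S \<omega> V) \<in> S"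
    proof
      assume "\<exists>A B. (A,B) \<in> S \<and> \<omega> \<in> PiE I (E (A,B))"
      then obtain A B where AB: "(A,B) \<in> S" "\<omega> \<in> PiE I (E (A,B))" by blast
      with mem[OF AB(1), of \<omega>] show "\<omega> \<in> space ?Pi \<and> (?S \<omega> U, ?S \<omega> V) \<in> S" by auto
    next
      assume "\<omega> \<in> space ?Pi \<and> (?S \<omega> U, ?S \<omega> V) \<in> S"
      then show "\<exists>A B. (A,B) \<in> S \<and> \<omega> \<in> PiE I (E (A,B))"
        using mem[of "?S \<omega> U" "?S \<omega> V" \<omega>] by blast
    qed
    also have "\<dots> \<longleftrightarrow> \<omega> \<in> {\<omega> \<in> space ?Pi. ?C \<omega>}"
      using disj by (auto simp: S_def)
    finally show "\<omega> \<in> {\<omega> \<in> space ?Pi. ?C \<omega>} \<longleftrightarrow> \<omega> \<in> (\<Union>s\<in>S. PiE I (E s))" by simp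
  qed
  have dj: "disjoint_family_on (\<lambda>s. PiE I (E s)) S"
    unfolding disjoint_family_on_def
  proof (intro ballI impI)
    fix s t assume st: "s \<in> S" "t \<in> S" "s \<noteq> t"
    obtain A B A' B' where [simp]: "s = (A,B)" "t = (A',B')" by fastforce
    show "PiE I (E s) \<inter> PiE I (E t) = {}" using st mem[of A B] mem[of A' B'] by auto
  qed
  have "measure ?Pi {\<omega> \<in> space ?Pi. ?C \<omega>}
      = (\<Sum>s\<in>S. measure ?Pi (PiE I (E s)))"
    unfolding eq using meas by (intro PS.finite_measure_finite_Union[OF finS _ dj]) auto
  also have "\<dots> = (\<Sum>s\<in>S. \<Prod>j\<in>I. prob (E s j))"
    using I Esets by (intro sum.cong refl PS.prob_times) 
  also have "\<dots> = (\<Sum>(A,B)\<in>S. ?h (card A) (card B))"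
  proof (intro sum.cong refl, safe)
    fix A B assume s: "(A,B) \<in> S"
    then have sub: "A \<subseteq> I" "B \<subseteq> I - A" by (auto simp: S_def)
    have fin: "finite A" "finite B" using sub I by (auto intro: finite_subset)
    have "(\<Prod>j\<in>I. prob (E (A,B) j)) = (\<Prod>j\<in>A. prob (E (A,B) j)) * (\<Prod>j\<in>I - A. prob (E (A,B) j))"
      using prod.subset_diff[OF sub(1) I, of "\<lambda>j. prob (E (A,B) j)"] by (simp add: mult.commute)
    also have "(\<Prod>j\<in>I - A. prob (E (A,B) j)) = (\<Prod>j\<in>B. prob (E (A,B) j)) * (\<Prod>j\<in>I - A - B. prob (E (A,B) j))"
      using prod.subset_diff[OF sub(2), of "\<lambda>j. prob (E (A,B) j)"] I by (simp add: mult.commute)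
    also have "(\<Prod>j\<in>A. prob (E (A,B) j)) = (\<Prod>j\<in>A. prob U)" by (intro prod.cong) (auto simp: E_def)
    also have "(\<Prod>j\<in>B. prob (E (A,B) j)) = (\<Prod>j\<in>B. prob V)" using sub by (intro prod.cong) (auto simp: E_def)
    also have "(\<Prod>j\<in>I - A - B. prob (E (A,B) j)) = (\<Prod>j\<in>I - A - B. prob W)" by (intro prod.cong) (auto simp: E_def)
    finally have P: "(\<Prod>j\<in>I. prob (E (A,B) j)) = (\<Prod>j\<in>A. prob U) * ((\<Prod>j\<in>B. prob V) * (\<Prod>j\<in>I - A - B. prob W))" .
    have "card (I - A - B) = card I - card A - card B"
      using sub fin I by (simp add: card_Diff_subset)
    with P show "(\<Prod>j\<in>I. prob (E (A,B) j)) = ?h (card A) (card B)"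
      by (simp add: probW)
  qed
  also have "\<dots> = (\<Sum>A | A \<subseteq> I \<and> card A < k. \<Sum>B | B \<subseteq> I - A \<and> card B < l.
       ?h (card A) (card B))"
    unfolding S_def using I by (subst sum.Sigma) auto
  also have "\<dots> = (\<Sum>A | A \<subseteq> I \<and> card A < k. \<Sum>b<l. real ((card I - card A) choose b) * 
       ?h (card A) b)"
  proof (intro sum.cong refl)
    fix A assume A: "A \<in> {A. A \<subseteq> I \<and> card A < k}"
    then have "card (I - A) = card I - card A" using I by (auto simp: card_Diff_subset finite_subset)
    then show "(\<Sum>B | B \<subseteq> I - A \<and> card B < l.
       ?h (card A) (card B)) = (\<Sum>b<l. real ((card I - card A) choose b) * 
       ?h (card A) b)"
      using sum_subsets_by_card[where I = "I - A" and k = l and \<phi> = "\<lambda>b. ?h (card A) b"] I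
      by simp
  qed
  also have "\<dots> = (\<Sum>a<k. real (card I choose a) * (\<Sum>b<l. real ((card I - a) choose b) * 
       ?h a b))"
    using sum_subsets_by_card[OF I, where k = k and \<phi> = "\<lambda>a. \<Sum>b<l. real ((card I - a) choose b) * 
       ?h a b"] by simp
  also have "\<dots> = trinomial_below (card I) k l (prob U) (prob V)"
    unfolding trinomial_below_def by (simp add: sum_distrib_left mult_ac)
  finally show ?thesis .
qed

text \<open>The shift c accounts for the points already placed in the first ball when the second is
  filled from the rest. The induction multiplies by the ratio (n - c - b) / (b + 1).\<close>

lemma binomial_div_power_tendsto:
  "(\<lambda>n. real ((n - c) choose b) / real n ^ b) \<longlonglongrightarrow> 1 / fact b"
proof (induction b)
  case 0 show ?case by simp
next
  case (Suc b)
  have "(\<lambda>n. (real (n - c) - real b) / real n) \<longlonglongrightarrow> 1"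
  proof (rule Lim_transform_eventually)
    show "(\<lambda>n. 1 - (real c + real b) / real n) \<longlonglongrightarrow> 1" by real_asymp
    show "\<forall>\<^sub>F n in sequentially. 1 - (real c + real b) / real n = (real (n - c) - real b) / real n"
      using eventually_ge_at_top[of "c+1"] by eventually_elim (auto simp: field_simps of_nat_diff)
  qed
  then have "(\<lambda>n. real ((n - c) choose b) / real n ^ b * ((real (n - c) - real b) / real n) / real (Suc b)) \<longlonglongrightarrow> 1 / fact b * 1 / real (Suc b)"
    by (intro tendsto_mult tendsto_divide Suc.IH tendsto_const) auto
  moreover have "real ((n - c) choose b) / real n ^ b * ((real (n - c) - real b) / real n) / real (Suc b)
      = real ((n - c) choose Suc b) / real n ^ Suc b" for n
  proof -
    have "real (Suc b) * real ((n - c) choose Suc b) = (real (n - c) - real b) * real ((n-c) choose b)"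
    proof (cases "b \<le> n - c")
      case True
      have "Suc b * ((n - c) choose Suc b) = (n - c - b) * ((n-c) choose b)"
        by (metis binomial_absorb_comp binomial_absorption mult.commute)
      then have "real (Suc b * ((n - c) choose Suc b)) = real ((n - c - b) * ((n-c) choose b))" by simp
      then show ?thesis by (simp only: of_nat_mult of_nat_diff[OF True])
    qed (auto simp: binomial_eq_0)
    then have "real ((n - c) choose Suc b) = (real (n - c) - real b) * real ((n-c) choose b) / real (Suc b)"
      by (simp add: eq_divide_eq mult.commute)
    then show ?thesis by (simp add: mult_ac)
  qed
  ultimately show ?case by (simp add: mult_ac)
qed

lemma tendsto_null_if_scaled:
  fixes z :: "nat \<Rightarrow> real"
  assumes "(\<lambda>n. real n * z n) \<longlonglongrightarrow> y"
  shows "z \<longlonglongrightarrow> 0"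
proof (rule Lim_transform_eventually)
  show "(\<lambda>n. (real n * z n) * (1 / real n)) \<longlonglongrightarrow> 0"
    using tendsto_mult[OF assms lim_1_over_n] by simp
  show "\<forall>\<^sub>F n in sequentially. real n * z n * (1 / real n) = z n"
    using eventually_gt_at_top[of 0] by eventually_elim auto
qed

text \<open>The base varies with n, so the logarithm is controlled through \<open>h\<close>, the
  continuous extension of ln (1 - u) / u by its limit -1 at 0. The value at 0 matters because x n
  may vanish, as when a ball has probability zero.\<close>

lemma exp_limit_tendsto:
  fixes x :: "nat \<Rightarrow> real"
  assumes "(\<lambda>n. real n * x n) \<longlonglongrightarrow> y"
  shows "(\<lambda>n. (1 - x n) ^ n) \<longlonglongrightarrow> exp (- y)"
proof -
  note x0 = tendsto_null_if_scaled[OF assms]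
  have "((\<lambda>u. ln (1 - u)) has_real_derivative -1) (at 0)"
    by (auto intro!: derivative_eq_intros)
  then have d: "(\<lambda>u::real. ln (1 - u) / u) \<midarrow>0\<rightarrow> -1" by (simp add: has_field_derivative_iff)
  define h where "h u = (if u = 0 then -1 else ln (1 - u) / u)" for u :: real
  have "h \<midarrow>0\<rightarrow> -1" using d
    by (rule Lim_transform_within[where d=1]) (auto simp: h_def)
  then have "isCont h 0" unfolding isCont_def by (simp add: h_def)
  then have "(\<lambda>n. h (x n)) \<longlonglongrightarrow> h 0" using x0 isCont_tendsto_compose by blast
  then have "(\<lambda>n. exp (real n * x n * h (x n))) \<longlonglongrightarrow> exp (y * h 0)"
    using assms by (intro tendsto_intros)
  moreover have "\<forall>\<^sub>F n in sequentially. exp (real n * x n * h (x n)) = (1 - x n) ^ n"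
  proof -
    have "\<forall>\<^sub>F n in sequentially. x n < 1" using x0 by (simp add: order_tendstoD(2))
    then show ?thesis
    proof eventually_elim
      case (elim n)
      have "x n * h (x n) = ln (1 - x n)" by (auto simp: h_def)
      then have "exp (real n * x n * h (x n)) = exp (real n * ln (1 - x n))" by (simp add: mult.assoc)
      also have "\<dots> = (1 - x n) ^ n" using elim by (simp add: exp_of_nat_mult)
      finally show ?case .
    qed
  qed
  ultimately show ?thesis using Lim_transform_eventually by (fastforce simp: h_def)
qed

text \<open>The limit factors, which expresses the asymptotic independence of the two counts: the
  n-th power tends to exp (- (c + d)) = exp (- c) exp (- d).\<close>

lemma trinomial_below_tendsto:
  assumes p: "(\<lambda>n. real n * p n) \<longlonglongrightarrow> c" and q: "(\<lambda>n. real n * q n) \<longlonglongrightarrow> d"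
  shows "(\<lambda>n. trinomial_below n k l (p n) (q n)) \<longlonglongrightarrow> poisson_below k c * poisson_below l d"
proof -
  note small = tendsto_null_if_scaled
  have "(\<lambda>n. trinomial_below n k l (p n) (q n)) \<longlonglongrightarrow>
      (\<Sum>a<k. \<Sum>b<l. 1 / fact a * c ^ a * (1 / fact b * d ^ b) * (exp (- (c + d)) / (1 - 0 - 0) ^ (a + b)))"
    unfolding trinomial_below_def
  proof (intro tendsto_sum)
    fix a b
    have "(\<lambda>n. real n * (p n + q n)) \<longlonglongrightarrow> c + d"
      using tendsto_add[OF p q] by (simp add: algebra_simps)
    from exp_limit_tendsto[OF this]
    have e: "(\<lambda>n. (1 - p n - q n) ^ n) \<longlonglongrightarrow> exp (- (c + d))" by (simp add: algebra_simps)
    \<comment> \<open>Each factor is normalised by a power of n, and the power n - a - b is written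
      as a quotient whose denominator is a fixed power of a quantity tending to 1.\<close>
    have "(\<lambda>n. real ((n - 0) choose a) / real n ^ a * (real n * p n) ^ a *
        (real ((n - a) choose b) / real n ^ b * (real n * q n) ^ b) * ((1 - p n - q n) ^ n / (1 - p n - q n) ^ (a + b)))
      \<longlonglongrightarrow> 1 / fact a * c ^ a * (1 / fact b * d ^ b) * (exp (- (c + d)) / (1 - 0 - 0) ^ (a + b))" (is "?A \<longlonglongrightarrow> _")
      by (intro tendsto_intros binomial_div_power_tendsto p q e small[OF p] small[OF q]) auto
    moreover have "\<forall>\<^sub>F n in sequentially. ?A n = 
       real (n choose a) * real ((n - a) choose b) * p n ^ a * q n ^ b * (1 - p n - q n) ^ (n - a - b)"
    proof -
      have "(\<lambda>n. p n + q n) \<longlonglongrightarrow> 0 + 0" by (intro tendsto_add small[OF p] small[OF q])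
      then have "\<forall>\<^sub>F n in sequentially. p n + q n < 1" by (rule order_tendstoD(2)) simp
      then show ?thesis using eventually_gt_at_top[of "a + b"]
      proof eventually_elim
        case (elim n)
        have "(1 - p n - q n) ^ n / (1 - p n - q n) ^ (a + b) = (1 - p n - q n) ^ (n - a - b)"
          using elim by (subst power_diff[symmetric]) (auto simp: diff_diff_left)
        then show ?case using elim by (simp add: power_mult_distrib)
      qed
    qed
    ultimately show "(\<lambda>n. real (n choose a) * real ((n - a) choose b) * p n ^ a * q n ^ b * (1 - p n - q n) ^ (n - a - b))
      \<longlonglongrightarrow> 1 / fact a * c ^ a * (1 / fact b * d ^ b) * (exp (- (c + d)) / (1 - 0 - 0) ^ (a + b))"
      by (rule Lim_transform_eventually)
  qed
  also have "(\<Sum>a<k. \<Sum>b<l. 1 / fact a * c ^ a * (1 / fact b * d ^ b) * (exp (- (c + d)) / (1 - 0 - 0) ^ (a + b)))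
    = poisson_below k c * poisson_below l d"
  proof -
    have e: "exp (- (c + d)) = exp (- c) * exp (- d)" by (simp add: exp_add[symmetric])
    show ?thesis unfolding poisson_below_def sum_product e by (intro sum.cong refl) simp
  qed
  finally show ?thesis .
qed

section \<open>The Poisson distribution and the digamma function\<close>

text \<open>The signed layer-cake formula. Subtracting the survival function of the constant 0 makes
  the integral converge for either sign of z.\<close>

lemma has_bochner_integral_indicator_lessThan_diff:
  "has_bochner_integral lborel (\<lambda>t. indicator {..<z} t - indicator {..<0} t) (z :: real)"
proof (cases "0 \<le> z")
  case True
  have "has_bochner_integral lborel (indicator {0..<z} :: real \<Rightarrow> real) z"
    using has_bochner_integral_real_indicator[of "{0..<z}" lborel] True by simp
  moreover have "(indicator {0..<z} :: real \<Rightarrow> real) = (\<lambda>t. indicator {..<z} t - indicator {..<0} t)"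
    using True by (auto simp: indicator_def fun_eq_iff)
  ultimately show ?thesis by simp
next
  case False
  have "has_bochner_integral lborel (\<lambda>t. - (indicator {z..<0} t :: real)) (- (- z))"
    using has_bochner_integral_real_indicator[of "{z..<0}" lborel] False
    by (intro has_bochner_integral_minus) simp
  moreover have "(\<lambda>t. - (indicator {z..<0} t :: real)) = (\<lambda>t. indicator {..<z} t - indicator {..<0} t)"
    using False by (auto simp: indicator_def fun_eq_iff)
  ultimately show ?thesis by simp
qed

text \<open>Carries gauge integrals, in which the improper integrals used here are available, over
  to Bochner integrals. Nonnegativity supplies absolute integrability.\<close>

lemma has_bochner_integral_lborel_nonneg:
  fixes f :: "real \<Rightarrow> real"
  assumes "f \<in> borel_measurable borel" "\<And>x. x \<in> S \<Longrightarrow> 0 \<le> f x" "(f has_integral I) S" "S \<in> sets borel"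
  shows "has_bochner_integral lborel (\<lambda>x. indicator S x * f x) I"
proof -
  have I: "((\<lambda>x. indicator S x * f x) has_integral I) UNIV"
  proof -
    have "(\<lambda>x. indicator S x * f x) = (\<lambda>x. if x \<in> S then f x else 0)" by (auto simp: indicator_def)
    then show ?thesis using assms(3) by (simp only: has_integral_restrict_UNIV)
  qed
  then have "integral\<^sup>N lborel (\<lambda>x. ennreal (indicator UNIV x * (indicator S x * f x))) = I"
    using assms(1,2,4) by (intro nn_integral_has_integral_lborel) (auto simp: indicator_def)
  moreover have "0 \<le> I" using I by (rule has_integral_nonneg) (auto simp: indicator_def assms)
  ultimately show ?thesis
    using assms by (intro has_bochner_integral_nn_integral) (auto simp: indicator_def)
qed

lemma has_bochner_integral_exp_lessThan:
  assumes "0 < s"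
  shows "has_bochner_integral lborel (\<lambda>t. indicator {..<0} t * exp (s * t)) (1 / s :: real)"
proof -
  have "((\<lambda>t. exp (- s * t)) has_integral exp (- s * 0) / s) {0..}"
    by (rule has_integral_exp_minus_to_infinity) fact
  then have "((\<lambda>t. exp (- s * t)) has_integral 1 / s) {0<..}"
    by (subst (asm) has_integral_spike_set_eq[of "{0..}" "{0<..}"]) (auto intro: negligible_subset[of "{0}"])
  then have "has_bochner_integral lborel (\<lambda>t. indicator {0<..} t * exp (- s * t)) (1 / s)"
    by (intro has_bochner_integral_lborel_nonneg) auto
  \<comment> \<open>Reflection of the half-line, with Jacobian 1. The endpoint 0 was removed
    beforehand so that the reflected half-line is open.\<close>
  then have "has_bochner_integral lborel (\<lambda>t. indicator {0<..} (0 + -1 * t) * exp (- s * (0 + -1 * t))) (1 / s /\<^sub>R \<bar>-1\<bar>)"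
    by (subst lborel_has_bochner_integral_real_affine_iff[symmetric]) simp_all
  moreover have "(\<lambda>t. indicator {0<..} (0 + -1 * t) * exp (- s * (0 + -1 * t))) = (\<lambda>t. indicator {..<0} t * exp (s * t))"
    by (auto simp: indicator_def fun_eq_iff)
  ultimately show ?thesis by simp
qed

lemma has_bochner_integral_exp_atLeast:
  assumes "0 < s"
  shows "has_bochner_integral lborel (\<lambda>t. indicator {0..} t * exp (- s * t)) (1 / s :: real)"
proof -
  have "((\<lambda>t. exp (- s * t)) has_integral exp (- s * 0) / s) {0..}"
    by (rule has_integral_exp_minus_to_infinity) fact
  then show ?thesis by (intro has_bochner_integral_lborel_nonneg) auto
qed

text \<open>Euler's integral under the substitution u = exp t, which maps the line onto the open
  half-line; the Jacobian exp t raises the exponent s - 1 to s.\<close>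

lemma has_bochner_integral_Gamma_exp:
  assumes "0 < s"
  shows "has_bochner_integral lborel (\<lambda>t. exp (s * t) * exp (- exp t)) (Gamma s :: real)"
proof -
  let ?f = "\<lambda>u. u powr (s - 1) / exp u"
  have I: "(?f has_integral Gamma s) {0<..}"
    using Gamma_integral_real[OF assms]
    by (subst (asm) has_integral_spike_set_eq[of "{0..}" "{0<..}"]) (auto intro: negligible_subset[of "{0}"])
  then have "?f absolutely_integrable_on {0<..}"
    by (intro nonnegative_absolutely_integrable_1) (auto simp: has_integral_integrable)
  moreover have "range exp = {0::real<..}" by (auto simp: image_iff) (metis exp_ln)
  ultimately have "?f absolutely_integrable_on (range exp) \<and> integral (range exp) ?f = Gamma s"
    using I by (auto simp: integral_unique)
  then have "(\<lambda>t. \<bar>exp t\<bar> * ?f (exp t)) absolutely_integrable_on UNIV \<and> integral UNIV (\<lambda>t. \<bar>exp t\<bar> * ?f (exp t)) = Gamma s"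
    by (subst has_absolute_integral_change_of_variables_1') (auto intro!: derivative_eq_intros inj_onI)
  moreover have "(\<lambda>t. \<bar>exp t\<bar> * ?f (exp t)) = (\<lambda>t. exp (s * t) * exp (- exp t))"
    by (auto simp: fun_eq_iff powr_def exp_minus exp_diff left_diff_distrib divide_inverse)
  ultimately have "((\<lambda>t. exp (s * t) * exp (- exp t)) has_integral Gamma s) UNIV"
    by (metis has_integral_integral set_lebesgue_integral_eq_integral(1))
  from has_bochner_integral_lborel_nonneg[OF _ _ this] show ?thesis by simp
qed

lemma poisson_below_Suc: "poisson_below (Suc k) c = poisson_below k c + exp (- c) * c ^ k / fact k"
  by (simp add: poisson_below_def)

text \<open>For k = 1, instead of differentiating under the integral sign, the difference quotients
  of \<open>Gamma\<close> at 1 are recognised as integrals of \<open>h t * exp (s * t)\<close>,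
  which converge by domination as s tends to 0. The step in k matches the recurrence of
  \<open>Digamma\<close>.\<close>

lemma has_bochner_integral_poisson_below_exp:
  assumes "1 \<le> k"
  shows "has_bochner_integral lborel (\<lambda>t. poisson_below k (exp t) - indicator {..<0} t) (Digamma (real k))"
  using assms
proof (induction k rule: dec_induct)
  case base
  define h where "h t = exp (- exp t) - (indicator {..<0} t :: real)" for t
  \<comment> \<open>Dominates \<open>h t * exp (s * t)\<close> for all s in [0, 1]: for t < 0
    because |h t| \<le> exp t, for t \<ge> 0 because exp (s t) \<le> exp t.\<close>
  define w where "w t = indicator {..<0} t * exp t + exp t * exp (- exp t)" for t :: real
  have [measurable]: "h \<in> borel_measurable borel" "w \<in> borel_measurable borel" by (simp_all add: h_def[abs_def] w_def[abs_def])
  have w: "integrable lborel w" unfolding w_def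
    using has_bochner_integral_exp_lessThan[of 1] has_bochner_integral_Gamma_exp[of 1]
    by (intro Bochner_Integration.integrable_add) (auto simp: has_bochner_integral_iff)
  have bound: "norm (h t * exp (s * t)) \<le> w t" if "0 \<le> s" "s \<le> 1" for s t
  proof (cases "t < 0")
    case True
    have "\<bar>h t\<bar> \<le> exp t" using exp_ge_add_one_self[of "- exp t"] True by (simp add: h_def)
    moreover have "exp (s * t) \<le> 1" using True that by (simp add: mult_nonneg_nonpos)
    ultimately have "\<bar>h t\<bar> * exp (s * t) \<le> exp t * 1" by (intro mult_mono) auto
    then show ?thesis using True by (simp add: w_def abs_mult add_increasing2)
  next
    case False
    then have "s * t \<le> t" using that mult_right_mono[of s 1 t] by simp
    then show ?thesis using False by (simp add: w_def h_def abs_mult mult.commute)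
  qed
  define s where "s n = 1 / (real n + 1)" for n
  have s: "0 < s n" "s n \<le> 1" for n by (auto simp: s_def)
  have s0: "s \<longlonglongrightarrow> 0" unfolding s_def by real_asymp
  have lim1: "(\<lambda>n. \<integral>t. h t * exp (s n * t) \<partial>lborel) \<longlonglongrightarrow> (\<integral>t. h t \<partial>lborel)"
  proof (rule integral_dominated_convergence[OF _ _ w])
    show "AE t in lborel. (\<lambda>n. h t * exp (s n * t)) \<longlonglongrightarrow> h t"
    proof (intro AE_I2)
      fix t
      have "(\<lambda>n. h t * exp (s n * t)) \<longlonglongrightarrow> h t * exp (0 * t)" by (intro tendsto_intros s0)
      then show "(\<lambda>n. h t * exp (s n * t)) \<longlonglongrightarrow> h t" by simp
    qed
  qed (use bound s in \<open>auto simp: less_imp_le\<close>)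
  \<comment> \<open>The compensator contributes - 1 / s, and Gamma s - 1 / s is the difference
    quotient because Gamma (1 + s) = s Gamma s and Gamma 1 = 1.\<close>
  have val: "(\<integral>t. h t * exp (s n * t) \<partial>lborel) = (Gamma (1 + s n) - Gamma 1) / (1 + s n - 1)" for n
  proof -
    have "has_bochner_integral lborel (\<lambda>t. exp (s n * t) * exp (- exp t) - indicator {..<0} t * exp (s n * t)) (Gamma (s n) - 1 / s n)"
      by (intro has_bochner_integral_diff has_bochner_integral_Gamma_exp has_bochner_integral_exp_lessThan s)
    then have "(\<integral>t. h t * exp (s n * t) \<partial>lborel) = Gamma (s n) - 1 / s n"
      by (simp add: has_bochner_integral_iff h_def algebra_simps)
    moreover have "Gamma (1 + s n) = s n * Gamma (s n)" using Gamma_plus1[of "s n"] s(1)[of n] by (auto simp: add.commute nonpos_Ints_def)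
    ultimately show ?thesis using s(1)[of n] by (simp add: field_simps)
  qed
  have "(Gamma has_real_derivative Gamma 1 * Digamma 1) (at 1)"
    by (rule has_field_derivative_Gamma) (auto simp: nonpos_Ints_def)
  then have "(\<lambda>y. (Gamma y - Gamma 1) / (y - 1)) \<midarrow>1\<rightarrow> Digamma (1::real)"
    by (simp add: has_field_derivative_iff)
  moreover have "filterlim (\<lambda>n. 1 + s n) (at 1) sequentially"
  proof -
    have "(\<lambda>n. 1 + s n) \<longlonglongrightarrow> 1 + 0" by (intro tendsto_intros s0)
    moreover have "1 + s n \<noteq> 1" for n using s(1)[of n] by simp
    ultimately show ?thesis by (auto simp: filterlim_at)
  qed
  ultimately have "(\<lambda>n. (Gamma (1 + s n) - Gamma 1) / (1 + s n - 1)) \<longlonglongrightarrow> Digamma 1"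
    by (rule filterlim_compose)
  then have "(\<integral>t. h t \<partial>lborel) = Digamma 1" using lim1 unfolding val by (rule LIMSEQ_unique[rotated])
  moreover have "integrable lborel h"
    by (rule Bochner_Integration.integrable_bound[OF w]) (use bound[of 0] in \<open>auto intro: order_trans[OF _ abs_ge_self]\<close>)
  ultimately have "has_bochner_integral lborel h (Digamma 1)" by (simp add: has_bochner_integral_iff)
  then show ?case unfolding h_def by (simp add: poisson_below_def)
next
  case (step k)
  \<comment> \<open>The new Poisson term is exp (k t) exp (- exp t) / k!, a Gamma integral of value
    (k - 1)! / k! = 1 / k.\<close>
  have "has_bochner_integral lborel (\<lambda>t. (poisson_below k (exp t) - indicator {..<0} t) + exp (real k * t) * exp (- exp t) / fact k)
    (Digamma (real k) + Gamma (real k) / fact k)"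
    using step by (intro has_bochner_integral_add step.IH has_bochner_integral_divide_zero has_bochner_integral_Gamma_exp) auto
  moreover have "Gamma (real k) / fact k = 1 / real k"
    using step(1) Gamma_fact[of "k - 1", where 'a = real] by (simp add: fact_reduce of_nat_diff)
  moreover have "Digamma (real (Suc k)) = Digamma (real k) + 1 / real k"
    using step(1) Digamma_plus1[of "real k"] by (simp add: add.commute)
  ultimately show ?case by (simp add: poisson_below_Suc exp_of_nat_mult[symmetric] algebra_simps)
qed

text \<open>Translating t by ln c moves the compensator from 0 to - ln c, and the layer-cake formula
  pays for moving it back. With c = f x this produces the term - ln (f x).\<close>

lemma has_bochner_integral_poisson_below_mult_exp:
  assumes "1 \<le> k" "0 < c"
  shows "has_bochner_integral lborel (\<lambda>t. poisson_below k (c * exp t) - indicator {..<0} t) (Digamma (real k) - ln c)"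
proof -
  have *: "has_bochner_integral lborel (\<lambda>t. poisson_below k (exp (ln c + 1 * t)) - indicator {..<0} (ln c + 1 * t)) (Digamma (real k) /\<^sub>R \<bar>1\<bar>)"
    by (subst lborel_has_bochner_integral_real_affine_iff[symmetric])
       (use has_bochner_integral_poisson_below_exp[OF assms(1)] in simp_all)
  have "has_bochner_integral lborel (\<lambda>t. poisson_below k (c * exp t) - indicator {..<- ln c} t) (Digamma (real k))"
  proof -
    have "indicator {..<0} (ln c + t) = (indicator {..<- ln c} t :: real)" for t by (auto simp: indicator_def)
    with * show ?thesis using assms by (simp add: exp_add)
  qed
  from has_bochner_integral_add[OF this has_bochner_integral_indicator_lessThan_diff[of "- ln c"]]
  show ?thesis by simp
qed

lemma poisson_below_nonneg: "0 \<le> c \<Longrightarrow> 0 \<le> poisson_below k c"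
  unfolding poisson_below_def by (intro sum_nonneg) auto

lemma poisson_below_le_1:
  assumes "0 \<le> c" shows "poisson_below k c \<le> 1"
proof -
  have "(\<Sum>a<k. c ^ a / fact a) \<le> exp c"
    using assms sum_le_suminf[of "\<lambda>n. c ^ n /\<^sub>R fact n" "{..<k}"] summable_exp_generic[of c]
    by (simp add: exp_def divide_inverse mult.commute)
  then have "exp (- c) * (\<Sum>a<k. c ^ a / fact a) \<le> exp (- c) * exp c" by (intro mult_left_mono) auto
  then show ?thesis by (simp add: poisson_below_def sum_distrib_left exp_minus)
qed

lemma borel_measurable_poisson_below[measurable]: "poisson_below k \<in> borel_measurable borel"
  unfolding poisson_below_def[abs_def] by measurable

section \<open>Nearest neighbours\<close>

text \<open>In the sorted list the entries \<le> r form an initial segment, and position k - 1 is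
  the k-th place when counting from 0.\<close>

lemma sort_nth_greater_iff:
  fixes xs :: "real list"
  assumes "1 \<le> k" "k \<le> length xs"
  shows "r < sort xs ! (k - 1) \<longleftrightarrow> length (filter (\<lambda>y. y \<le> r) xs) < k"
proof -
  define ys where "ys = sort xs"
  let ?L = "{i. i < length ys \<and> ys ! i \<le> r}"
  have s: "sorted ys" and len: "length ys = length xs" by (simp_all add: ys_def)
  have "length (filter (\<lambda>y. y \<le> r) xs) = length (filter (\<lambda>y. y \<le> r) ys)"
    unfolding ys_def by (metis mset_filter mset_sort size_mset)
  also have "\<dots> = card ?L"
    by (rule length_filter_conv_card)
  finally have L: "length (filter (\<lambda>y. y \<le> r) xs) = card ?L" .
  have "r < ys ! (k - 1) \<longleftrightarrow> card ?L < k"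
  proof
    assume r: "r < ys ! (k - 1)"
    have "?L \<subseteq> {..<k - 1}"
    proof safe
      fix i assume i: "i < length ys" "ys ! i \<le> r"
      show "i < k - 1"
      proof (rule ccontr)
        assume "\<not> i < k - 1"
        then have "ys ! (k - 1) \<le> ys ! i" using s i by (intro sorted_nth_mono) auto
        then show False using r i by simp
      qed
    qed
    then have "card ?L \<le> card {..<k - 1}" by (intro card_mono) auto
    then show "card ?L < k" using assms by simp
  next
    assume c: "card ?L < k"
    show "r < ys ! (k - 1)"
    proof (rule ccontr)
      assume "\<not> r < ys ! (k - 1)"
      then have "ys ! i \<le> r" if "i < k" for i
        using sorted_nth_mono[OF s, of i "k - 1"] that assms len \<open>\<not> r < ys ! (k - 1)\<close> by fastforce
      then have "{..<k} \<subseteq> ?L" using assms len by auto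
      then have "card {..<k} \<le> card ?L" by (intro card_mono) auto
      then show False using c by simp
    qed
  qed
  then show ?thesis by (simp add: L ys_def)
qed

text \<open>Trades the sorted list for a count of points in a closed ball, whose probability under a
  product measure can be computed. The hypothesis k < N makes the list of N - 1 distances long
  enough.\<close>

lemma knn_dist_greater_iff:
  assumes "1 \<le> k" "k < N" "i \<in> {1..N}"
  shows "r < knn_dist k N x i \<longleftrightarrow> card {j \<in> {1..N} - {i}. dist (x i) (x j) \<le> r} < k"
proof -
  define js where "js = filter (\<lambda>j. j \<noteq> i) [1..<Suc N]"
  have setjs: "set js = {1..N} - {i}" and djs: "distinct js" by (auto simp: js_def)
  have len: "length js = N - 1" using setjs assms distinct_card[OF djs] by simp
  have "r < knn_dist k N x i \<longleftrightarrow> length (filter (\<lambda>y. y \<le> r) (map (\<lambda>j. norm (x i - x j)) js)) < k"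
    unfolding knn_dist_def js_def[symmetric] using assms len by (intro sort_nth_greater_iff) auto
  also have "length (filter (\<lambda>y. y \<le> r) (map (\<lambda>j. norm (x i - x j)) js)) = length (filter (\<lambda>j. dist (x i) (x j) \<le> r) js)"
    by (simp add: filter_map o_def dist_norm)
  also have "\<dots> = card {j \<in> {1..N} - {i}. dist (x i) (x j) \<le> r}"
    using distinct_card[OF distinct_filter[OF djs], of "\<lambda>j. dist (x i) (x j) \<le> r"] setjs by (simp add: Collect_conj_eq Int_commute)
  finally show ?thesis .
qed

lemma card_int_box:
  "card {v :: int ^ 'm::finite. \<forall>a. v $ a \<in> T} = card T ^ CARD('m)"
proof -
  have "bij_betw vec_nth {v :: int ^ 'm. \<forall>a. v $ a \<in> T} (PiE UNIV (\<lambda>_. T))"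
    by (rule bij_betw_byWitness[where f' = vec_lambda]) (auto simp: PiE_iff)
  then show ?thesis by (simp add: bij_betw_same_card card_PiE)
qed

lemma card_le_mult_image:
  assumes "finite S" "finite T" "c ` S \<subseteq> T" "\<And>v. v \<in> T \<Longrightarrow> card {i \<in> S. c i = v} \<le> k"
  shows "card S \<le> k * card T"
proof -
  have "card S = card (\<Union>v\<in>T. {i \<in> S. c i = v})" using assms(3) by (intro arg_cong[where f=card]) auto
  also have "\<dots> \<le> (\<Sum>v\<in>T. card {i \<in> S. c i = v})" using assms(2) by (rule card_UN_le)
  also have "\<dots> \<le> (\<Sum>v\<in>T. k)" using assms(4) by (intro sum_mono) auto
  finally show ?thesis by (simp add: mult.commute)
qed

text \<open>
  Two points in the same cell of a grid of mesh \<open>r / m\<close> are at distance at most \<open>r\<close>, so a cell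
  contains at most \<open>k\<close> points with fewer than \<open>k\<close> neighbours.
\<close>

lemma card_isolated_le:
  fixes x :: "nat \<Rightarrow> real ^ 'm::finite"
  assumes I: "finite I" and r: "0 < r" and rR: "r < 2 * R"
  shows "real (card {i \<in> I. norm (x i) \<le> R \<and> card {j \<in> I - {i}. dist (x i) (x j) \<le> r} < k})
         \<le> real k * (6 * real CARD('m) * R / r) ^ CARD('m)"
proof -
  define m where "m = real CARD('m)"
  define s where "s = r / m"
  have m: "m \<ge> 1" by (simp add: m_def Suc_le_eq)
  have s: "s > 0" "s \<le> r" using m r by (auto simp: s_def field_simps)
  define S where "S = {i \<in> I. norm (x i) \<le> R \<and> card {j \<in> I - {i}. dist (x i) (x j) \<le> r} < k}"
  define c where "c i = (\<chi> a. \<lfloor>x i $ a / s\<rfloor>)" for i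
  define T where "T = {\<lfloor>- R / s\<rfloor>..\<lfloor>R / s\<rfloor>}"
  define TT where "TT = {v :: int ^ 'm. \<forall>a. v $ a \<in> T}"
  have R: "R > 0" using r rR by simp
  have finT: "finite T" by (simp add: T_def)
  have "card T > 0" unfolding T_def using s R by (auto simp: floor_mono card_gt_0_iff)
  then have "card TT > 0" unfolding TT_def card_int_box by simp
  then have finTT: "finite TT" by (rule card_ge_0_finite)
  have "card S \<le> k * card TT"
  proof (rule card_le_mult_image[where c = c])
    show "finite S" using I by (simp add: S_def)
    show "finite TT" by fact
    show "c ` S \<subseteq> TT"
    proof safe
      fix i assume "i \<in> S"
      then have n: "norm (x i) \<le> R" by (simp add: S_def)
      show "c i \<in> TT" unfolding TT_def T_def c_def
      proof (simp, safe)
        fix a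
        have "\<bar>x i $ a\<bar> \<le> R" using component_le_norm_cart[of "x i" a] n by simp
        then have "- R / s \<le> x i $ a / s" "x i $ a / s \<le> R / s"
          using s by (auto intro: divide_right_mono simp del: minus_divide_left[symmetric] divide_minus_left)
        then show "\<lfloor>- (R / s)\<rfloor> \<le> \<lfloor>x i $ a / s\<rfloor>" "\<lfloor>x i $ a / s\<rfloor> \<le> \<lfloor>R / s\<rfloor>" by (auto intro: floor_mono)
      qed
    qed
  next
    fix v assume "v \<in> TT"
    define F where "F = {i \<in> S. c i = v}"
    show "card {i \<in> S. c i = v} \<le> k"
    proof (rule ccontr)
      assume "\<not> card {i \<in> S. c i = v} \<le> k"
      then have kF: "k < card F" by (simp add: F_def)
      have finF: "finite F" using I by (simp add: F_def S_def)
      obtain i where i: "i \<in> F" using kF by fastforce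
      have "dist (x i) (x j) \<le> r" if j: "j \<in> F" for j
      proof -
        have "\<bar>(x i - x j) $ a\<bar> \<le> s" for a
        proof -
          have "\<lfloor>x i $ a / s\<rfloor> = \<lfloor>x j $ a / s\<rfloor>" using i j unfolding F_def c_def by (auto simp: vec_eq_iff)
          then have "\<bar>x i $ a / s - x j $ a / s\<bar> \<le> 1" by linarith
          then show ?thesis using s by (simp add: diff_divide_distrib[symmetric] abs_divide)
        qed
        then have "norm (x i - x j) \<le> (\<Sum>a\<in>(UNIV :: 'm set). s)"
          by (intro order_trans[OF norm_le_l1_cart] sum_mono) auto
        also have "\<dots> = r" using m by (simp add: s_def m_def)
        finally show ?thesis by (simp add: dist_norm)
      qed
      then have "F - {i} \<subseteq> {j \<in> I - {i}. dist (x i) (x j) \<le> r}" by (auto simp: F_def S_def)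
      then have "card (F - {i}) \<le> card {j \<in> I - {i}. dist (x i) (x j) \<le> r}" using I by (intro card_mono) auto
      moreover have "card (F - {i}) = card F - 1" using i finF by simp
      moreover have "card {j \<in> I - {i}. dist (x i) (x j) \<le> r} < k" using i by (auto simp: F_def S_def)
      ultimately show False using kF by simp
    qed
  qed
  then have "real (card S) \<le> real (k * card TT)" by (simp only: of_nat_le_iff)
  also have "\<dots> = real k * real (card T) ^ CARD('m)" by (simp add: TT_def card_int_box)
  also have "\<dots> \<le> real k * (6 * m * R / r) ^ CARD('m)"
  proof (intro mult_left_mono power_mono)
    \<comment> \<open>An axis meets at most 2 R / s + 2 cells, and the summand 2 is at most 4 R / s
      since s \<le> r < 2 R. This is the origin of the constant 6.\<close>
    have 1: "real (card T) \<le> 2 * (R / s) + 2"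
      unfolding T_def using s R by (simp add: nat_add_distrib floor_mono) linarith
    have 2: "2 \<le> 4 * (R / s)" using s rR by (simp add: field_simps)
    have 3: "R / s = m * R / r" using r m by (simp add: s_def)
    from 1 2 have "real (card T) \<le> 6 * (R / s)" by linarith
    then show "real (card T) \<le> 6 * m * R / r" by (simp add: 3)
  qed auto
  finally show ?thesis by (simp add: S_def m_def)
qed

section \<open>Points in small balls\<close>

lemma measurable_card_less[measurable (raw)]:
  assumes "finite I" and [measurable]: "\<And>j. j \<in> I \<Longrightarrow> Measurable.pred M (\<lambda>x. P x j)"
  shows "Measurable.pred M (\<lambda>x. card {j \<in> I. P x j} < k)"
proof -
  have "real (card {j \<in> I. P x j}) = (\<Sum>j\<in>I. if P x j then 1 else 0)" for x
    using assms(1) by (simp add: sum.If_cases Int_def)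
  then have "(card {j \<in> I. P x j} < k) = ((\<Sum>j\<in>I. if P x j then 1 else 0) < real k)" for x
    by (metis of_nat_less_iff)
  then show ?thesis by simp
qed

text \<open>With i as the point whose neighbours are counted, this conditions on its location y
  while the other points stay independent.\<close>

lemma (in product_sigma_finite) emeasure_PiM_insert:
  assumes I: "finite I" "i \<notin> I" and P: "Measurable.pred (PiM (insert i I) M) P"
  shows "emeasure (PiM (insert i I) M) {w \<in> space (PiM (insert i I) M). P w}
    = (\<integral>\<^sup>+y. emeasure (PiM I M) {w \<in> space (PiM I M). P (w(i := y))} \<partial>M i)"
proof -
  let ?A = "{w \<in> space (PiM (insert i I) M). P w}"
  have A: "?A \<in> sets (PiM (insert i I) M)" using P by simp
  have "emeasure (PiM (insert i I) M) ?A = (\<integral>\<^sup>+w. indicator ?A w \<partial>PiM (insert i I) M)"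
    using A by simp
  also have "\<dots> = (\<integral>\<^sup>+y. (\<integral>\<^sup>+w. indicator ?A (w(i := y)) \<partial>PiM I M) \<partial>M i)"
    using A by (intro product_nn_integral_insert_rev I) simp
  also have "\<dots> = (\<integral>\<^sup>+y. emeasure (PiM I M) {w \<in> space (PiM I M). P (w(i := y))} \<partial>M i)"
  proof (rule nn_integral_cong)
    fix y assume y: "y \<in> space (M i)"
    have m: "(\<lambda>w. w(i := y)) \<in> measurable (PiM I M) (PiM (insert i I) M)"
      using y by (intro measurable_fun_upd[where J = I]) auto
    have B: "{w \<in> space (PiM I M). P (w(i := y))} \<in> sets (PiM I M)"
      using measurable_compose[OF m P] by simp
    have "(\<integral>\<^sup>+w. indicator ?A (w(i := y)) \<partial>PiM I M) = (\<integral>\<^sup>+w. indicator {w \<in> space (PiM I M). P (w(i := y))} w \<partial>PiM I M)"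
      using measurable_space[OF m] by (intro nn_integral_cong) (auto simp: indicator_def)
    then show "(\<integral>\<^sup>+w. indicator ?A (w(i := y)) \<partial>PiM I M) = emeasure (PiM I M) {w \<in> space (PiM I M). P (w(i := y))}"
      using B by simp
  qed
  finally show ?thesis .
qed

lemma trinomial_below_borel[measurable (raw)]:
  assumes "p \<in> borel_measurable M" "q \<in> borel_measurable M"
  shows "(\<lambda>x. trinomial_below n k l (p x) (q x)) \<in> borel_measurable M"
  unfolding trinomial_below_def using assms by measurable

definition kl_radius :: "nat \<Rightarrow> nat \<Rightarrow> real \<Rightarrow> real" where
  "kl_radius m N t = root m (exp t / (real N * unit_ball_vol (real m)))"

locale bounded_density =
  fixes f :: "real ^ 'm::finite \<Rightarrow> real" and C :: real
  assumes f_nonneg: "0 \<le> f x" and f_cont: "continuous_on UNIV f" and f_le: "f x \<le> C"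
    and f_prob: "prob_space (density lborel (\<lambda>x. ennreal (f x)))"
begin

abbreviation D :: "(real ^ 'm) measure" where "D \<equiv> density lborel (\<lambda>x. ennreal (f x))"

sublocale D: prob_space D by (rule f_prob)

sublocale PD: product_prob_space "\<lambda>_. D" I for I ..

lemma f_borel[measurable]: "f \<in> borel_measurable borel"
  using f_cont by (rule borel_measurable_continuous_onI)

lemma V_pos: "0 < unit_ball_vol (real CARD('m))" by (simp add: unit_ball_vol_pos)

lemma C_nonneg: "0 \<le> C" using f_nonneg f_le order_trans by blast

lemma rad_pos: "0 < N \<Longrightarrow> 0 < kl_radius CARD('m) N t"
  using V_pos by (simp add: kl_radius_def)

lemma rad_power: "0 < N \<Longrightarrow> unit_ball_vol (real CARD('m)) * kl_radius CARD('m) N t ^ CARD('m) = exp t / real N"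
  using V_pos by (simp add: kl_radius_def real_root_pow_pos2 V_pos[THEN less_imp_neq, symmetric])

lemma rad_tendsto_0: "(\<lambda>n. kl_radius CARD('m) n t) \<longlonglongrightarrow> 0"
proof -
  have "(\<lambda>n. exp t / unit_ball_vol (real CARD('m)) * (1 / real n)) \<longlonglongrightarrow> exp t / unit_ball_vol (real CARD('m)) * 0" by (intro tendsto_intros lim_1_over_n)
  then have "(\<lambda>n. exp t / (real n * unit_ball_vol (real CARD('m)))) \<longlonglongrightarrow> 0" by (simp add: field_simps)
  from tendsto_real_root[OF this, of "CARD('m)"] show ?thesis by (simp add: kl_radius_def)
qed

section \<open>Mass of small balls\<close>

lemma measure_cball_le:
  assumes "0 \<le> r" shows "measure D (cball x r) \<le> C * (unit_ball_vol (real CARD('m)) * r ^ CARD('m))"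
proof -
  have "emeasure D (cball x r) = (\<integral>\<^sup>+y. ennreal (f y) * indicator (cball x r) y \<partial>lborel)"
    by (subst emeasure_density) auto
  also have "\<dots> \<le> (\<integral>\<^sup>+y. ennreal C * indicator (cball x r) y \<partial>lborel)"
    by (intro nn_integral_mono mult_right_mono ennreal_leI f_le) auto
  also have "\<dots> = ennreal C * emeasure lborel (cball x r)" by (simp add: nn_integral_cmult_indicator)
  also have "\<dots> = ennreal (C * (unit_ball_vol (real CARD('m)) * r ^ CARD('m)))"
    using assms C_nonneg V_pos by (simp add: emeasure_cball ennreal_mult')
  finally show ?thesis
    using assms C_nonneg V_pos by (simp add: D.emeasure_eq_measure)
qed

lemma measure_cball_approx:
  assumes r: "0 \<le> r" and \<epsilon>: "\<And>y. y \<in> cball x r \<Longrightarrow> \<bar>f y - f x\<bar> \<le> \<epsilon>"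
  shows "\<bar>measure D (cball x r) - f x * (unit_ball_vol (real CARD('m)) * r ^ CARD('m))\<bar> \<le> \<epsilon> * (unit_ball_vol (real CARD('m)) * r ^ CARD('m))"
proof -
  let ?v = "unit_ball_vol (real CARD('m)) * r ^ CARD('m)"
  have v: "measure lborel (cball x r) = ?v" "0 \<le> ?v" using r V_pos by (simp_all add: content_cball)
  have ind: "integrable lborel (\<lambda>y. c * indicator (cball x r) y :: real)" for c
  proof -
    have "emeasure lborel (cball x r) < \<infinity>" by (rule emeasure_bounded_finite) simp
    then show ?thesis by (simp add: less_top)
  qed
  have int: "integrable lborel (\<lambda>y. f y * indicator (cball x r) y)"
    by (rule Bochner_Integration.integrable_bound[OF ind[of C]])
       (auto simp: indicator_def f_nonneg intro!: AE_I2 order_trans[OF f_le])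
  have "emeasure D (cball x r) = (\<integral>\<^sup>+y. ennreal (f y * indicator (cball x r) y) \<partial>lborel)"
    by (subst emeasure_density) (auto simp: indicator_def intro!: nn_integral_cong)
  also have "\<dots> = ennreal (\<integral>y. f y * indicator (cball x r) y \<partial>lborel)"
    using int by (rule nn_integral_eq_integral) (simp add: f_nonneg)
  finally have m: "measure D (cball x r) = (\<integral>y. f y * indicator (cball x r) y \<partial>lborel)"
    by (simp add: measure_def integral_nonneg_AE f_nonneg)
  have "measure D (cball x r) - f x * ?v = (\<integral>y. (f y - f x) * indicator (cball x r) y \<partial>lborel)"
    using int ind[of "f x"] v by (simp add: m left_diff_distrib)
  also have "\<bar>\<dots>\<bar> \<le> (\<integral>y. \<bar>(f y - f x) * indicator (cball x r) y\<bar> \<partial>lborel)" by (rule integral_abs_bound)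
  also have "\<dots> \<le> (\<integral>y. \<epsilon> * indicator (cball x r) y \<partial>lborel)"
    using int ind[of "f x"] ind[of \<epsilon>] \<epsilon>
    by (intro integral_mono) (auto simp: left_diff_distrib indicator_def)
  also have "\<dots> = \<epsilon> * ?v" using v by simp
  finally show ?thesis .
qed

text \<open>By continuity at x, the mass of the ball is f x times its volume up to o(volume). The
  offset c separates two counts: the radius belongs to the sample size n + c, while n is the number
  of other points; c is 1 for a single centre and 2 for a pair.\<close>

lemma scaled_measure_cball_tendsto:
  "(\<lambda>n. real n * measure D (cball x (kl_radius CARD('m) (n + c) t))) \<longlonglongrightarrow> f x * exp t"
proof -
  let ?\<rho> = "\<lambda>n. kl_radius CARD('m) n t"
  let ?b = "\<lambda>n. measure D (cball x (kl_radius CARD('m) n t))"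
  let ?v = "\<lambda>n. unit_ball_vol (real CARD('m)) * kl_radius CARD('m) n t ^ CARD('m)"
  have "(\<lambda>n. real n * ?b n - f x * exp t) \<longlonglongrightarrow> 0"
  proof (rule LIMSEQ_I)
    fix e :: real assume e: "0 < e"
    define \<epsilon> where "\<epsilon> = e / (2 * exp t)"
    have \<epsilon>: "\<epsilon> > 0" "\<epsilon> * exp t < e" using e by (auto simp: \<epsilon>_def)
    have "isCont f x" using f_cont by (simp add: continuous_on_eq_continuous_at)
    then obtain d where d: "d > 0" "\<And>y. dist y x < d \<Longrightarrow> \<bar>f y - f x\<bar> < \<epsilon>"
      using \<epsilon>(1) unfolding continuous_at_eps_delta dist_real_def by blast
    have "\<forall>\<^sub>F n in sequentially. ?\<rho> n < d" using rad_tendsto_0 d(1) by (rule order_tendstoD(2))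
    then have "\<forall>\<^sub>F n in sequentially. norm (real n * ?b n - f x * exp t - 0) < e"
      using eventually_gt_at_top[of 0]
    proof eventually_elim
      case (elim n)
      have v: "real n * ?v n = exp t" using elim by (simp add: rad_power)
      have "\<bar>?b n - f x * ?v n\<bar> \<le> \<epsilon> * ?v n"
      proof (rule measure_cball_approx)
        show "0 \<le> ?\<rho> n" using rad_pos[of n t] elim by simp
        fix y assume "y \<in> cball x (?\<rho> n)"
        then show "\<bar>f y - f x\<bar> \<le> \<epsilon>" using d(2)[of y] elim by (simp add: dist_commute)
      qed
      then have "real n * \<bar>?b n - f x * ?v n\<bar> \<le> real n * (\<epsilon> * ?v n)"
        by (intro mult_left_mono) auto
      also have "\<dots> = \<epsilon> * exp t" using v by (metis mult.left_commute)
      also have "real n * \<bar>?b n - f x * ?v n\<bar> = \<bar>real n * (?b n - f x * ?v n)\<bar>"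
        by (simp add: abs_mult)
      also have "real n * (?b n - f x * ?v n) = real n * ?b n - f x * exp t"
        unfolding v[symmetric] by (simp add: right_diff_distrib mult_ac)
      finally show ?case using \<epsilon>(2) by simp
    qed
    then show "\<exists>no. \<forall>n\<ge>no. norm (real n * ?b n - f x * exp t - 0) < e"
      by (simp add: eventually_sequentially)
  qed
  then have L: "(\<lambda>n. real n * ?b n) \<longlonglongrightarrow> f x * exp t" by (rule LIM_zero_cancel)
  have L': "(\<lambda>n. real (n + c) * ?b (n + c)) \<longlonglongrightarrow> f x * exp t"
    using LIMSEQ_ignore_initial_segment[OF L, of c] by simp
  \<comment> \<open>The masses themselves tend to 0, so replacing the factor n + c by n changes the
    product by c times a null sequence.\<close>
  have "(\<lambda>n. ?b n) \<longlonglongrightarrow> 0" using L by (rule tendsto_null_if_scaled)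
  then have "(\<lambda>n. ?b (n + c)) \<longlonglongrightarrow> 0"
    by (rule LIMSEQ_ignore_initial_segment)
  then have "(\<lambda>n. real (n + c) * ?b (n + c) - real c * ?b (n + c)) \<longlonglongrightarrow> f x * exp t - real c * 0"
    by (intro tendsto_intros L')
  then show ?thesis by (simp add: left_diff_distrib[symmetric])
qed

lemma measurable_measure_cball[measurable]: "(\<lambda>x. measure D (cball x r)) \<in> borel_measurable borel"
proof -
  have "{z \<in> space (borel \<Otimes>\<^sub>M D). dist (fst z) (snd z) \<le> r} \<in> sets (borel \<Otimes>\<^sub>M D)"
    by measurable
  then have A: "(\<lambda>x. emeasure D (Pair x -` {z \<in> space (borel \<Otimes>\<^sub>M D). dist (fst z) (snd z) \<le> r})) \<in> borel_measurable borel"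
    by (rule D.measurable_emeasure_Pair)
  have B: "Pair x -` {z \<in> space (borel \<Otimes>\<^sub>M D). dist (fst z) (snd z) \<le> r} = cball x r" for x
    by (auto simp: space_pair_measure)
  have "(\<lambda>x. emeasure D (cball x r)) \<in> borel_measurable borel" using A unfolding B .
  then show ?thesis unfolding measure_def by measurable
qed

section \<open>Points with few neighbours\<close>

lemma trinomial_below_bounds:
  "0 \<le> trinomial_below n k 1 (measure D (cball x r)) 0" "trinomial_below n k 1 (measure D (cball x r)) 0 \<le> 1"
proof -
  have "trinomial_below (card {..<n}) k 1 (D.prob (cball x r)) (D.prob {}) =
    measure (PiM {..<n} (\<lambda>_. D)) {\<omega> \<in> space (PiM {..<n} (\<lambda>_. D)). card {j\<in>{..<n}. \<omega> j \<in> cball x r} < k \<and> card {j\<in>{..<n}. \<omega> j \<in> {}} < 1}"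
    by (rule D.PiM_trinomial[symmetric]) auto
  then show "0 \<le> trinomial_below n k 1 (measure D (cball x r)) 0" "trinomial_below n k 1 (measure D (cball x r)) 0 \<le> 1"
    using prob_space.prob_le_1[OF prob_space_PiM[of "{..<n}" "\<lambda>_. D"]] D.prob_space_axioms by auto
qed

text \<open>Given the location x of point i, each remaining point hits the ball around x
  independently. The second set of the trinomial formula is empty with bound 1, a vacuous condition,
  so the formula becomes binomial.\<close>

lemma PiM_few_neighbours:
  assumes I: "finite I" "i \<notin> I"
  shows "emeasure (PiM (insert i I) (\<lambda>_. D)) {w \<in> space (PiM (insert i I) (\<lambda>_. D)). card {j\<in>I. dist (w i) (w j) \<le> r} < k}
     = (\<integral>\<^sup>+x. trinomial_below (card I) k 1 (measure D (cball x r)) 0 \<partial>D)"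
proof -
  interpret PP: finite_product_prob_space "\<lambda>_. D" I by unfold_locales (use I in auto)
  have "Measurable.pred (PiM (insert i I) (\<lambda>_. D)) (\<lambda>w. card {j\<in>I. dist (w i) (w j) \<le> r} < k)"
    using I(1) by measurable
  from PD.emeasure_PiM_insert[OF I this]
  have "emeasure (PiM (insert i I) (\<lambda>_. D)) {w \<in> space (PiM (insert i I) (\<lambda>_. D)). card {j\<in>I. dist (w i) (w j) \<le> r} < k}
    = (\<integral>\<^sup>+x. emeasure (PiM I (\<lambda>_. D)) {w \<in> space (PiM I (\<lambda>_. D)). card {j\<in>I. dist ((w(i := x)) i) ((w(i := x)) j) \<le> r} < k} \<partial>D)" .
  also have "\<dots> = (\<integral>\<^sup>+x. trinomial_below (card I) k 1 (measure D (cball x r)) 0 \<partial>D)"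
  proof (rule nn_integral_cong)
    fix x
    have "{w \<in> space (PiM I (\<lambda>_. D)). card {j\<in>I. dist ((w(i := x)) i) ((w(i := x)) j) \<le> r} < k}
      = {w \<in> space (PiM I (\<lambda>_. D)). card {j\<in>I. w j \<in> cball x r} < k \<and> card {j\<in>I. w j \<in> {}} < 1}"
      using I(2) by (auto intro!: arg_cong[where f = card] simp: elim!: back_subst[of "\<lambda>c. c < k"])
    then show "emeasure (PiM I (\<lambda>_. D)) {w \<in> space (PiM I (\<lambda>_. D)). card {j\<in>I. dist ((w(i := x)) i) ((w(i := x)) j) \<le> r} < k}
      = trinomial_below (card I) k 1 (measure D (cball x r)) 0"
      using D.PiM_trinomial[OF I(1), of "cball x r" "{}" k 1] by (simp add: PD.P.emeasure_eq_measure)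
  qed
  finally show ?thesis .
qed

text \<open>A majorant for the conditional probability that points at x and y both have few
  neighbours. For disjoint balls it is the trinomial probability; the value 1 for close pairs is
  harmless because such pairs lose all weight as the radius shrinks.\<close>

definition pair_bound :: "nat \<Rightarrow> nat \<Rightarrow> real \<Rightarrow> real ^ 'm \<Rightarrow> real ^ 'm \<Rightarrow> real" where
  "pair_bound n k r x y = (if 2 * r < dist x y then trinomial_below n k k (measure D (cball x r)) (measure D (cball y r)) else 1)"

lemma pair_bound_eq:
  assumes "2 * r < dist x y" "finite I"
  shows "pair_bound (card I) k r x y = measure (PiM I (\<lambda>_. D))
    {w \<in> space (PiM I (\<lambda>_. D)). card {j\<in>I. w j \<in> cball x r} < k \<and> card {j\<in>I. w j \<in> cball y r} < k}"
proof -
  have "cball x r \<inter> cball y r = {}"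
  proof (rule ccontr)
    assume "cball x r \<inter> cball y r \<noteq> {}"
    then obtain z where "dist x z \<le> r" "dist y z \<le> r" by auto
    then show False using assms(1) dist_triangle2[of x y z] by simp
  qed
  then show ?thesis using D.PiM_trinomial[OF assms(2), of "cball x r" "cball y r" k k] assms(1)
    by (simp add: pair_bound_def)
qed

lemma pair_bound_bounds: "0 \<le> pair_bound n k r x y" "pair_bound n k r x y \<le> 1"
proof -
  interpret PP: finite_product_prob_space "\<lambda>_. D" "{..<n}" by unfold_locales auto
  have "0 \<le> pair_bound n k r x y \<and> pair_bound n k r x y \<le> 1"
  proof (cases "2 * r < dist x y")
    case True
    then show ?thesis using pair_bound_eq[OF True, of "{..<n}" k] by simp
  qed (simp add: pair_bound_def)
  then show "0 \<le> pair_bound n k r x y" "pair_bound n k r x y \<le> 1" by auto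
qed

lemma measurable_pair_bound[measurable (raw)]:
  assumes "g \<in> borel_measurable M" "h \<in> borel_measurable M"
  shows "(\<lambda>x. pair_bound n k r (g x) (h x)) \<in> borel_measurable M"
  unfolding pair_bound_def using assms
    measurable_compose[OF assms(1) measurable_measure_cball[of r]] measurable_compose[OF assms(2) measurable_measure_cball[of r]]
  by measurable

text \<open>Conditions on the two locations in turn. Leaving each of the two points out of the
  other's count can only enlarge the event, which is the direction that the variance bound
  uses.\<close>

lemma PiM_few_neighbours_pair:
  assumes I: "finite I" "i \<notin> I" "j \<notin> I" "i \<noteq> j"
  shows "emeasure (PiM (insert i (insert j I)) (\<lambda>_. D)) {w \<in> space (PiM (insert i (insert j I)) (\<lambda>_. D)).
      card {l\<in>insert j I. dist (w i) (w l) \<le> r} < k \<and> card {l\<in>insert i I. dist (w j) (w l) \<le> r} < k}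
     \<le> (\<integral>\<^sup>+x. \<integral>\<^sup>+y. pair_bound (card I) k r x y \<partial>D \<partial>D)"
proof -
  interpret PP: finite_product_prob_space "\<lambda>_. D" I by unfold_locales (use I in auto)
  let ?Q = "\<lambda>w. card {l\<in>insert j I. dist (w i) (w l) \<le> r} < k \<and> card {l\<in>insert i I. dist (w j) (w l) \<le> r} < k"
  have fin: "finite (insert j I)" "finite (insert i I)" using I by auto
  have Q: "Measurable.pred (PiM (insert i (insert j I)) (\<lambda>_. D)) ?Q"
    using fin by (intro pred_intros_logic measurable_card_less) (auto simp: pred_def)
  have "emeasure (PiM (insert i (insert j I)) (\<lambda>_. D)) {w \<in> space (PiM (insert i (insert j I)) (\<lambda>_. D)). ?Q w}
    = (\<integral>\<^sup>+x. emeasure (PiM (insert j I) (\<lambda>_. D)) {w \<in> space (PiM (insert j I) (\<lambda>_. D)). ?Q (w(i := x))} \<partial>D)"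
    using I by (intro PD.emeasure_PiM_insert Q) auto
  also have "\<dots> \<le> (\<integral>\<^sup>+x. \<integral>\<^sup>+y. pair_bound (card I) k r x y \<partial>D \<partial>D)"
  proof (rule nn_integral_mono)
    fix x assume x: "x \<in> space D"
    have m: "(\<lambda>w. w(i := x)) \<in> measurable (PiM (insert j I) (\<lambda>_. D)) (PiM (insert i (insert j I)) (\<lambda>_. D))"
      using x by (intro measurable_fun_upd[where J = "insert j I"]) auto
    have "emeasure (PiM (insert j I) (\<lambda>_. D)) {w \<in> space (PiM (insert j I) (\<lambda>_. D)). ?Q (w(i := x))}
      = (\<integral>\<^sup>+y. emeasure (PiM I (\<lambda>_. D)) {w \<in> space (PiM I (\<lambda>_. D)). ?Q (w(j := y, i := x))} \<partial>D)"
      using I by (intro PD.emeasure_PiM_insert measurable_compose[OF m Q]) auto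
    also have "\<dots> \<le> (\<integral>\<^sup>+y. pair_bound (card I) k r x y \<partial>D)"
    proof (rule nn_integral_mono)
      fix y
      show "emeasure (PiM I (\<lambda>_. D)) {w \<in> space (PiM I (\<lambda>_. D)). ?Q (w(j := y, i := x))} \<le> ennreal (pair_bound (card I) k r x y)"
      proof (cases "2 * r < dist x y")
        case True
        have "{w \<in> space (PiM I (\<lambda>_. D)). ?Q (w(j := y, i := x))} \<subseteq>
          {w \<in> space (PiM I (\<lambda>_. D)). card {l\<in>I. w l \<in> cball x r} < k \<and> card {l\<in>I. w l \<in> cball y r} < k}"
        proof safe
          fix w
          let ?w = "w(j := y, i := x)"
          assume 1: "card {l\<in>insert j I. dist (?w i) (?w l) \<le> r} < k" and 2: "card {l\<in>insert i I. dist (?w j) (?w l) \<le> r} < k"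
          have "card {l\<in>I. w l \<in> cball x r} \<le> card {l\<in>insert j I. dist (?w i) (?w l) \<le> r}"
            using I by (intro card_mono) auto
          with 1 show "card {l\<in>I. w l \<in> cball x r} < k" by simp
          have "card {l\<in>I. w l \<in> cball y r} \<le> card {l\<in>insert i I. dist (?w j) (?w l) \<le> r}"
            using I by (intro card_mono) auto
          with 2 show "card {l\<in>I. w l \<in> cball y r} < k" by simp
        qed
        then have "emeasure (PiM I (\<lambda>_. D)) {w \<in> space (PiM I (\<lambda>_. D)). ?Q (w(j := y, i := x))} \<le>
          emeasure (PiM I (\<lambda>_. D)) {w \<in> space (PiM I (\<lambda>_. D)). card {l\<in>I. w l \<in> cball x r} < k \<and> card {l\<in>I. w l \<in> cball y r} < k}"
        proof (rule emeasure_mono)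
          show "{w \<in> space (PiM I (\<lambda>_. D)). card {l\<in>I. w l \<in> cball x r} < k \<and> card {l\<in>I. w l \<in> cball y r} < k} \<in> sets (PiM I (\<lambda>_. D))"
          proof -
            have "Measurable.pred (PiM I (\<lambda>_. D)) (\<lambda>w. w l \<in> cball z r)" if "l \<in> I" for l z
              unfolding mem_cball using that by measurable
            then have "Measurable.pred (PiM I (\<lambda>_. D)) (\<lambda>w. card {l\<in>I. w l \<in> cball x r} < k \<and> card {l\<in>I. w l \<in> cball y r} < k)"
              by (intro pred_intros_logic measurable_card_less I(1))
            then show ?thesis by simp
          qed
        qed
        then show ?thesis using pair_bound_eq[OF True I(1), of k] by (simp add: PD.P.emeasure_eq_measure)
      next
        case False
        then show ?thesis using PD.P.emeasure_le_1 by (simp add: pair_bound_def)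
      qed
    qed
    finally show "emeasure (PiM (insert j I) (\<lambda>_. D)) {w \<in> space (PiM (insert j I) (\<lambda>_. D)). ?Q (w(i := x))} \<le> (\<integral>\<^sup>+y. pair_bound (card I) k r x y \<partial>D)" .
  qed
  finally show ?thesis .
qed

section \<open>Poisson limits of the one-point and two-point probabilities\<close>

definition lim_survival :: "nat \<Rightarrow> real \<Rightarrow> real" where
  "lim_survival k t = (\<integral>x. poisson_below k (f x * exp t) \<partial>D)"

lemma one_point_tendsto:
  "(\<lambda>n. \<integral>x. trinomial_below n k 1 (measure D (cball x (kl_radius CARD('m) (n + c) t))) 0 \<partial>D) \<longlonglongrightarrow> lim_survival k t"
  unfolding lim_survival_def
proof (rule integral_dominated_convergence[where w = "\<lambda>_. 1"])
  show "AE x in D. (\<lambda>n. trinomial_below n k 1 (measure D (cball x (kl_radius CARD('m) (n + c) t))) 0) \<longlonglongrightarrow> poisson_below k (f x * exp t)"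
  proof (rule AE_I2)
    fix x
    \<comment> \<open>The second factor of the limit is the probability that a Poisson variable of
      mean 0 is below 1, which is 1.\<close>
    have "(\<lambda>n. trinomial_below n k 1 (measure D (cball x (kl_radius CARD('m) (n + c) t))) 0) \<longlonglongrightarrow> poisson_below k (f x * exp t) * poisson_below 1 0"
      by (intro trinomial_below_tendsto scaled_measure_cball_tendsto) simp
    then show "(\<lambda>n. trinomial_below n k 1 (measure D (cball x (kl_radius CARD('m) (n + c) t))) 0) \<longlonglongrightarrow> poisson_below k (f x * exp t)"
      by (simp add: poisson_below_def)
  qed
qed (use trinomial_below_bounds in auto)

text \<open>For fixed y \<noteq> x the radius eventually drops below half the distance, so the
  default value 1 of \<open>pair_bound\<close> disappears in the limit; the excluded point is null
  under D. Both integrals converge by domination with the constant 1.\<close>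

lemma two_point_tendsto:
  "(\<lambda>n. \<integral>x. \<integral>y. pair_bound n k (kl_radius CARD('m) (n + c) t) x y \<partial>D \<partial>D) \<longlonglongrightarrow> (lim_survival k t)\<^sup>2"
proof -
  let ?\<rho> = "\<lambda>n. kl_radius CARD('m) (n + c) t"
  let ?g = "\<lambda>x. poisson_below k (f x * exp t)"
  have inner: "(\<lambda>n. \<integral>y. pair_bound n k (?\<rho> n) x y \<partial>D) \<longlonglongrightarrow> (\<integral>y. ?g x * ?g y \<partial>D)" for x
  proof (rule integral_dominated_convergence[where w = "\<lambda>_. 1"])
    have "AE y in lborel. y \<noteq> x" by (rule AE_lborel_singleton)
    then have "AE y in D. y \<noteq> x" by (subst AE_density) auto
    then show "AE y in D. (\<lambda>n. pair_bound n k (?\<rho> n) x y) \<longlonglongrightarrow> ?g x * ?g y"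
    proof eventually_elim
      case (elim y)
      have "(\<lambda>n. trinomial_below n k k (measure D (cball x (?\<rho> n))) (measure D (cball y (?\<rho> n)))) \<longlonglongrightarrow> ?g x * ?g y"
        by (intro trinomial_below_tendsto scaled_measure_cball_tendsto)
      moreover have "\<forall>\<^sub>F n in sequentially. ?\<rho> n < dist x y / 2"
        using LIMSEQ_ignore_initial_segment[OF rad_tendsto_0, of c t] elim by (intro order_tendstoD(2)) auto
      then have "\<forall>\<^sub>F n in sequentially. trinomial_below n k k (measure D (cball x (?\<rho> n))) (measure D (cball y (?\<rho> n))) = pair_bound n k (?\<rho> n) x y"
        by eventually_elim (simp add: pair_bound_def)
      ultimately show ?case by (rule Lim_transform_eventually)
    qed
  qed (use pair_bound_bounds in auto)
  have "(\<lambda>n. \<integral>x. (\<integral>y. pair_bound n k (?\<rho> n) x y \<partial>D) \<partial>D) \<longlonglongrightarrow> (\<integral>x. (\<integral>y. ?g x * ?g y \<partial>D) \<partial>D)"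
  proof (rule integral_dominated_convergence[where w = "\<lambda>_. 1"])
    show "AE x in D. (\<lambda>n. \<integral>y. pair_bound n k (?\<rho> n) x y \<partial>D) \<longlonglongrightarrow> (\<integral>y. ?g x * ?g y \<partial>D)" by (intro AE_I2 inner)
    fix n
    show "AE x in D. norm (\<integral>y. pair_bound n k (?\<rho> n) x y \<partial>D) \<le> 1"
    proof (rule AE_I2)
      fix x
      have "0 \<le> (\<integral>y. pair_bound n k (?\<rho> n) x y \<partial>D)" by (intro integral_nonneg_AE AE_I2 pair_bound_bounds)
      moreover have "(\<integral>y. pair_bound n k (?\<rho> n) x y \<partial>D) \<le> 1"
        using pair_bound_bounds by (intro D.integral_le_const D.integrable_const_bound[where B = 1]) auto
      ultimately show "norm (\<integral>y. pair_bound n k (?\<rho> n) x y \<partial>D) \<le> 1" by simp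
    qed
  qed auto
  then show ?thesis by (simp add: lim_survival_def power2_eq_square)
qed

end

section \<open>The empirical survival function\<close>

lemma (in prob_space) expectation_indicator:
  assumes "A \<in> events" shows "expectation (indicator A) = prob A"
  using assms by simp

locale density_sample = bounded_density f C + prob_space M
  for f :: "real ^ 'm::finite \<Rightarrow> real" and C :: real and M :: "'a measure" +
  fixes Xs :: "nat \<Rightarrow> 'a \<Rightarrow> real ^ 'm" and \<delta> :: real
  assumes indep: "indep_vars (\<lambda>_. borel) Xs {1..}"
    and distr: "1 \<le> i \<Longrightarrow> distributed M lborel (Xs i) f"
    and \<delta>: "0 < \<delta>"
    and moment: "integrable M (\<lambda>\<omega>. norm (Xs 1 \<omega>) powr (real CARD('m) + \<delta>))"
begin

lemma measurable_sample: "1 \<le> i \<Longrightarrow> Xs i \<in> borel_measurable M"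
  using distributed_measurable[OF distr] by simp

lemma distr_sample: "1 \<le> i \<Longrightarrow> distr M borel (Xs i) = D"
  using distributed_distr_eq_density[OF distr[of i]] by (metis distr_cong sets_lborel)

lemma distr_PiM_sample:
  assumes "finite J" "J \<noteq> {}" "J \<subseteq> {1..}"
  shows "distr M (PiM J (\<lambda>_. borel)) (\<lambda>\<omega>. \<lambda>j\<in>J. Xs j \<omega>) = PiM J (\<lambda>_. D)"
proof -
  have "distr M (PiM J (\<lambda>_. borel)) (\<lambda>\<omega>. \<lambda>j\<in>J. Xs j \<omega>) = PiM J (\<lambda>j. distr M borel (Xs j))"
    using assms indep_vars_subset[OF indep assms(3)] measurable_sample
    by (subst indep_vars_iff_distr_eq_PiM'[symmetric]) auto
  also have "\<dots> = PiM J (\<lambda>_. D)" using assms distr_sample by (intro PiM_cong) auto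
  finally show ?thesis .
qed

lemma emeasure_sample:
  assumes J: "finite J" "J \<noteq> {}" "J \<subseteq> {1..}" and \<phi>: "Measurable.pred (PiM J (\<lambda>_. borel)) \<phi>"
  shows "emeasure M {\<omega> \<in> space M. \<phi> (\<lambda>j\<in>J. Xs j \<omega>)} = emeasure (PiM J (\<lambda>_. D)) {w \<in> space (PiM J (\<lambda>_. D)). \<phi> w}"
proof -
  have X: "(\<lambda>\<omega>. \<lambda>j\<in>J. Xs j \<omega>) \<in> measurable M (PiM J (\<lambda>_. borel))"
    using J measurable_sample by (intro measurable_restrict) auto
  have sp: "space (PiM J (\<lambda>_. D)) = space (PiM J (\<lambda>_. borel :: (real ^ 'm) measure))" by (simp add: space_PiM)
  have "{w \<in> space (PiM J (\<lambda>_. borel)). \<phi> w} \<in> sets (PiM J (\<lambda>_. borel :: (real ^ 'm) measure))" using \<phi> by simp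
  then have "emeasure (PiM J (\<lambda>_. D)) {w \<in> space (PiM J (\<lambda>_. D)). \<phi> w} = emeasure M ((\<lambda>\<omega>. \<lambda>j\<in>J. Xs j \<omega>) -` {w \<in> space (PiM J (\<lambda>_. borel)). \<phi> w} \<inter> space M)"
    unfolding distr_PiM_sample[OF J, symmetric] sp[unfolded distr_PiM_sample[OF J, symmetric]] using X by (subst emeasure_distr) auto
  also have "(\<lambda>\<omega>. \<lambda>j\<in>J. Xs j \<omega>) -` {w \<in> space (PiM J (\<lambda>_. borel)). \<phi> w} \<inter> space M = {\<omega> \<in> space M. \<phi> (\<lambda>j\<in>J. Xs j \<omega>)}"
    using measurable_space[OF X] by auto
  finally show ?thesis by simp
qed

text \<open>Defined by a count rather than through the logarithm of a distance: at coinciding points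
  \<open>ln 0 = 0\<close> would give the logarithm a finite value, whereas the count reports a close
  neighbour at every t.\<close>

definition isolated :: "nat \<Rightarrow> nat \<Rightarrow> real \<Rightarrow> nat \<Rightarrow> 'a \<Rightarrow> bool" where
  "isolated k N t i \<omega> \<longleftrightarrow> card {j \<in> {1..N} - {i}. dist (Xs i \<omega>) (Xs j \<omega>) \<le> kl_radius CARD('m) N t} < k"

definition survival :: "nat \<Rightarrow> nat \<Rightarrow> real \<Rightarrow> 'a \<Rightarrow> real" where
  "survival k N t \<omega> = (\<Sum>i=1..N. of_bool (isolated k N t i \<omega>)) / real N"

definition prob_isolated :: "nat \<Rightarrow> nat \<Rightarrow> real \<Rightarrow> real" where
  "prob_isolated k N t = (\<integral>x. trinomial_below (N - 1) k 1 (measure D (cball x (kl_radius CARD('m) N t))) 0 \<partial>D)"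

definition prob_isolated_pair :: "nat \<Rightarrow> nat \<Rightarrow> real \<Rightarrow> real" where
  "prob_isolated_pair k N t = (\<integral>x. \<integral>y. pair_bound (N - 2) k (kl_radius CARD('m) N t) x y \<partial>D \<partial>D)"

lemma pred_isolated[measurable]:
  assumes "i \<in> {1..N}" shows "Measurable.pred M (isolated k N t i)"
  unfolding isolated_def using assms measurable_sample
  by (intro measurable_card_less borel_measurable_le borel_measurable_dist pred_intros_logic) (auto intro!: measurable_sample)

lemma prob_isolated_eq:
  assumes i: "i \<in> {1..N}"
  shows "prob {\<omega> \<in> space M. isolated k N t i \<omega>} = prob_isolated k N t"
proof -
  let ?r = "kl_radius CARD('m) N t"
  define I where "I = {1..N} - {i}"
  have I: "finite I" "i \<notin> I" "insert i I = {1..N}" "card I = N - 1" using i by (auto simp: I_def)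
  define J where "J = insert i I"
  have J: "finite J" "J \<noteq> {}" "J \<subseteq> {1..}" using I i by (auto simp: J_def)
  let ?Q = "\<lambda>w :: nat \<Rightarrow> real ^ 'm. card {j\<in>I. dist (w i) (w j) \<le> ?r} < k"
  have Q: "Measurable.pred (PiM J (\<lambda>_. borel :: (real ^ 'm) measure)) ?Q"
    using I(1) unfolding J_def by measurable
  have "{\<omega> \<in> space M. isolated k N t i \<omega>} = {\<omega> \<in> space M. ?Q (\<lambda>l\<in>J. Xs l \<omega>)}"
    unfolding isolated_def I_def[symmetric]
    by (intro Collect_cong conj_cong refl arg_cong[where f = "\<lambda>A. card A < k"]) (auto simp: J_def)
  then have "emeasure M {\<omega> \<in> space M. isolated k N t i \<omega>} = emeasure (PiM J (\<lambda>_. D)) {w \<in> space (PiM J (\<lambda>_. D)). ?Q w}"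
    using emeasure_sample[OF J Q] by simp
  also have "\<dots> = (\<integral>\<^sup>+x. trinomial_below (N - 1) k 1 (measure D (cball x ?r)) 0 \<partial>D)"
    using PiM_few_neighbours[OF I(1,2), of ?r k] unfolding J_def I(4) .
  also have "\<dots> = ennreal (prob_isolated k N t)"
    unfolding prob_isolated_def using trinomial_below_bounds
    by (intro nn_integral_eq_integral D.integrable_const_bound[where B = 1]) auto
  finally have "emeasure M {\<omega> \<in> space M. isolated k N t i \<omega>} = ennreal (prob_isolated k N t)" .
  moreover have "0 \<le> prob_isolated k N t" unfolding prob_isolated_def by (intro integral_nonneg_AE AE_I2 trinomial_below_bounds)
  ultimately show ?thesis by (simp add: measure_def)
qed

lemma prob_isolated_pair_le:
  assumes i: "i \<in> {1..N}" and j: "j \<in> {1..N}" and ij: "i \<noteq> j"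
  shows "prob {\<omega> \<in> space M. isolated k N t i \<omega> \<and> isolated k N t j \<omega>} \<le> prob_isolated_pair k N t"
proof -
  let ?r = "kl_radius CARD('m) N t"
  define I where "I = {1..N} - {i, j}"
  define J where "J = insert i (insert j I)"
  have I: "finite I" "i \<notin> I" "j \<notin> I" "J = {1..N}" "card I = N - 2" "insert j I = {1..N} - {i}" "insert i I = {1..N} - {j}"
    using i j ij by (auto simp: I_def J_def card_Diff_subset)
  have J: "finite J" "J \<noteq> {}" "J \<subseteq> {1..}" using I i by auto
  let ?Q = "\<lambda>w :: nat \<Rightarrow> real ^ 'm. card {l\<in>insert j I. dist (w i) (w l) \<le> ?r} < k \<and> card {l\<in>insert i I. dist (w j) (w l) \<le> ?r} < k"
  have fin: "finite (insert j I)" "finite (insert i I)" using I by auto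
  have Q: "Measurable.pred (PiM J (\<lambda>_. borel :: (real ^ 'm) measure)) ?Q"
    using fin unfolding J_def by (intro pred_intros_logic measurable_card_less) (auto simp: pred_def)
  have "{\<omega> \<in> space M. isolated k N t i \<omega> \<and> isolated k N t j \<omega>} = {\<omega> \<in> space M. ?Q (\<lambda>l\<in>J. Xs l \<omega>)}"
    unfolding isolated_def I(6,7)[symmetric]
    by (intro Collect_cong conj_cong refl arg_cong[where f = "\<lambda>A. card A < k"]) (auto simp: J_def)
  then have "emeasure M {\<omega> \<in> space M. isolated k N t i \<omega> \<and> isolated k N t j \<omega>} = emeasure (PiM J (\<lambda>_. D)) {w \<in> space (PiM J (\<lambda>_. D)). ?Q w}"
    using emeasure_sample[OF J Q] by simp
  also have "\<dots> \<le> (\<integral>\<^sup>+x. \<integral>\<^sup>+y. pair_bound (N - 2) k ?r x y \<partial>D \<partial>D)"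
    using PiM_few_neighbours_pair[OF I(1,2,3) ij, of ?r k] unfolding J_def I(5) .
  also have "(\<integral>\<^sup>+x. \<integral>\<^sup>+y. pair_bound (N - 2) k ?r x y \<partial>D \<partial>D) = (\<integral>\<^sup>+x. ennreal (\<integral>y. pair_bound (N - 2) k ?r x y \<partial>D) \<partial>D)"
    using pair_bound_bounds by (intro nn_integral_cong nn_integral_eq_integral D.integrable_const_bound[where B = 1]) auto
  also have "\<dots> = ennreal (prob_isolated_pair k N t)"
    unfolding prob_isolated_pair_def
  proof (intro nn_integral_eq_integral D.integrable_const_bound[where B = 1] AE_I2)
    fix x
    show 0: "0 \<le> (\<integral>y. pair_bound (N - 2) k ?r x y \<partial>D)" by (intro integral_nonneg_AE AE_I2 pair_bound_bounds)
    have "(\<integral>y. pair_bound (N - 2) k ?r x y \<partial>D) \<le> 1"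
      using pair_bound_bounds by (intro D.integral_le_const D.integrable_const_bound[where B = 1]) auto
    with 0 show "norm (\<integral>y. pair_bound (N - 2) k ?r x y \<partial>D) \<le> 1" by simp
  qed simp
  finally have "emeasure M {\<omega> \<in> space M. isolated k N t i \<omega> \<and> isolated k N t j \<omega>} \<le> ennreal (prob_isolated_pair k N t)" .
  moreover have "0 \<le> prob_isolated_pair k N t" unfolding prob_isolated_pair_def by (intro integral_nonneg_AE AE_I2 pair_bound_bounds)
  ultimately show ?thesis by (simp add: emeasure_eq_measure)
qed

lemma prob_isolated_tendsto: "(\<lambda>N. prob_isolated k N t) \<longlonglongrightarrow> lim_survival k t"
proof -
  have "(\<lambda>n. prob_isolated k (n + 1) t) \<longlonglongrightarrow> lim_survival k t"
    using one_point_tendsto[of k 1 t] by (simp add: prob_isolated_def)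
  then show ?thesis by (rule LIMSEQ_offset)
qed

lemma prob_isolated_pair_tendsto: "(\<lambda>N. prob_isolated_pair k N t) \<longlonglongrightarrow> (lim_survival k t)\<^sup>2"
proof -
  have "(\<lambda>n. prob_isolated_pair k (n + 2) t) \<longlonglongrightarrow> (lim_survival k t)\<^sup>2"
    using two_point_tendsto[of k 2 t] by (simp add: prob_isolated_pair_def)
  then show ?thesis by (rule LIMSEQ_offset)
qed

lemma integrable_isolated:
  assumes "i \<in> {1..N}" shows "integrable M (\<lambda>\<omega>. of_bool (isolated k N t i \<omega>) :: real)"
  using pred_isolated[OF assms] by (intro integrable_const_bound[where B = 1]) auto

lemma expectation_isolated:
  assumes "i \<in> {1..N}" shows "expectation (\<lambda>\<omega>. of_bool (isolated k N t i \<omega>)) = prob_isolated k N t"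
proof -
  have "expectation (\<lambda>\<omega>. of_bool (isolated k N t i \<omega>)) = expectation (indicator {\<omega> \<in> space M. isolated k N t i \<omega>})"
    by (intro Bochner_Integration.integral_cong) (auto simp: indicator_def)
  also have "\<dots> = prob_isolated k N t" using pred_isolated[OF assms]
    by (subst expectation_indicator) (simp_all add: prob_isolated_eq[OF assms])
  finally show ?thesis .
qed

lemma survival_bounds: "0 \<le> survival k N t \<omega>" "survival k N t \<omega> \<le> 1"
proof -
  show "0 \<le> survival k N t \<omega>" unfolding survival_def by (intro divide_nonneg_nonneg sum_nonneg) auto
  have "(\<Sum>i=1..N. of_bool (isolated k N t i \<omega>) :: real) \<le> (\<Sum>i=1..N. 1)" by (intro sum_mono) auto
  then show "survival k N t \<omega> \<le> 1" unfolding survival_def by (cases "N = 0") auto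
qed

lemma integrable_survival: "integrable M (survival k N t)"
  unfolding survival_def[abs_def]
  by (intro integrable_mean_intros integrable_isolated)

lemma expectation_survival:
  assumes "1 \<le> N" shows "expectation (survival k N t) = prob_isolated k N t"
proof -
  have "expectation (survival k N t) = (\<Sum>i=1..N. expectation (\<lambda>\<omega>. of_bool (isolated k N t i \<omega>))) / real N"
    unfolding survival_def[abs_def] integral_divide_zero
    by (intro arg_cong2[where f = "(/)"] refl Bochner_Integration.integral_sum integrable_isolated)
  also have "\<dots> = prob_isolated k N t" using assms by (simp add: expectation_isolated)
  finally show ?thesis .
qed

text \<open>The N diagonal pairs contribute at most 1 each, which is 1 / N after division by N^2;
  all other pairs share one two-point bound.\<close>

lemma expectation_survival_square:
  assumes N: "1 \<le> N" shows "expectation (\<lambda>\<omega>. (survival k N t \<omega>)\<^sup>2) \<le> 1 / real N + prob_isolated_pair k N t"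
proof -
  let ?b = "\<lambda>i \<omega>. of_bool (isolated k N t i \<omega>) :: real"
  have meas: "Measurable.pred M (\<lambda>\<omega>. isolated k N t i \<omega> \<and> isolated k N t j \<omega>)" if "i \<in> {1..N}" "j \<in> {1..N}" for i j
    using pred_isolated[OF that(1)] pred_isolated[OF that(2)] by (rule pred_intros_logic)
  have bb: "?b i \<omega> * ?b j \<omega> = of_bool (isolated k N t i \<omega> \<and> isolated k N t j \<omega>)" for i j \<omega> by auto
  have int: "integrable M (\<lambda>\<omega>. ?b i \<omega> * ?b j \<omega>)" if "i \<in> {1..N}" "j \<in> {1..N}" for i j
    unfolding bb using meas[OF that] by (intro integrable_const_bound[where B = 1]) auto
  have E: "expectation (\<lambda>\<omega>. ?b i \<omega> * ?b j \<omega>) \<le> prob_isolated_pair k N t + (if i = j then 1 else 0)"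
    if ij: "i \<in> {1..N}" "j \<in> {1..N}" for i j
  proof -
    have "expectation (\<lambda>\<omega>. ?b i \<omega> * ?b j \<omega>) = expectation (indicator {\<omega> \<in> space M. isolated k N t i \<omega> \<and> isolated k N t j \<omega>})"
      by (intro Bochner_Integration.integral_cong) (auto simp: indicator_def)
    also have "\<dots> = prob {\<omega> \<in> space M. isolated k N t i \<omega> \<and> isolated k N t j \<omega>}"
      using meas[OF ij] by (intro expectation_indicator) simp
    also have "\<dots> \<le> prob_isolated_pair k N t + (if i = j then 1 else 0)"
    proof (cases "i = j")
      case True
      have "0 \<le> prob_isolated_pair k N t" unfolding prob_isolated_pair_def by (intro integral_nonneg_AE AE_I2 pair_bound_bounds)
      then show ?thesis using True prob_le_1 by (simp add: add_increasing)
    qed (use prob_isolated_pair_le[OF ij] in simp)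
    finally show ?thesis .
  qed
  have sq: "(survival k N t \<omega>)\<^sup>2 = (\<Sum>i=1..N. \<Sum>j=1..N. ?b i \<omega> * ?b j \<omega>) / (real N)\<^sup>2" for \<omega>
  proof -
    have "(\<Sum>i=1..N. ?b i \<omega>)\<^sup>2 = (\<Sum>i=1..N. \<Sum>j=1..N. ?b i \<omega> * ?b j \<omega>)"
      by (simp only: power2_eq_square sum_product)
    then show ?thesis by (simp only: survival_def power_divide)
  qed
  have "expectation (\<lambda>\<omega>. \<Sum>i=1..N. \<Sum>j=1..N. ?b i \<omega> * ?b j \<omega>) = (\<Sum>i=1..N. \<Sum>j=1..N. expectation (\<lambda>\<omega>. ?b i \<omega> * ?b j \<omega>))"
  proof -
    have "expectation (\<lambda>\<omega>. \<Sum>i=1..N. \<Sum>j=1..N. ?b i \<omega> * ?b j \<omega>) = (\<Sum>i=1..N. expectation (\<lambda>\<omega>. \<Sum>j=1..N. ?b i \<omega> * ?b j \<omega>))"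
      by (intro Bochner_Integration.integral_sum Bochner_Integration.integrable_sum int)
    also have "\<dots> = (\<Sum>i=1..N. \<Sum>j=1..N. expectation (\<lambda>\<omega>. ?b i \<omega> * ?b j \<omega>))"
      by (intro sum.cong refl Bochner_Integration.integral_sum int)
    finally show ?thesis .
  qed
  also have "\<dots> \<le> (\<Sum>i=1..N. \<Sum>j=1..N. prob_isolated_pair k N t + (if i = j then 1 else 0))"
    by (intro sum_mono E)
  also have "\<dots> = (real N)\<^sup>2 * prob_isolated_pair k N t + real N"
    by (simp add: sum.distrib power2_eq_square distrib_left)
  finally have "expectation (\<lambda>\<omega>. \<Sum>i=1..N. \<Sum>j=1..N. ?b i \<omega> * ?b j \<omega>) / (real N)\<^sup>2 \<le> ((real N)\<^sup>2 * prob_isolated_pair k N t + real N) / (real N)\<^sup>2"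
    by (rule divide_right_mono) simp
  also have "\<dots> = 1 / real N + prob_isolated_pair k N t" using N by (simp add: field_simps power2_eq_square)
  finally show ?thesis unfolding sq integral_divide_zero .
qed

lemma prob_isolated_bounds: "0 \<le> prob_isolated k N t" "prob_isolated k N t \<le> 1"
proof -
  let ?f = "\<lambda>x. trinomial_below (N - 1) k 1 (measure D (cball x (kl_radius CARD('m) N t))) 0"
  have "integrable D ?f"
    using trinomial_below_bounds by (intro D.integrable_const_bound[where B = 1]) auto
  then show "0 \<le> prob_isolated k N t" "prob_isolated k N t \<le> 1" unfolding prob_isolated_def
    by (intro integral_nonneg_AE D.integral_le_const AE_I2 trinomial_below_bounds; assumption)+
qed

text \<open>The mean square deviation expands into a second moment, a mean and g^2. The upper bound
  for it tends to g^2 - 2 g^2 + g^2 = 0, and nonnegativity supplies the matching lower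
  bound.\<close>

lemma survival_tendsto_L1:
  "(\<lambda>N. expectation (\<lambda>\<omega>. \<bar>survival k N t \<omega> - lim_survival k t\<bar>)) \<longlonglongrightarrow> 0"
proof (rule tendsto_sandwich[OF _ _ tendsto_const])
  let ?g = "lim_survival k t"
  let ?B = "\<lambda>N. sqrt (1 / real N + prob_isolated_pair k N t - 2 * ?g * prob_isolated k N t + ?g\<^sup>2)"
  show "\<forall>\<^sub>F N in sequentially. 0 \<le> expectation (\<lambda>\<omega>. \<bar>survival k N t \<omega> - ?g\<bar>)"
    by (intro always_eventually allI integral_nonneg_AE AE_I2) simp
  show "\<forall>\<^sub>F N in sequentially. expectation (\<lambda>\<omega>. \<bar>survival k N t \<omega> - ?g\<bar>) \<le> ?B N"
    using eventually_ge_at_top[of 1]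
  proof eventually_elim
    case (elim N)
    have [measurable]: "random_variable borel (survival k N t)" using integrable_survival by auto
    have i2: "integrable M (\<lambda>\<omega>. (survival k N t \<omega>)\<^sup>2)"
      using survival_bounds by (intro integrable_const_bound[where B = 1]) (auto intro!: AE_I2 power_le_one)
    have e: "(survival k N t \<omega> - ?g)\<^sup>2 = (survival k N t \<omega>)\<^sup>2 - 2 * ?g * survival k N t \<omega> + ?g\<^sup>2" for \<omega>
      by (simp add: power2_diff)
    have i3: "integrable M (\<lambda>\<omega>. (survival k N t \<omega> - ?g)\<^sup>2)"
      unfolding e using i2 integrable_survival by auto
    have "expectation (\<lambda>\<omega>. (survival k N t \<omega> - ?g)\<^sup>2) = expectation (\<lambda>\<omega>. (survival k N t \<omega>)\<^sup>2) - 2 * ?g * prob_isolated k N t + ?g\<^sup>2"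
      unfolding e using i2 integrable_survival[of k N t] by (simp add: expectation_survival[OF elim] prob_space)
    also have "\<dots> \<le> 1 / real N + prob_isolated_pair k N t - 2 * ?g * prob_isolated k N t + ?g\<^sup>2"
      using expectation_survival_square[OF elim, of k t] by simp
    finally have "sqrt (expectation (\<lambda>\<omega>. (survival k N t \<omega> - ?g)\<^sup>2)) \<le> ?B N" by (rule real_sqrt_le_mono)
    moreover have "expectation (\<lambda>\<omega>. \<bar>survival k N t \<omega> - ?g\<bar>) \<le> sqrt (expectation (\<lambda>\<omega>. (survival k N t \<omega> - ?g)\<^sup>2))"
      by (rule expectation_abs_le[OF _ i3]) simp
    ultimately show ?case by (rule order_trans[rotated])
  qed
  have "(\<lambda>N. 1 / real N + prob_isolated_pair k N t - 2 * ?g * prob_isolated k N t + ?g\<^sup>2) \<longlonglongrightarrow> 0 + ?g\<^sup>2 - 2 * ?g * ?g + ?g\<^sup>2"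
    by (intro tendsto_intros lim_1_over_n prob_isolated_tendsto prob_isolated_pair_tendsto)
  then have "?B \<longlonglongrightarrow> sqrt (0 + ?g\<^sup>2 - 2 * ?g * ?g + ?g\<^sup>2)" by (rule tendsto_real_sqrt)
  then show "?B \<longlonglongrightarrow> 0" by (simp add: power2_eq_square)
qed

end

section \<open>Tail bounds\<close>

context density_sample
begin

lemma measure_cball_kl_radius_le:
  assumes "1 \<le> N" shows "real N * measure D (cball x (kl_radius CARD('m) N t)) \<le> C * exp t"
proof -
  let ?r = "kl_radius CARD('m) N t"
  have r: "0 < ?r" and v: "unit_ball_vol (real CARD('m)) * ?r ^ CARD('m) = exp t / real N"
    using assms rad_pos rad_power by simp_all
  have "real N * measure D (cball x ?r) \<le> real N * (C * (exp t / real N))"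
    using measure_cball_le[of ?r x] r by (intro mult_left_mono) (simp_all add: v)
  then show ?thesis using assms by simp
qed

text \<open>Bernoulli's inequality bounds the probability that all other points avoid a small ball.\<close>

lemma prob_isolated_lower:
  assumes k: "1 \<le> k" and N: "1 \<le> N"
  shows "1 - prob_isolated k N t \<le> C * exp t"
proof -
  let ?p = "\<lambda>x. measure D (cball x (kl_radius CARD('m) N t))"
  have "1 - C * exp t \<le> trinomial_below (N - 1) k 1 (?p x) 0" for x
  proof -
    have p: "0 \<le> ?p x" "?p x \<le> 1" by simp_all
    have "1 - C * exp t \<le> 1 - real (N - 1) * ?p x"
    proof -
      have "real (N - 1) * ?p x \<le> real N * ?p x" by (intro mult_right_mono) auto
      then show ?thesis using measure_cball_kl_radius_le[OF N, of x t] by linarith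
    qed
    also have "\<dots> \<le> (1 - ?p x) ^ (N - 1)"
      using Bernoulli_inequality[of "- ?p x" "N - 1"] p by simp
    \<comment> \<open>The event of an empty ball is the term a = 0, which belongs to the sum over a
      < k because k \<ge> 1.\<close>
    also have "\<dots> = (\<Sum>a\<in>{0::nat}. real ((N - 1) choose a) * ?p x ^ a * (1 - ?p x) ^ (N - 1 - a))" by simp
    also have "\<dots> \<le> (\<Sum>a<k. real ((N - 1) choose a) * ?p x ^ a * (1 - ?p x) ^ (N - 1 - a))"
      using k p by (intro sum_mono2) auto
    also have "\<dots> = trinomial_below (N - 1) k 1 (?p x) 0" by (simp add: trinomial_below_def)
    finally show ?thesis .
  qed
  then have "(\<integral>x. 1 - C * exp t \<partial>D) \<le> prob_isolated k N t"
    unfolding prob_isolated_def using trinomial_below_bounds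
    by (intro integral_mono[OF D.integrable_const D.integrable_const_bound[where B = 1]]) auto
  moreover have "measure D UNIV = 1" using D.prob_space by simp
  ultimately show ?thesis by simp
qed

definition mom :: real where "mom = expectation (\<lambda>\<omega>. norm (Xs 1 \<omega>) powr (real CARD('m) + \<delta>))"

lemma prob_norm_large:
  assumes t: "0 \<le> t" and i: "1 \<le> i"
  shows "prob {\<omega> \<in> space M. exp (t / (2 * real CARD('m))) < norm (Xs i \<omega>)} \<le> mom * exp (- t / 2)"
proof -
  let ?R = "exp (t / (2 * real CARD('m)))"
  let ?q = "real CARD('m) + \<delta>"
  have [measurable]: "Xs i \<in> borel_measurable M" "Xs 1 \<in> borel_measurable M" using measurable_sample i by auto
  have same: "prob {\<omega> \<in> space M. ?R < norm (Xs i \<omega>)} = prob {\<omega> \<in> space M. ?R < norm (Xs 1 \<omega>)}"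
  proof -
    have "prob {\<omega> \<in> space M. ?R < norm (Xs j \<omega>)} = measure D {x. ?R < norm x}" if "1 \<le> j" for j
    proof -
      have [measurable]: "Xs j \<in> borel_measurable M" using measurable_sample that by auto
      have "{x :: real ^ 'm. ?R < norm x} \<in> sets borel" by measurable
      then show ?thesis unfolding distr_sample[OF that, symmetric]
        by (subst measure_distr) (auto intro!: arg_cong[where f = prob])
    qed
    then show ?thesis using i by simp
  qed
  have "prob {\<omega> \<in> space M. ?R < norm (Xs 1 \<omega>)} \<le> prob {\<omega> \<in> space M. exp (t / 2) \<le> norm (Xs 1 \<omega>) powr ?q}"
  proof (intro finite_measure_mono subsetI)
    fix \<omega> assume "\<omega> \<in> {\<omega> \<in> space M. ?R < norm (Xs 1 \<omega>)}"
    then have \<omega>: "\<omega> \<in> space M" "?R \<le> norm (Xs 1 \<omega>)" by auto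
    have "exp (t / 2) \<le> exp (t / (2 * real CARD('m)) * ?q)"
    proof -
      have "t / (2 * real CARD('m)) * real CARD('m) \<le> t / (2 * real CARD('m)) * ?q"
        using t \<delta> by (intro mult_left_mono) auto
      then show ?thesis by simp
    qed
    also have "\<dots> = ?R powr ?q" by (simp add: powr_def mult.commute)
    also have "\<dots> \<le> norm (Xs 1 \<omega>) powr ?q" using \<omega> \<delta> by (intro powr_mono2) auto
    finally show "\<omega> \<in> {\<omega> \<in> space M. exp (t / 2) \<le> norm (Xs 1 \<omega>) powr ?q}" using \<omega> by simp
  qed measurable
  also have "\<dots> \<le> mom / exp (t / 2)"
    unfolding mom_def using moment by (intro integral_Markov_inequality_measure[where A = "{}"]) auto
  also have "\<dots> = mom * exp (- t / 2)"
  proof -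
    have "exp (- t / 2) * exp (t / 2) = 1" by (simp add: mult_exp_exp)
    then show ?thesis by (subst nonzero_divide_eq_eq) (simp_all only: mult.assoc mult_1_right exp_not_eq_zero not_False_eq_True)
  qed
  finally show ?thesis unfolding same .
qed

lemma mom_nonneg: "0 \<le> mom" unfolding mom_def by (intro integral_nonneg_AE AE_I2) simp

text \<open>One constant for both regimes. The first summand comes from the grid count; the second
  pays for points of large norm, of which the small-radius regime charges one on average and the
  union bound k + 1.\<close>

definition tail_const :: "nat \<Rightarrow> real" where
  "tail_const k = real k * (6 * real CARD('m)) ^ CARD('m) * unit_ball_vol (real CARD('m)) + (real k + 1) * mom"

text \<open>The grid bounds the number of isolated points for every outcome, so the estimate is made
  for the empirical average and then integrated. As r^m = exp t / (N V), the count is N times a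
  multiple of exp (- t / 2), and averaging removes N.\<close>

lemma prob_isolated_upper_small_radius:
  assumes N: "1 \<le> N" and t: "0 \<le> t"
    and r: "kl_radius CARD('m) N t < 2 * exp (t / (2 * real CARD('m)))"
  shows "prob_isolated k N t \<le> tail_const k * exp (- t / 2)"
proof -
  let ?R = "exp (t / (2 * real CARD('m)))"
  let ?r = "kl_radius CARD('m) N t"
  let ?B = "\<lambda>i. {\<omega> \<in> space M. ?R < norm (Xs i \<omega>)}"
  let ?V = "unit_ball_vol (real CARD('m))"
  let ?K = "real k * (6 * real CARD('m)) ^ CARD('m) * ?V"
  have r0: "0 < ?r" and v: "?V * ?r ^ CARD('m) = exp t / real N" using N rad_pos rad_power by simp_all
  have meas: "?B i \<in> events" if "i \<in> {1..N}" for i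
  proof -
    have [measurable]: "Xs i \<in> borel_measurable M" using measurable_sample[of i] that by simp
    show ?thesis by measurable
  qed
  have bound: "survival k N t \<omega> \<le> ?K * exp (- t / 2) + (\<Sum>i=1..N. indicator (?B i) \<omega>) / real N"
    if \<omega>: "\<omega> \<in> space M" for \<omega>
  proof -
    let ?A = "{i \<in> {1..N}. norm (Xs i \<omega>) \<le> ?R \<and> card {j \<in> {1..N} - {i}. dist (Xs i \<omega>) (Xs j \<omega>) \<le> ?r} < k}"
    have "real (card ?A) \<le> real k * (6 * real CARD('m) * ?R / ?r) ^ CARD('m)"
      by (rule card_isolated_le) (use r r0 in auto)
    also have "\<dots> = real N * (?K * exp (- t / 2))"
    proof -
      have "?R ^ CARD('m) = exp (t / 2)" by (simp add: exp_of_nat_mult[symmetric])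
      then have "(6 * real CARD('m) * ?R / ?r) ^ CARD('m) = (6 * real CARD('m)) ^ CARD('m) * exp (t / 2) / ?r ^ CARD('m)"
        by (simp add: power_divide power_mult_distrib)
      also have "?r ^ CARD('m) = exp t / (real N * ?V)"
      proof -
        have "?r ^ CARD('m) * (real N * ?V) = real N * (?V * ?r ^ CARD('m))" by (simp only: mult_ac)
        also have "\<dots> = exp t" unfolding v using N by simp
        finally show ?thesis using N V_pos by (subst nonzero_eq_divide_eq) (simp_all add: V_pos[THEN less_imp_neq, symmetric])
      qed
      also have "exp (t / 2) = exp t * exp (- t / 2)" by (simp add: mult_exp_exp)
      also have "(6 * real CARD('m)) ^ CARD('m) * (exp t * exp (- t / 2)) / (exp t / (real N * ?V))
        = real N * ((6 * real CARD('m)) ^ CARD('m) * ?V * exp (- t / 2))"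
        by simp
      finally show ?thesis by (simp only: mult_ac)
    qed
    finally have A: "real (card ?A) \<le> real N * (?K * exp (- t / 2))" .
    \<comment> \<open>An isolated point either lies in the ball of radius R, where the grid count
      applies, or is charged to the event of a large norm.\<close>
    have "(\<Sum>i=1..N. of_bool (isolated k N t i \<omega>)) \<le> (\<Sum>i=1..N. of_bool (i \<in> ?A) + indicator (?B i) \<omega> :: real)"
      using \<omega> by (intro sum_mono) (auto simp: isolated_def indicator_def)
    also have "\<dots> = real (card ?A) + (\<Sum>i=1..N. indicator (?B i) \<omega>)"
    proof -
      have "{1..N} \<inter> {i. i \<in> ?A} = ?A" by blast
      then have "(\<Sum>i=1..N. of_bool (i \<in> ?A)) = real (card ?A)" by (simp only: sum_of_bool_eq finite_atLeastAtMost)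
      then show ?thesis by (simp only: sum.distrib)
    qed
    finally have "(\<Sum>i=1..N. of_bool (isolated k N t i \<omega>)) \<le> real N * (?K * exp (- t / 2)) + (\<Sum>i=1..N. indicator (?B i) \<omega>)"
      using A by linarith
    then have "survival k N t \<omega> \<le> (real N * (?K * exp (- t / 2)) + (\<Sum>i=1..N. indicator (?B i) \<omega>)) / real N"
      unfolding survival_def by (rule divide_right_mono) simp
    then show ?thesis using N by (simp add: add_divide_distrib)
  qed
  have "prob_isolated k N t = expectation (survival k N t)" by (rule expectation_survival[OF N, symmetric])
  also have "\<dots> \<le> expectation (\<lambda>\<omega>. ?K * exp (- t / 2) + (\<Sum>i=1..N. indicator (?B i) \<omega>) / real N)"
    using meas by (intro integral_mono bound integrable_survival Bochner_Integration.integrable_add integrable_const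
        integrable_mean_intros integrable_real_indicator) (auto simp: less_top[symmetric])
  also have "\<dots> = ?K * exp (- t / 2) + (\<Sum>i=1..N. prob (?B i)) / real N"
  proof -
    have ii: "integrable M (indicator (?B i) :: 'a \<Rightarrow> real)" if "i \<in> {1..N}" for i
      using meas[OF that] by (intro integrable_real_indicator) (auto simp: less_top[symmetric])
    have "expectation (\<lambda>\<omega>. \<Sum>i=1..N. indicator (?B i) \<omega>) = (\<Sum>i=1..N. prob (?B i))"
      using ii meas by (subst Bochner_Integration.integral_sum) (auto intro!: sum.cong expectation_indicator)
    moreover have "integrable M (\<lambda>\<omega>. \<Sum>i=1..N. indicator (?B i) \<omega> :: real)"
      using ii by (intro Bochner_Integration.integrable_sum)
    ultimately show ?thesis by (simp add: prob_space)
  qed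
  also have "(\<Sum>i=1..N. prob (?B i)) / real N \<le> (\<Sum>i=1..N. mom * exp (- t / 2)) / real N"
    using prob_norm_large[OF t] by (intro divide_right_mono sum_mono) auto
  also have "\<dots> = mom * exp (- t / 2)" using N by simp
  also have "?K * exp (- t / 2) + mom * exp (- t / 2) \<le> tail_const k * exp (- t / 2)"
    unfolding tail_const_def using mom_nonneg by (simp add: distrib_right)
  finally show ?thesis by simp
qed

text \<open>If the radius exceeds the diameter of the ball that contains most of the mass, a point can be
  isolated only if it or one of \<open>k\<close> other points lies outside that ball.\<close>

lemma prob_isolated_upper_large_radius:
  assumes N: "k < N" and t: "0 \<le> t"
    and r: "2 * exp (t / (2 * real CARD('m))) \<le> kl_radius CARD('m) N t"
  shows "prob_isolated k N t \<le> tail_const k * exp (- t / 2)"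
proof -
  let ?R = "exp (t / (2 * real CARD('m)))"
  let ?r = "kl_radius CARD('m) N t"
  let ?B = "\<lambda>i. {\<omega> \<in> space M. ?R < norm (Xs i \<omega>)}"
  have meas: "?B i \<in> events" if "1 \<le> i" for i
  proof -
    have [measurable]: "Xs i \<in> borel_measurable M" using measurable_sample[OF that] .
    show ?thesis by measurable
  qed
  \<comment> \<open>All indices have the same isolation probability, so index 1 stands for all of
    them; k < N ensures that 2, ..., k + 1 belong to the sample.\<close>
  have N1: "1 \<in> {1..N}" using N by simp
  have "{\<omega> \<in> space M. isolated k N t 1 \<omega>} \<subseteq> (\<Union>i\<in>{1..k + 1}. ?B i)"
  proof (rule ccontr)
    assume "\<not> {\<omega> \<in> space M. isolated k N t 1 \<omega>} \<subseteq> (\<Union>i\<in>{1..k + 1}. ?B i)"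
    then obtain \<omega> where "\<omega> \<in> {\<omega> \<in> space M. isolated k N t 1 \<omega>}" "\<omega> \<notin> (\<Union>i\<in>{1..k + 1}. ?B i)" by blast
    then have \<omega>: "\<omega> \<in> space M" "isolated k N t 1 \<omega>" "\<And>i. i \<in> {1..k + 1} \<Longrightarrow> norm (Xs i \<omega>) \<le> ?R"
      by (auto simp: not_less)
    have "{2..k + 1} \<subseteq> {j \<in> {1..N} - {1}. dist (Xs 1 \<omega>) (Xs j \<omega>) \<le> ?r}"
    proof
      fix j assume j: "j \<in> {2..k + 1}"
      have "dist (Xs 1 \<omega>) (Xs j \<omega>) \<le> norm (Xs 1 \<omega>) + norm (Xs j \<omega>)" unfolding dist_norm by (rule norm_triangle_ineq4)
      also have "\<dots> \<le> ?r" using \<omega>(3)[of 1] \<omega>(3)[of j] j r by auto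
      finally show "j \<in> {j \<in> {1..N} - {1}. dist (Xs 1 \<omega>) (Xs j \<omega>) \<le> ?r}" using j N by auto
    qed
    then have "card {2..k + 1} \<le> card {j \<in> {1..N} - {1}. dist (Xs 1 \<omega>) (Xs j \<omega>) \<le> ?r}" by (intro card_mono) auto
    then show False using \<omega>(2) by (simp add: isolated_def)
  qed
  then have "prob {\<omega> \<in> space M. isolated k N t 1 \<omega>} \<le> prob (\<Union>i\<in>{1..k + 1}. ?B i)"
    using meas by (intro finite_measure_mono) auto
  also have "\<dots> \<le> (\<Sum>i\<in>{1..k + 1}. prob (?B i))"
    using meas by (intro finite_measure_subadditive_finite) auto
  also have "\<dots> \<le> (\<Sum>i\<in>{1..k + 1}. mom * exp (- t / 2))"
    using prob_norm_large[OF t] by (intro sum_mono) auto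
  also have "\<dots> = (real k + 1) * mom * exp (- t / 2)" by simp
  also have "\<dots> \<le> tail_const k * exp (- t / 2)"
    unfolding tail_const_def using less_imp_le[OF V_pos] by (intro mult_right_mono) auto
  finally show ?thesis by (simp only: prob_isolated_eq[OF N1])
qed

text \<open>The factor 1 in the first exponent and the form of the second match the exponential
  integrals that give integrability.\<close>

definition dominating :: "nat \<Rightarrow> real \<Rightarrow> real" where
  "dominating k t = C * (indicator {..<0} t * exp (1 * t)) + tail_const k * (indicator {0..} t * exp (- (1 / 2) * t))"

lemma integrable_dominating: "integrable lborel (dominating k)"
proof -
  have "integrable lborel (\<lambda>t :: real. indicator {..<0} t * exp (1 * t) :: real)"
    using has_bochner_integral_exp_lessThan[OF zero_less_one] by (rule integrable.intros)
  moreover have "integrable lborel (\<lambda>t :: real. indicator {0..} t * exp (- (1 / 2) * t) :: real)"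
    using has_bochner_integral_exp_atLeast[OF half_gt_zero[OF zero_less_one]] by (rule integrable.intros)
  ultimately show ?thesis
    unfolding dominating_def[abs_def] by (intro Bochner_Integration.integrable_add integrable_mult_right)
qed

lemma prob_isolated_dominated:
  assumes k: "1 \<le> k" "k < N"
  shows "\<bar>prob_isolated k N t - indicator {..<0} t\<bar> \<le> dominating k t"
proof -
  note b = prob_isolated_bounds[of k N t]
  show ?thesis
  proof (cases "t < 0")
    case True
    then show ?thesis using prob_isolated_lower[of k N t] k b by (simp add: dominating_def)
  next
    case False
    then have "prob_isolated k N t \<le> tail_const k * exp (- t / 2)"
      using prob_isolated_upper_small_radius[of N t k] prob_isolated_upper_large_radius[of k N t] k by force
    then show ?thesis using False b by (simp add: dominating_def)
  qed
qed

text \<open>The bound on \<open>prob_isolated\<close> is uniform in N > k and therefore passes to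
  the limit.\<close>

lemma lim_survival_dominated:
  assumes k: "1 \<le> k"
  shows "\<bar>lim_survival k t - indicator {..<0} t\<bar> \<le> dominating k t"
proof (rule tendsto_upperbound)
  show "(\<lambda>N. \<bar>prob_isolated k N t - indicator {..<0} t\<bar>) \<longlonglongrightarrow> \<bar>lim_survival k t - indicator {..<0} t\<bar>"
    by (intro tendsto_intros prob_isolated_tendsto)
  show "\<forall>\<^sub>F N in sequentially. \<bar>prob_isolated k N t - indicator {..<0} t\<bar> \<le> dominating k t"
    using eventually_gt_at_top[of k] by eventually_elim (rule prob_isolated_dominated[OF k])
qed simp

text \<open>Since F lies in [0, 1], the difference F - 1{t < 0} has one sign for each t, and its
  mean absolute value is the absolute value of its mean. The factor 2 collects the bound for F and
  the bound for its limit.\<close>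

lemma survival_dominated:
  assumes k: "1 \<le> k" "k < N"
  shows "expectation (\<lambda>\<omega>. \<bar>survival k N t \<omega> - lim_survival k t\<bar>) \<le> 2 * dominating k t"
proof -
  let ?i = "indicator {..<0} t :: real"
  have N: "1 \<le> N" using k by simp
  have abs: "\<bar>survival k N t \<omega> - ?i\<bar> = (if t < 0 then 1 - survival k N t \<omega> else survival k N t \<omega>)" for \<omega>
    using survival_bounds[of k N t \<omega>] by (simp add: indicator_def)
  have "expectation (\<lambda>\<omega>. \<bar>survival k N t \<omega> - lim_survival k t\<bar>) \<le> expectation (\<lambda>\<omega>. \<bar>survival k N t \<omega> - ?i\<bar> + dominating k t)"
  proof (rule integral_mono)
    show "integrable M (\<lambda>\<omega>. \<bar>survival k N t \<omega> - lim_survival k t\<bar>)" "integrable M (\<lambda>\<omega>. \<bar>survival k N t \<omega> - ?i\<bar> + dominating k t)"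
      using integrable_survival by auto
    fix \<omega>
    show "\<bar>survival k N t \<omega> - lim_survival k t\<bar> \<le> \<bar>survival k N t \<omega> - ?i\<bar> + dominating k t"
      using lim_survival_dominated[OF k(1), of t] by linarith
  qed
  also have "\<dots> = \<bar>prob_isolated k N t - ?i\<bar> + dominating k t"
  proof -
    have "expectation (\<lambda>\<omega>. \<bar>survival k N t \<omega> - ?i\<bar>) = (if t < 0 then 1 - prob_isolated k N t else prob_isolated k N t)"
      unfolding abs using integrable_survival[of k N t] by (simp add: prob_space expectation_survival[OF N])
    also have "\<dots> = \<bar>prob_isolated k N t - ?i\<bar>"
      using prob_isolated_bounds[of k N t] by (simp add: indicator_def)
    finally show ?thesis using integrable_survival[of k N t] by (simp add: prob_space)
  qed
  also have "\<dots> \<le> 2 * dominating k t" using prob_isolated_dominated[OF k, of t] by simp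
  finally show ?thesis .
qed

end

section \<open>Consistency of the entropy estimator\<close>

context density_sample
begin

lemma measurable_knn_dist:
  assumes k: "1 \<le> k" "k < N" "i \<in> {1..N}"
  shows "(\<lambda>\<omega>. knn_dist k N (\<lambda>i. Xs i \<omega>) i) \<in> borel_measurable M"
  unfolding borel_measurable_iff_greater
proof
  fix r
  have "Measurable.pred M (\<lambda>\<omega>. card {j \<in> {1..N} - {i}. dist (Xs i \<omega>) (Xs j \<omega>) \<le> r} < k)"
  proof (rule measurable_card_less)
    fix j assume j: "j \<in> {1..N} - {i}"
    have [measurable]: "Xs i \<in> borel_measurable M" "Xs j \<in> borel_measurable M" using j k measurable_sample by auto
    show "Measurable.pred M (\<lambda>\<omega>. dist (Xs i \<omega>) (Xs j \<omega>) \<le> r)" by measurable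
  qed simp
  then show "{\<omega> \<in> space M. r < knn_dist k N (\<lambda>i. Xs i \<omega>) i} \<in> events"
    by (simp only: pred_def knn_dist_greater_iff[OF k])
qed

definition log_dist :: "nat \<Rightarrow> nat \<Rightarrow> nat \<Rightarrow> 'a \<Rightarrow> real" where
  "log_dist k N i \<omega> = ln (real N * unit_ball_vol (real CARD('m))) + real CARD('m) * ln (knn_dist k N (\<lambda>i. Xs i \<omega>) i)"

text \<open>A chain of monotone maps: exponentiate, cancel N V, take m-th roots. Positivity of the
  distance excludes the default value \<open>ln 0 = 0\<close>.\<close>

lemma less_log_dist_iff:
  assumes k: "1 \<le> k" "k < N" "i \<in> {1..N}" and pos: "0 < knn_dist k N (\<lambda>i. Xs i \<omega>) i"
  shows "t < log_dist k N i \<omega> \<longleftrightarrow> isolated k N t i \<omega>"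
proof -
  let ?\<rho> = "knn_dist k N (\<lambda>i. Xs i \<omega>) i" and ?r = "kl_radius CARD('m) N t" and ?c = "real N * unit_ball_vol (real CARD('m))"
  have c: "0 < ?c" using k V_pos by simp
  have r: "0 < ?r" using rad_pos k by simp
  have "?c * ?r ^ CARD('m) = real N * (unit_ball_vol (real CARD('m)) * ?r ^ CARD('m))" by (simp only: mult.assoc)
  also have "\<dots> = exp t" using k by (subst rad_power) auto
  finally have t: "exp t = ?c * ?r ^ CARD('m)" by simp
  have "log_dist k N i \<omega> = ln (?c * ?\<rho> ^ CARD('m))"
  proof -
    have "ln (a * b) = ln a + ln b" if "0 < a" "0 < b" for a b :: real using that by (simp add: ln_mult)
    from this[OF c] show ?thesis using pos by (simp only: log_dist_def ln_realpow zero_less_power)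
  qed
  then have "t < log_dist k N i \<omega> \<longleftrightarrow> exp t < ?c * ?\<rho> ^ CARD('m)"
    using c pos by (metis exp_less_cancel_iff exp_ln mult_pos_pos zero_less_power)
  also have "\<dots> \<longleftrightarrow> ?r ^ CARD('m) < ?\<rho> ^ CARD('m)" unfolding t using c by (rule mult_less_cancel_left_pos)
  also have "\<dots> \<longleftrightarrow> ?r < ?\<rho>" using r pos by (auto intro: power_strict_mono power_less_imp_less_base)
  also have "\<dots> \<longleftrightarrow> isolated k N t i \<omega>" unfolding isolated_def by (rule knn_dist_greater_iff[OF k])
  finally show ?thesis .
qed

text \<open>A point at distance 0 from its k-th neighbour is isolated at no level t. By the lower
  tail bound this has probability at most C exp t for every t, and t = - n is sent to minus
  infinity.\<close>

lemma AE_knn_dist_pos: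
  assumes k: "1 \<le> k" "k < N" "i \<in> {1..N}"
  shows "AE \<omega> in M. 0 < knn_dist k N (\<lambda>i. Xs i \<omega>) i"
proof -
  let ?\<rho> = "\<lambda>\<omega>. knn_dist k N (\<lambda>i. Xs i \<omega>) i"
  note [measurable] = measurable_knn_dist[OF k] pred_isolated[OF k(3)]
  let ?A = "{\<omega> \<in> space M. \<not> 0 < ?\<rho> \<omega>}"
  have "prob ?A \<le> C * exp (- real n)" for n
  proof -
    have "?A \<subseteq> {\<omega> \<in> space M. \<not> isolated k N (- real n) i \<omega>}"
    proof safe
      fix \<omega> assume "\<not> 0 < ?\<rho> \<omega>" "isolated k N (- real n) i \<omega>"
      then have "kl_radius CARD('m) N (- real n) < ?\<rho> \<omega>" unfolding isolated_def by (subst knn_dist_greater_iff[OF k])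
      then show False using rad_pos[of N "- real n"] k \<open>\<not> 0 < ?\<rho> \<omega>\<close> by simp
    qed
    then have "prob ?A \<le> prob {\<omega> \<in> space M. \<not> isolated k N (- real n) i \<omega>}" by (intro finite_measure_mono) auto
    also have "\<dots> = 1 - prob_isolated k N (- real n)"
      unfolding prob_isolated_eq[OF k(3), symmetric] by (rule prob_neg) simp
    also have "\<dots> \<le> C * exp (- real n)" using k by (intro prob_isolated_lower) auto
    finally show ?thesis .
  qed
  moreover have "(\<lambda>n. C * exp (- real n)) \<longlonglongrightarrow> C * 0"
    by (intro tendsto_intros filterlim_compose[OF exp_at_bot] filterlim_compose[OF filterlim_uminus_at_bot_at_top filterlim_real_sequentially])
  ultimately have "prob ?A \<le> C * 0" by (intro LIMSEQ_le_const) auto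
  then have "prob ?A = 0" using measure_nonneg[of M ?A] by simp
  then show ?thesis by (subst AE_iff_measurable[of ?A]) (auto simp: emeasure_eq_measure)
qed

lemma borel_measurable_lim_survival[measurable]: "lim_survival k \<in> borel_measurable borel"
  unfolding lim_survival_def[abs_def] by measurable

definition mean_log_dist :: "nat \<Rightarrow> nat \<Rightarrow> 'a \<Rightarrow> real" where
  "mean_log_dist k N \<omega> = (\<Sum>i=1..N. log_dist k N i \<omega>) / real N"

definition log_dist_limit :: "nat \<Rightarrow> real" where
  "log_dist_limit k = (\<integral>t. lim_survival k t - indicator {..<0} t \<partial>lborel)"

lemma integrable_lim_survival:
  assumes "1 \<le> k" shows "integrable lborel (\<lambda>t. lim_survival k t - indicator {..<0} t)"
  by (rule Bochner_Integration.integrable_bound[OF integrable_dominating[of k]])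
     (auto intro!: AE_I2 order_trans[OF lim_survival_dominated[OF assms]])

text \<open>Since \<open>z = \<integral> (1{t < z} - 1{t < 0}) dt\<close>, the mean of the log distances differs from its limit by
  the integral of the difference of the survival functions.\<close>

lemma mean_log_dist_deviation:
  assumes k: "1 \<le> k" "k < N"
  shows "(\<integral>\<^sup>+\<omega>. ennreal \<bar>mean_log_dist k N \<omega> - log_dist_limit k\<bar> \<partial>M)
    \<le> (\<integral>\<^sup>+t. ennreal (expectation (\<lambda>\<omega>. \<bar>survival k N t \<omega> - lim_survival k t\<bar>)) \<partial>lborel)"
proof -
  have logm[measurable]: "log_dist k N i \<in> borel_measurable M" if "i \<in> {1..N}" for i
    unfolding log_dist_def[abs_def] using measurable_knn_dist[OF k that] by measurable
  \<comment> \<open>\<open>s\<close> is built from the logarithms themselves, so the layer-cake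
    formula holds for every outcome. It agrees with \<open>survival\<close> only almost surely, when
    all neighbour distances are positive.\<close>
  define s where "s \<omega> t = (\<Sum>i=1..N. indicator {..<log_dist k N i \<omega>} t) / real N" for \<omega> t
  have smeas: "(\<lambda>z. s (fst z) (snd z)) \<in> borel_measurable (M \<Otimes>\<^sub>M lborel)"
  proof -
    have "(\<lambda>z. indicator {..<log_dist k N i (fst z)} (snd z) :: real) \<in> borel_measurable (M \<Otimes>\<^sub>M lborel)" if "i \<in> {1..N}" for i
    proof -
      have [measurable]: "log_dist k N i \<in> borel_measurable M" by (rule logm[OF that])
      have "(\<lambda>z. indicator {..<log_dist k N i (fst z)} (snd z) :: real) = (\<lambda>z. if snd z < log_dist k N i (fst z) then 1 else 0)"
        by (auto simp: indicator_def)
      then show ?thesis by simp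
    qed
    then show ?thesis unfolding s_def by (intro borel_measurable_divide borel_measurable_sum borel_measurable_const)
  qed
  have dev: "ennreal \<bar>mean_log_dist k N \<omega> - log_dist_limit k\<bar> \<le> (\<integral>\<^sup>+t. ennreal \<bar>s \<omega> t - lim_survival k t\<bar> \<partial>lborel)" for \<omega>
  proof -
    have "has_bochner_integral lborel (\<lambda>t. (\<Sum>i=1..N. indicator {..<log_dist k N i \<omega>} t - indicator {..<0} t) / real N) (mean_log_dist k N \<omega>)"
      unfolding mean_log_dist_def
      by (intro has_bochner_integral_divide_zero has_bochner_integral_sum has_bochner_integral_indicator_lessThan_diff)
    moreover have "(\<Sum>i=1..N. indicator {..<log_dist k N i \<omega>} t - indicator {..<0} t) / real N = s \<omega> t - indicator {..<0} t" for t
      using k by (simp add: s_def sum_subtractf diff_divide_distrib)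
    ultimately have "has_bochner_integral lborel (\<lambda>t. s \<omega> t - indicator {..<0} t) (mean_log_dist k N \<omega>)" by simp
    moreover have "has_bochner_integral lborel (\<lambda>t. lim_survival k t - indicator {..<0} t) (log_dist_limit k)"
      using integrable_lim_survival[OF k(1)] by (simp add: has_bochner_integral_iff log_dist_limit_def)
    ultimately have "has_bochner_integral lborel (\<lambda>t. (s \<omega> t - indicator {..<0} t) - (lim_survival k t - indicator {..<0} t)) (mean_log_dist k N \<omega> - log_dist_limit k)"
      by (rule has_bochner_integral_diff)
    then have I: "has_bochner_integral lborel (\<lambda>t. s \<omega> t - lim_survival k t) (mean_log_dist k N \<omega> - log_dist_limit k)" by simp
    then have "ennreal (norm (mean_log_dist k N \<omega> - log_dist_limit k)) \<le> (\<integral>\<^sup>+t. ennreal (norm (s \<omega> t - lim_survival k t)) \<partial>lborel)"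
      using integral_norm_bound_ennreal[of lborel "\<lambda>t. s \<omega> t - lim_survival k t"] by (simp add: has_bochner_integral_iff)
    then show ?thesis by simp
  qed
  interpret pair_sigma_finite M lborel by unfold_locales
  have "(\<integral>\<^sup>+\<omega>. ennreal \<bar>mean_log_dist k N \<omega> - log_dist_limit k\<bar> \<partial>M) \<le> (\<integral>\<^sup>+\<omega>. \<integral>\<^sup>+t. ennreal \<bar>s \<omega> t - lim_survival k t\<bar> \<partial>lborel \<partial>M)"
    by (intro nn_integral_mono dev)
  also have "\<dots> = (\<integral>\<^sup>+t. \<integral>\<^sup>+\<omega>. ennreal \<bar>s \<omega> t - lim_survival k t\<bar> \<partial>M \<partial>lborel)"
    using smeas by (intro Fubini'[symmetric]) (simp add: case_prod_beta)
  also have "\<dots> = (\<integral>\<^sup>+t. ennreal (expectation (\<lambda>\<omega>. \<bar>survival k N t \<omega> - lim_survival k t\<bar>)) \<partial>lborel)"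
  proof (rule nn_integral_cong)
    fix t
    have "AE \<omega> in M. \<forall>i\<in>{1..N}. 0 < knn_dist k N (\<lambda>i. Xs i \<omega>) i"
      using AE_knn_dist_pos[OF k] by (intro AE_finite_allI) auto
    then have "AE \<omega> in M. s \<omega> t = survival k N t \<omega>"
    proof eventually_elim
      case (elim \<omega>)
      have "indicator {..<log_dist k N i \<omega>} t = (of_bool (isolated k N t i \<omega>) :: real)" if "i \<in> {1..N}" for i
        using less_log_dist_iff[OF k that] elim that by (simp add: indicator_def)
      then show ?case unfolding s_def survival_def by simp
    qed
    then have "(\<integral>\<^sup>+\<omega>. ennreal \<bar>s \<omega> t - lim_survival k t\<bar> \<partial>M) = (\<integral>\<^sup>+\<omega>. ennreal \<bar>survival k N t \<omega> - lim_survival k t\<bar> \<partial>M)"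
      by (intro nn_integral_cong_AE) (auto elim!: eventually_mono)
    also have "\<dots> = ennreal (expectation (\<lambda>\<omega>. \<bar>survival k N t \<omega> - lim_survival k t\<bar>))"
      using integrable_survival[of k N t] by (intro nn_integral_eq_integral) auto
    finally show "(\<integral>\<^sup>+\<omega>. ennreal \<bar>s \<omega> t - lim_survival k t\<bar> \<partial>M) = ennreal (expectation (\<lambda>\<omega>. \<bar>survival k N t \<omega> - lim_survival k t\<bar>))" .
  qed
  finally show ?thesis .
qed

text \<open>The deviation is first bounded in the extended nonnegative reals. Finiteness of the
  bound then yields integrability of the mean logarithm, of which only measurability is known
  beforehand.\<close>

lemma mean_log_dist_tendsto_L1:
  assumes k: "1 \<le> k"
  shows "\<forall>\<^sub>F N in sequentially. integrable M (mean_log_dist k N)"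
    and "(\<lambda>N. expectation (\<lambda>\<omega>. \<bar>mean_log_dist k N \<omega> - log_dist_limit k\<bar>)) \<longlonglongrightarrow> 0"
proof -
  let ?\<Delta> = "\<lambda>N \<omega>. \<bar>mean_log_dist k N \<omega> - log_dist_limit k\<bar>"
  let ?u = "\<lambda>N t. expectation (\<lambda>\<omega>. \<bar>survival k N t \<omega> - lim_survival k t\<bar>)"
  let ?I = "\<lambda>N. \<integral>\<^sup>+t. ennreal (?u N t) \<partial>lborel"
  have pred: "Measurable.pred (lborel \<Otimes>\<^sub>M M) (\<lambda>z. isolated k N (fst z) i (snd z))" if i: "i \<in> {1..N}" for i N
  proof -
    have [measurable]: "(\<lambda>z. kl_radius CARD('m) N (fst z)) \<in> borel_measurable (lborel \<Otimes>\<^sub>M M)"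
      unfolding kl_radius_def by measurable
    have [measurable]: "Xs j \<in> borel_measurable M" if "j \<in> {1..N}" for j using measurable_sample that by simp
    show ?thesis unfolding isolated_def using i
      by (intro measurable_card_less borel_measurable_le borel_measurable_dist) (auto intro!: measurable_compose[OF measurable_snd] measurable_sample)
  qed
  have umeas: "?u N \<in> borel_measurable lborel" for N
  proof -
    have "(\<lambda>z. of_bool (isolated k N (fst z) i (snd z)) :: real) \<in> borel_measurable (lborel \<Otimes>\<^sub>M M)" if "i \<in> {1..N}" for i
      using pred[OF that] by simp
    then have "(\<lambda>z. survival k N (fst z) (snd z)) \<in> borel_measurable (lborel \<Otimes>\<^sub>M M)"
      unfolding survival_def by (intro borel_measurable_divide borel_measurable_sum borel_measurable_const)
    then have "(\<lambda>z. \<bar>survival k N (fst z) (snd z) - lim_survival k (fst z)\<bar>) \<in> borel_measurable (lborel \<Otimes>\<^sub>M M)"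
      by simp
    then show ?thesis by (intro borel_measurable_lebesgue_integral) (simp add: case_prod_beta)
  qed
  \<comment> \<open>Domination holds for N > k, so the sequence is shifted to start at k +
    1.\<close>
  define N0 where "N0 = Suc k"
  have fin: "(\<integral>\<^sup>+t. ennreal (2 * dominating k t) \<partial>lborel) < \<infinity>"
  proof -
    have "integrable lborel (\<lambda>t. 2 * dominating k t)" using integrable_dominating by simp
    moreover have "0 \<le> 2 * dominating k t" for t
      using order_trans[OF abs_ge_zero lim_survival_dominated[OF k, of t]] by simp
    ultimately show ?thesis by (subst nn_integral_eq_integral) auto
  qed
  have "(\<lambda>n. ?I (n + N0)) \<longlonglongrightarrow> (\<integral>\<^sup>+t. 0 \<partial>(lborel :: real measure))"
  proof (rule nn_integral_dominated_convergence[where w = "\<lambda>t. ennreal (2 * dominating k t)"])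
    show "(\<lambda>t. ennreal (?u (n + N0) t)) \<in> borel_measurable lborel" for n
      using umeas by (intro measurable_compose[OF _ measurable_ennreal]) auto
    show "(\<lambda>t. ennreal (2 * dominating k t)) \<in> borel_measurable lborel"
      using integrable_dominating[of k] by (intro measurable_compose[OF _ measurable_ennreal]) auto
    show "AE t in lborel. ennreal (?u (n + N0) t) \<le> ennreal (2 * dominating k t)" for n
      by (intro AE_I2 ennreal_leI survival_dominated k) (simp add: N0_def)
    show "AE t in lborel. (\<lambda>n. ennreal (?u (n + N0) t)) \<longlonglongrightarrow> 0"
    proof (rule AE_I2)
      fix t
      have "(\<lambda>n. ?u (n + N0) t) \<longlonglongrightarrow> 0" using survival_tendsto_L1 by (rule LIMSEQ_ignore_initial_segment)
      then have "(\<lambda>n. ennreal (?u (n + N0) t)) \<longlonglongrightarrow> ennreal 0" by (rule tendsto_ennrealI)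
      then show "(\<lambda>n. ennreal (?u (n + N0) t)) \<longlonglongrightarrow> 0" by simp
    qed
  qed (use fin in auto)
  then have "(\<lambda>n. ?I (n + N0)) \<longlonglongrightarrow> 0" by simp
  then have I0: "?I \<longlonglongrightarrow> 0" by (rule LIMSEQ_offset)
  have dev: "\<forall>\<^sub>F N in sequentially. (\<integral>\<^sup>+\<omega>. ennreal (?\<Delta> N \<omega>) \<partial>M) \<le> ?I N \<and> ?I N < \<infinity> \<and> mean_log_dist k N \<in> borel_measurable M"
    using eventually_gt_at_top[of k]
  proof eventually_elim
    case (elim N)
    have "?I N \<le> (\<integral>\<^sup>+t. ennreal (2 * dominating k t) \<partial>lborel)"
      by (intro nn_integral_mono ennreal_leI survival_dominated k elim)
    then have "?I N < \<infinity>" using fin by (rule le_less_trans)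
    moreover have "mean_log_dist k N \<in> borel_measurable M"
    proof -
      have "log_dist k N i \<in> borel_measurable M" if "i \<in> {1..N}" for i
        unfolding log_dist_def[abs_def] using measurable_knn_dist[OF k elim that] by measurable
      then show ?thesis unfolding mean_log_dist_def[abs_def] by (intro borel_measurable_divide borel_measurable_sum borel_measurable_const)
    qed
    ultimately show ?case using mean_log_dist_deviation[OF k elim] by simp
  qed
  have int: "\<forall>\<^sub>F N in sequentially. integrable M (\<lambda>\<omega>. mean_log_dist k N \<omega> - log_dist_limit k)"
    using dev
  proof eventually_elim
    case (elim N)
    then show ?case by (intro integrableI_bounded) (auto intro: le_less_trans)
  qed
  then show "\<forall>\<^sub>F N in sequentially. integrable M (mean_log_dist k N)"
  proof eventually_elim
    case (elim N)
    from Bochner_Integration.integrable_add[OF elim integrable_const[of "log_dist_limit k"]] show ?case by simp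
  qed
  have "(\<lambda>N. ennreal (expectation (\<lambda>\<omega>. ?\<Delta> N \<omega>))) \<longlonglongrightarrow> 0"
  proof (rule tendsto_sandwich[OF _ _ tendsto_const I0])
    show "\<forall>\<^sub>F N in sequentially. ennreal (expectation (\<lambda>\<omega>. ?\<Delta> N \<omega>)) \<le> ?I N"
      using dev int
    proof eventually_elim
      case (elim N)
      have "(\<integral>\<^sup>+\<omega>. ennreal (?\<Delta> N \<omega>) \<partial>M) = ennreal (expectation (\<lambda>\<omega>. ?\<Delta> N \<omega>))"
        using elim(2) by (intro nn_integral_eq_integral) auto
      then show ?case using elim(1) by simp
    qed
  qed simp
  then show "(\<lambda>N. expectation (\<lambda>\<omega>. ?\<Delta> N \<omega>)) \<longlonglongrightarrow> 0"
    by (subst (asm) ennreal_0[symmetric], subst (asm) tendsto_ennreal_iff) (auto intro!: always_eventually integral_nonneg_AE)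
qed

text \<open>Fubini exchanges t and x, and the inner integral over t is Digamma k - ln (f x).
  Absolute integrability comes from the sign: at each t the integrand has one sign for all x, so its
  absolute integral over x is |g(t) - 1{t < 0}|, already known to be integrable.\<close>

lemma log_dist_limit_eq:
  assumes k: "1 \<le> k" and H: "finite_diff_entropy f"
  shows "log_dist_limit k = Digamma (real k) + diff_entropy f"
proof -
  let ?h = "\<lambda>t x. poisson_below k (f x * exp t) - indicator {..<0} t :: real"
  interpret L: pair_sigma_finite lborel D by unfold_locales
  have pb: "0 \<le> poisson_below k (f x * exp t)" "poisson_below k (f x * exp t) \<le> 1" for x t
    using f_nonneg by (auto intro!: poisson_below_nonneg poisson_below_le_1)
  have ipb: "integrable D (\<lambda>x. poisson_below k (f x * exp t))" for t
    using pb by (intro D.integrable_const_bound[where B = 1]) auto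
  have g: "(\<integral>x. ?h t x \<partial>D) = lim_survival k t - indicator {..<0} t" for t
    using ipb D.prob_space by (simp add: lim_survival_def)
  have abs: "\<bar>?h t x\<bar> = (if t < 0 then - ?h t x else ?h t x)" for t x
    using pb[of x t] by (simp add: indicator_def)
  have absg: "(\<integral>x. \<bar>?h t x\<bar> \<partial>D) = \<bar>lim_survival k t - indicator {..<0} t\<bar>" for t
  proof -
    have "(\<integral>x. \<bar>?h t x\<bar> \<partial>D) = (if t < 0 then - (\<integral>x. ?h t x \<partial>D) else (\<integral>x. ?h t x \<partial>D))"
      unfolding abs by (cases "t < 0") (simp_all only: if_True if_False Bochner_Integration.integral_minus)
    then have e: "(\<integral>x. \<bar>?h t x\<bar> \<partial>D) = (if t < 0 then - (lim_survival k t - indicator {..<0} t) else lim_survival k t - indicator {..<0} t)"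
      unfolding g .
    have "0 \<le> (\<integral>x. \<bar>?h t x\<bar> \<partial>D)" by (intro integral_nonneg_AE AE_I2) simp
    with e show ?thesis by (auto split: if_splits)
  qed
  have meas: "(\<lambda>z. ?h (fst z) (snd z)) \<in> borel_measurable (lborel \<Otimes>\<^sub>M D)"
    by measurable
  have int: "integrable (lborel \<Otimes>\<^sub>M D) (\<lambda>(t, x). ?h t x)"
  proof (rule L.Fubini_integrable)
    show "(\<lambda>(t, x). ?h t x) \<in> borel_measurable (lborel \<Otimes>\<^sub>M D)" using meas by (simp add: case_prod_beta)
    show "integrable lborel (\<lambda>t. \<integral>x. norm (case (t, x) of (t, x) \<Rightarrow> ?h t x) \<partial>D)"
      using integrable_abs[OF integrable_lim_survival[OF k]] by (simp add: absg)
    show "AE t in lborel. integrable D (\<lambda>x. case (t, x) of (t, x) \<Rightarrow> ?h t x)" using ipb by simp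
  qed
  have "log_dist_limit k = (\<integral>t. (\<integral>x. ?h t x \<partial>D) \<partial>lborel)" by (simp only: log_dist_limit_def g)
  also have "\<dots> = (\<integral>x. (\<integral>t. ?h t x \<partial>lborel) \<partial>D)" by (rule L.Fubini_integral[OF int, symmetric])
  also have "\<dots> = (\<integral>x. Digamma (real k) - ln (f x) \<partial>D)"
  proof (rule integral_cong_AE)
    \<comment> \<open>The set where f vanishes is null under D, so the inner integral is evaluated
      only where f x > 0.\<close>
    show "AE x in D. (\<integral>t. ?h t x \<partial>lborel) = Digamma (real k) - ln (f x)"
    proof (subst AE_density)
      show "AE x in lborel. 0 < ennreal (f x) \<longrightarrow> (\<integral>t. ?h t x \<partial>lborel) = Digamma (real k) - ln (f x)"
        using has_bochner_integral_poisson_below_mult_exp[OF k] by (auto simp: has_bochner_integral_iff)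
    qed simp
    show "(\<lambda>x. \<integral>t. ?h t x \<partial>lborel) \<in> borel_measurable D"
    proof -
      have "(\<lambda>(x, t). ?h t x) \<in> borel_measurable (D \<Otimes>\<^sub>M lborel)" by measurable
      then show ?thesis by (rule lborel.borel_measurable_lebesgue_integral)
    qed
  qed measurable
  also have "\<dots> = Digamma (real k) - (\<integral>x. ln (f x) \<partial>D)"
  proof -
    have "integrable D (\<lambda>x. ln (f x))"
      using H by (subst integrable_real_density) (auto simp: f_nonneg finite_diff_entropy_def)
    then show ?thesis using D.prob_space by simp
  qed
  also have "(\<integral>x. ln (f x) \<partial>D) = - diff_entropy f"
    by (subst integral_real_density) (auto simp: f_nonneg diff_entropy_def)
  finally show ?thesis by simp
qed

text \<open>Digamma (n + 1) is the n-th harmonic number minus the Euler-Mascheroni constant, so this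
  is the defining limit of that constant up to a shift by one.\<close>

lemma Digamma_minus_ln_tendsto: "(\<lambda>N. Digamma (real N) - ln (real N)) \<longlonglongrightarrow> 0"
proof -
  have "(\<lambda>n. (harm n - ln (real n)) - euler_mascheroni + (ln (real n) - ln (real n + 1))) \<longlonglongrightarrow> euler_mascheroni - euler_mascheroni + 0"
  proof (intro tendsto_intros euler_mascheroni_LIMSEQ)
    show "(\<lambda>n. ln (real n) - ln (real n + 1)) \<longlonglongrightarrow> 0" by real_asymp
  qed
  then have "(\<lambda>n. Digamma (real (Suc n)) - ln (real (Suc n))) \<longlonglongrightarrow> 0"
    unfolding Digamma_of_nat by (simp add: algebra_simps)
  then show ?thesis by (rule LIMSEQ_imp_Suc)
qed

theorem KL_entropy_est_tendsto_in_prob: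
  assumes k: "1 \<le> k" and H: "finite_diff_entropy f"
  shows "tendsto_in_prob M (\<lambda>N \<omega>. KL_entropy_est k N (\<lambda>i. Xs i \<omega>)) (diff_entropy f)"
proof (rule tendsto_in_prob_L1)
  let ?H = "\<lambda>N \<omega>. KL_entropy_est k N (\<lambda>i. Xs i \<omega>)"
  define d where "d N = Digamma (real N) - ln (real N)" for N
  have est: "?H N \<omega> = mean_log_dist k N \<omega> + (d N - Digamma (real k))" if "1 \<le> N" for N \<omega>
  proof -
    let ?L = "\<Sum>i=1..N. ln (knn_dist k N (\<lambda>i. Xs i \<omega>) i)"
    have "mean_log_dist k N \<omega> = (real N * ln (real N * unit_ball_vol (real CARD('m))) + real CARD('m) * ?L) / real N"
      unfolding mean_log_dist_def log_dist_def sum.distrib sum_distrib_left by simp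
    also have "\<dots> = ln (real N) + ln (unit_ball_vol (real CARD('m))) + real CARD('m) / real N * ?L"
      using that V_pos by (simp add: add_divide_distrib ln_mult V_pos[THEN less_imp_neq, symmetric])
    finally show ?thesis by (simp add: KL_entropy_est_def d_def)
  qed
  note int = mean_log_dist_tendsto_L1(1)[OF k]
  show "\<forall>\<^sub>F N in sequentially. integrable M (\<lambda>\<omega>. ?H N \<omega>)"
    using int eventually_ge_at_top[of 1] by eventually_elim (simp add: est)
  show "(\<lambda>N. expectation (\<lambda>\<omega>. \<bar>?H N \<omega> - diff_entropy f\<bar>)) \<longlonglongrightarrow> 0"
  proof (rule tendsto_sandwich[OF _ _ tendsto_const])
    show "\<forall>\<^sub>F N in sequentially. 0 \<le> expectation (\<lambda>\<omega>. \<bar>?H N \<omega> - diff_entropy f\<bar>)"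
      by (intro always_eventually allI integral_nonneg_AE AE_I2) simp
    show "\<forall>\<^sub>F N in sequentially. expectation (\<lambda>\<omega>. \<bar>?H N \<omega> - diff_entropy f\<bar>)
       \<le> expectation (\<lambda>\<omega>. \<bar>mean_log_dist k N \<omega> - log_dist_limit k\<bar>) + \<bar>d N\<bar>"
      using int eventually_ge_at_top[of 1]
    proof eventually_elim
      case (elim N)
      have "expectation (\<lambda>\<omega>. \<bar>?H N \<omega> - diff_entropy f\<bar>) \<le> expectation (\<lambda>\<omega>. \<bar>mean_log_dist k N \<omega> - log_dist_limit k\<bar> + \<bar>d N\<bar>)"
      proof (rule integral_mono)
        fix \<omega>
        \<comment> \<open>The term Digamma k cancels between estimator and limit, which leaves the
          deterministic error d N.\<close>
        show "\<bar>?H N \<omega> - diff_entropy f\<bar> \<le> \<bar>mean_log_dist k N \<omega> - log_dist_limit k\<bar> + \<bar>d N\<bar>"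
          unfolding est[OF elim(2)] log_dist_limit_eq[OF k H] by linarith
      qed (use elim in \<open>simp_all add: est\<close>)
      then show ?case using elim by (simp add: prob_space)
    qed
    have "(\<lambda>N. expectation (\<lambda>\<omega>. \<bar>mean_log_dist k N \<omega> - log_dist_limit k\<bar>) + \<bar>d N\<bar>) \<longlonglongrightarrow> 0 + \<bar>0\<bar>"
      unfolding d_def by (intro tendsto_intros mean_log_dist_tendsto_L1(2)[OF k] Digamma_minus_ln_tendsto)
    then show "(\<lambda>N. expectation (\<lambda>\<omega>. \<bar>mean_log_dist k N \<omega> - log_dist_limit k\<bar>) + \<bar>d N\<bar>) \<longlonglongrightarrow> 0" by simp
  qed
qed

end

section \<open>Consistency of the statistic and separation of normal from non-normal
  densities\<close>

theorem theorem4p1: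
  fixes f :: "real ^ 'm::finite \<Rightarrow> real"
    and P :: "'b measure" and X :: "'b \<Rightarrow> real ^ 'm"
    and \<mu> :: "real ^ 'm" and S :: "real ^ 'm ^ 'm"
    and M :: "'a measure" and Xs :: "nat \<Rightarrow> 'a \<Rightarrow> real ^ 'm"
    and \<delta> :: real
  assumes f_nonneg: "\<And>x. 0 \<le> f x"
    and f_cont: "continuous_on UNIV f"
    and P: "prob_space P"
    and X: "distributed P lborel X f"
    and second_moments: "integrable P (\<lambda>\<omega>. norm (X \<omega>) ^ 2)"
    and mu: "\<mu> = integral\<^sup>L P X"
    and cov: "S = covariance_matrix P X"
    and H_finite: "finite_diff_entropy f"
    and f_bounded: "\<exists>C. \<forall>x. f x \<le> C"
    and delta: "\<delta> > 0" "integrable P (\<lambda>\<omega>. norm (X \<omega>) powr (real CARD('m) + \<delta>))"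
    and M: "prob_space M"
    and iid_indep: "prob_space.indep_vars M (\<lambda>_. borel) Xs {1..}"
    and iid_distr: "\<And>i. i \<ge> 1 \<Longrightarrow> distributed M lborel (Xs i) f"
  shows
    "(\<forall>k\<ge>1. tendsto_in_prob M (\<lambda>N \<omega>. T_KL k N (\<lambda>i. Xs i \<omega>))
               (diff_entropy (mvn_density \<mu> S) - diff_entropy f)) \<and>
     diff_entropy (mvn_density \<mu> S) - diff_entropy f = KL_div f (mvn_density \<mu> S) \<and>
     (mvn_distributed P X \<mu> S \<longrightarrow>
        (\<forall>k\<ge>1. tendsto_in_prob M (\<lambda>N \<omega>. T_KL k N (\<lambda>i. Xs i \<omega>)) 0)) \<and>
     ((\<nexists>a A. mvn_distributed P X a A) \<longrightarrow>
        (\<exists>\<xi>>0. \<forall>k\<ge>1. tendsto_in_prob M (\<lambda>N \<omega>. T_KL k N (\<lambda>i. Xs i \<omega>)) \<xi>))"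
proof -
  interpret P: prob_space P by (rule P)
  interpret M: prob_space M by (rule M)
  obtain C where C: "\<And>x. f x \<le> C" using f_bounded by blast
  have Xrv: "X \<in> borel_measurable P" using distributed_measurable[OF X] by simp
  have Xs1: "distributed M lborel (Xs 1) f" by (rule iid_distr) simp
  have Xsrv: "Xs 1 \<in> borel_measurable M" using distributed_measurable[OF Xs1] by simp
  \<comment> \<open>X and the sample are related only through the common density f; moment
    conditions move between the two probability spaces along it.\<close>
  have transfer: "integrable P (\<lambda>\<omega>. g (X \<omega>)) \<longleftrightarrow> integrable M (\<lambda>\<omega>. g (Xs 1 \<omega>))"
    if "g \<in> borel_measurable borel" for g :: "real ^ 'm \<Rightarrow> real"
    using distributed_integrable[OF X, of g] distributed_integrable[OF Xs1, of g] f_nonneg that by simp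
  have distr_borel: "distr Q borel Z = density lborel f" if "distributed Q lborel Z f" for Q :: "'c measure" and Z
    using distributed_distr_eq_density[OF that] by (metis distr_cong sets_lborel)
  have "prob_space (distr P borel X)" using Xrv by (rule P.prob_space_distr)
  then have D: "prob_space (density lborel (\<lambda>x. ennreal (f x)))" unfolding distr_borel[OF X] .
  interpret density_sample f C M Xs \<delta>
  proof (intro density_sample.intro bounded_density.intro density_sample_axioms.intro)
    show "integrable M (\<lambda>\<omega>. norm (Xs 1 \<omega>) powr (real CARD('m) + \<delta>))"
      using delta(2) by (subst transfer[symmetric]) auto
  qed (fact f_nonneg f_cont C D M iid_indep iid_distr delta(1))+
  have S: "symmetric_pos_def S" unfolding cov by (rule P.covariance_matrix_pos_def[OF X second_moments])
  have covM: "covariance_matrix M (Xs 1) = S"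
    unfolding cov using covariance_matrix_cong_distr(2)[OF Xrv Xsrv] distr_borel[OF X] distr_borel[OF Xs1] by simp
  let ?\<phi> = "mvn_density \<mu> S"
  have T: "tendsto_in_prob M (\<lambda>N \<omega>. T_KL k N (\<lambda>i. Xs i \<omega>)) (diff_entropy ?\<phi> - diff_entropy f)" if k: "1 \<le> k" for k
  proof -
    have "tendsto_in_prob M (\<lambda>N \<omega>. ln ((2 * pi * exp 1) ^ CARD('m) * det (sample_cov N (\<lambda>i. Xs i \<omega>))) / 2)
      (ln ((2 * pi * exp 1) ^ CARD('m) * det (covariance_matrix M (Xs 1))) / 2)"
    proof (rule M.ln_det_sample_cov_tendsto_in_prob[OF iid_indep])
      show "distr M borel (Xs i) = distr M borel (Xs 1)" if "1 \<le> i" for i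
        using distr_borel[OF iid_distr[OF that]] distr_borel[OF Xs1] by simp
      show "integrable M (\<lambda>\<omega>. norm (Xs 1 \<omega>) ^ 2)" using second_moments by (subst transfer[symmetric]) auto
      show "0 < det (covariance_matrix M (Xs 1))" unfolding covM by (rule symmetric_pos_def_det_pos[OF S])
    qed simp
    then have "tendsto_in_prob M (\<lambda>N \<omega>. ln ((2 * pi * exp 1) ^ CARD('m) * det (sample_cov N (\<lambda>i. Xs i \<omega>))) / 2) (diff_entropy ?\<phi>)"
      unfolding covM diff_entropy_mvn_density[OF S] .
    from M.tendsto_in_prob_diff[OF this KL_entropy_est_tendsto_in_prob[OF k H_finite]]
    show ?thesis unfolding T_KL_def .
  qed
  have KL: "diff_entropy ?\<phi> - diff_entropy f = KL_div f ?\<phi>"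
    using P.KL_div_mvn_density[OF X f_nonneg second_moments H_finite]
    by (simp add: KL_div_def has_bochner_integral_iff mu cov)
  have "diff_entropy ?\<phi> - diff_entropy f = 0" if "mvn_distributed P X \<mu> S"
  proof -
    have "distributed P lborel X ?\<phi>" using that by (simp add: mvn_distributed_def)
    then show ?thesis
      using P.diff_entropy_cong_distributed[OF X f_nonneg, of ?\<phi>] mvn_density_pos[OF S, of \<mu>] by (simp add: less_imp_le)
  qed
  \<comment> \<open>Absence of every normal law is applied to the one with the mean and covariance
    of X. The constant \<xi> is the divergence itself, hence the same for all k.\<close>
  moreover have "0 < diff_entropy ?\<phi> - diff_entropy f" if "\<nexists>a A. mvn_distributed P X a A"
    unfolding mu cov using that by (intro P.KL_div_mvn_density_pos[OF X f_nonneg second_moments H_finite]) auto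
  ultimately show ?thesis using T KL by metis
qed

end
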